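(* Let $n\ge 2$, let $r,s\in\mathbb{C}$ be nonzero with $r\neq s$, and let $V$ be the natural representation of $U_{r,s}(\mathfrak{sl}_n)$. Let $S^2_{r,s}(V)\subseteq V\otimes V$ be the span of $\{v_i\otimes v_i\mid 1\le i\le n\}\cup\{v_i\otimes v_j+s\,v_j\otimes v_i\mid 1\le i<j\le n\}$. Then for every $1\le k\le n-1$ there is an isomorphism of $U_{r,s}(\mathfrak{sl}_n)$-modules $$V^{\otimes k}\Big/\sum_{i=0}^{k-2}V^{\otimes i}\otimes S^2_{r,s}(V)\otimes V^{\otimes (k-i-2)}\;\cong\; V(\overline{\omega}_k),$$ where $V(\overline{\omega}_k)$ is the simple highest weight module with highest weight $\overline{\omega}_k=\epsilon_1+\cdots+\epsilon_k$.
   Context: Let $\epsilon_1,\dots,\epsilon_n$ be an orthonormal basis of a Euclidean space with inner product $\langle\,,\,\rangle$, and let $\alpha_j=\epsilon_j-\epsilon_{j+1}$ for $1\le j\le n-1$. The algebra $U_{r,s}(\mathfrak{sl}_n)$ is the unital associative $\mathbb{C}$-algebra generated by $e_i,f_i,\omega_i^{\pm1},(\omega_i')^{\pm1}$ ($1\le i<n$) with relations: (R1) the $\omega_i,\omega_i'$ are invertible and all commute with each other; (R2) $\omega_ie_j=r^{\langle \epsilon_i,\alpha_j\rangle}s^{\langle \epsilon_{i+1},\alpha_j\rangle}e_j\omega_i$ and $\omega_if_j=r^{-\langle \epsilon_i,\alpha_j\rangle}s^{-\langle \epsilon_{i+1},\alpha_j\rangle}f_j\omega_i$; (R3) $\omega_i'e_j=r^{\langle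 \epsilon_{i+1},\alpha_j\rangle}s^{\langle \epsilon_{i},\alpha_j\rangle}e_j\omega_i'$ and $\omega_i'f_j=r^{-\langle \epsilon_{i+1},\alpha_j\rangle}s^{-\langle \epsilon_{i},\alpha_j\rangle}f_j\omega_i'$; (R4) $[e_i,f_j]=\frac{\delta_{ij}}{r-s}(\omega_i-\omega_i')$; (R5) $[e_i,e_j]=[f_i,f_j]=0$ if $|i-j|>1$; (R6) $e_i^2e_{i+1}-(r+s)e_ie_{i+1}e_i+rs\,e_{i+1}e_i^2=0$ and $e_ie_{i+1}^2-(r+s)e_{i+1}e_ie_{i+1}+rs\,e_{i+1}^2e_i=0$; (R7) $f_i^2f_{i+1}-(r^{-1}+s^{-1})f_if_{i+1}f_i+r^{-1}s^{-1}f_{i+1}f_i^2=0$ and $f_if_{i+1}^2-(r^{-1}+s^{-1})f_{i+1}f_if_{i+1}+r^{-1}s^{-1}f_{i+1}^2f_i=0$. It is a Hopf algebra with $\omega_i,\omega_i'$ group-like, $\Delta(e_i)=e_i\otimes 1+\omega_i\otimes e_i$, $\Delta(f_i)=1\otimes f_i+f_i\otimes\omega_i'$, counit zero on $e_i$ and $f_i$, and antipode $S(e_i)=-\omega_i^{-1}e_i$, $S(f_i)=-f_i(\omega_i')^{-1}$. Tensor powers of modules are modules via iterated $\Delta$. The natural representation $V$ has basis $v_1,\dots,v_n$; with $E_{ij}v_k=\delta_{jk}v_i$, the action is $e_j=E_{j,j+1}$, $f_j=E_{j+1,j}$, $\omega_j=rE_{jj}+sE_{j+1,j+1}+\sum_{k\ne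 j,j+1}E_{kk}$, $\omega_j'=sE_{jj}+rE_{j+1,j+1}+\sum_{k\neq j,j+1}E_{kk}$ for $1\le j\le n-1$. The subspace $S^2_{r,s}(V)$ is a submodule of $V\otimes V$. For $k=1$ the sum in the claim is empty (equal to $0$). For $\lambda\in\bigoplus_{i=1}^{n-1}\mathbb{Z}\overline{\omega}_i$, where $\overline{\omega}_i=\epsilon_1+\cdots+\epsilon_i$, let $\widehat\lambda$ be the character of the subalgebra $U^0$ generated by the $\omega_i^{\pm1},(\omega_i')^{\pm1}$ given by $\widehat\lambda(\omega_i)=r^{\langle\epsilon_i,\lambda\rangle}s^{\langle\epsilon_{i+1},\lambda\rangle}$, $\widehat\lambda(\omega_i')=r^{\langle\epsilon_{i+1},\lambda\rangle}s^{\langle\epsilon_i,\lambda\rangle}$. The Verma module $M(\lambda)$ is the module induced from the one-dimensional module of the subalgebra generated by $U^0$ and all $e_i$ on which $U^0$ acts by $\widehat\lambda$ and every $e_i$ acts by $0$. $V(\lambda)$ denotes the simple quotient of $M(\lambda)$.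
   Formalization: When r/s is a root of unity the Verma module can have several non-isomorphic simple quotients (e.g. n=2, r=1, s=-1), so "the" simple module V(ϖ_k) is undefined; the formal theorem asserts an isomorphism with a simple quotient of M(ϖ_k), which is V(ϖ_k) whenever that is unique. *)

theory Defs
  imports Complex_Main "HOL-Library.Poly_Mapping" "HOL-Algebra.Module" "HOL-Algebra.QuotRing"
    "HOL-Algebra.Generated_Rings" "HOL-Algebra.Free_Abelian_Groups"
begin

section \<open>Left modules over a (not necessarily commutative) ring\<close>

text \<open>The locale \<^locale>\<open>module\<close> of the library requires a commutative ring; its record type, cosets
  and the locale \<^locale>\<open>submodule\<close> do not, and are reused. The multiplication and unit fields of
  the module records below carry no meaning.\<close>

locale left_module = R?: ring R + M?: abelian_group M
  for R :: "('a, 'b) ring_scheme" (structure) and M :: "('a, 'm) module" (structure) +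
  assumes smult_closed: "a \<in> carrier R \<Longrightarrow> x \<in> carrier M \<Longrightarrow> a \<odot>\<^bsub>M\<^esub> x \<in> carrier M"
    and smult_l_distr: "a \<in> carrier R \<Longrightarrow> b \<in> carrier R \<Longrightarrow> x \<in> carrier M \<Longrightarrow>
      (a \<oplus>\<^bsub>R\<^esub> b) \<odot>\<^bsub>M\<^esub> x = a \<odot>\<^bsub>M\<^esub> x \<oplus>\<^bsub>M\<^esub> b \<odot>\<^bsub>M\<^esub> x"
    and smult_r_distr: "a \<in> carrier R \<Longrightarrow> x \<in> carrier M \<Longrightarrow> y \<in> carrier M \<Longrightarrow>
      a \<odot>\<^bsub>M\<^esub> (x \<oplus>\<^bsub>M\<^esub> y) = a \<odot>\<^bsub>M\<^esub> x \<oplus>\<^bsub>M\<^esub> a \<odot>\<^bsub>M\<^esub> y"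
    and smult_assoc: "a \<in> carrier R \<Longrightarrow> b \<in> carrier R \<Longrightarrow> x \<in> carrier M \<Longrightarrow>
      (a \<otimes>\<^bsub>R\<^esub> b) \<odot>\<^bsub>M\<^esub> x = a \<odot>\<^bsub>M\<^esub> (b \<odot>\<^bsub>M\<^esub> x)"
    and smult_one: "x \<in> carrier M \<Longrightarrow> \<one>\<^bsub>R\<^esub> \<odot>\<^bsub>M\<^esub> x = x"

definition module_iso :: "('a, 'b) ring_scheme \<Rightarrow> ('a, 'm) module \<Rightarrow> ('a, 'l) module \<Rightarrow> bool" where
  "module_iso R M L \<longleftrightarrow> left_module R M \<and> left_module R L \<and>
     (\<exists>\<phi>. bij_betw \<phi> (carrier M) (carrier L) \<and>
        (\<forall>x\<in>carrier M. \<forall>y\<in>carrier M. \<phi> (x \<oplus>\<^bsub>M\<^esub> y) = \<phi> x \<oplus>\<^bsub>L\<^esub> \<phi> y) \<and>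
        (\<forall>a\<in>carrier R. \<forall>x\<in>carrier M. \<phi> (a \<odot>\<^bsub>M\<^esub> x) = a \<odot>\<^bsub>L\<^esub> \<phi> x))"

definition simple_module :: "('a, 'b) ring_scheme \<Rightarrow> ('a, 'm) module \<Rightarrow> bool" where
  "simple_module R M \<longleftrightarrow> left_module R M \<and> carrier M \<noteq> {\<zero>\<^bsub>M\<^esub>} \<and>
     (\<forall>N. submodule N R M \<longrightarrow> N = {\<zero>\<^bsub>M\<^esub>} \<or> N = carrier M)"

definition quot_module :: "('a, 'm) module \<Rightarrow> 'm set \<Rightarrow> ('a, 'm set) module" where
  "quot_module M N =
     \<lparr>carrier = a_rcosets\<^bsub>M\<^esub> N, monoid.mult = undefined, one = undefined, ring.zero = N, ring.add = set_add M,
      smult = (\<lambda>a S. \<Union>x\<in>S. N +>\<^bsub>M\<^esub> (a \<odot>\<^bsub>M\<^esub> x))\<rparr>"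

text \<open>A relation, not a function: the simple quotient of a Verma module is unique when \<open>r/s\<close> is
  not a root of unity, but need not be in general.\<close>

definition simple_quotient :: "('a, 'b) ring_scheme \<Rightarrow> ('a, 'm) module \<Rightarrow> ('a, 'm set) module \<Rightarrow> bool"
  where "simple_quotient R M L \<longleftrightarrow>
     (\<exists>N. submodule N R M \<and> L = quot_module M N \<and> simple_module R L)"

text \<open>The induced module: the tensor product over B of R with W, for B a subring of R and W a left
  B-module, as the free abelian group on pairs modulo the balanced bilinear relations.\<close>

definition balanced_rels ::
  "('a, 'b) ring_scheme \<Rightarrow> 'a set \<Rightarrow> ('a, 'w) module \<Rightarrow> (('a \<times> 'w) \<Rightarrow>\<^sub>0 int) set" where
  "balanced_rels R B W =
     {frag_of (a \<oplus>\<^bsub>R\<^esub> a', x) - frag_of (a, x) - frag_of (a', x) | a a' x.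
        a \<in> carrier R \<and> a' \<in> carrier R \<and> x \<in> carrier W} \<union>
     {frag_of (a, x \<oplus>\<^bsub>W\<^esub> y) - frag_of (a, x) - frag_of (a, y) | a x y.
        a \<in> carrier R \<and> x \<in> carrier W \<and> y \<in> carrier W} \<union>
     {frag_of (a \<otimes>\<^bsub>R\<^esub> b, x) - frag_of (a, b \<odot>\<^bsub>W\<^esub> x) | a b x.
        a \<in> carrier R \<and> b \<in> B \<and> x \<in> carrier W}"

definition induced_module ::
  "('a, 'b) ring_scheme \<Rightarrow> 'a set \<Rightarrow> ('a, 'w) module \<Rightarrow> ('a, (('a \<times> 'w) \<Rightarrow>\<^sub>0 int) set) module" where
  "induced_module R B W =
     (let G = free_Abelian_group (carrier R \<times> carrier W);
          K = generate G (balanced_rels R B W)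
      in \<lparr>carrier = rcosets\<^bsub>G\<^esub> K, monoid.mult = undefined, one = undefined, ring.zero = K, ring.add = set_mult G,
          smult = (\<lambda>u S. \<Union>x\<in>S. K #>\<^bsub>G\<^esub> frag_extend (\<lambda>(a, w). frag_of (u \<otimes>\<^bsub>R\<^esub> a, w)) x)\<rparr>)"


section \<open>Free associative algebras\<close>

text \<open>With the free monoid structure on lists, \<open>'a list \<Rightarrow>\<^sub>0 complex\<close> is the free
  associative unital algebra on \<open>'a\<close>, i.e. the tensor algebra of the vector space with basis
  \<open>'a\<close>; its product is concatenation, i.e. the tensor product of tensors.\<close>

instantiation list :: (type) monoid_add
begin
definition zero_list :: "'a list" where "zero_list = []"
definition plus_list :: "'a list \<Rightarrow> 'a list \<Rightarrow> 'a list" where "plus_list xs ys = xs @ ys"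
instance by standard (simp_all add: zero_list_def plus_list_def)
end

type_synonym 'a falg = "'a list \<Rightarrow>\<^sub>0 complex"

definition const :: "complex \<Rightarrow> 'a falg" where
  "const c = Poly_Mapping.single [] c"

definition mon :: "'a list \<Rightarrow> 'a falg" where
  "mon w = Poly_Mapping.single w 1"

definition tscale :: "complex \<Rightarrow> 'a falg \<Rightarrow> 'a falg" where
  "tscale c x = const c * x"

interpretation tvs: vector_space "tscale :: complex \<Rightarrow> 'a falg \<Rightarrow> 'a falg"
proof
  have one: "const 1 = (1 :: 'a falg)"
    unfolding const_def zero_list_def[symmetric] by simp
  show "tscale 1 x = x" for x :: "'a falg" by (simp add: tscale_def one)
  show "tscale a (tscale b x) = tscale (a * b) x" for a b and x :: "'a falg"
    by (simp add: tscale_def const_def mult_single plus_list_def flip: mult.assoc)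
  show "tscale (a + b) x = tscale a x + tscale b x" for a b and x :: "'a falg"
    by (simp add: tscale_def const_def single_add distrib_right)
  show "tscale a (x + y) = tscale a x + tscale a y" for a and x y :: "'a falg"
    by (simp add: tscale_def distrib_left)
qed

definition lin_ext :: "('a list \<Rightarrow> 'b falg) \<Rightarrow> 'a falg \<Rightarrow> 'b falg" where
  "lin_ext h x = (\<Sum>w\<in>Poly_Mapping.keys x. tscale (Poly_Mapping.lookup x w) (h w))"

definition class_ring :: "'a set \<Rightarrow> ('a::ring_1) ring" where
  "class_ring A = \<lparr>carrier = A, monoid.mult = (*), one = 1, ring.zero = 0, ring.add = (+)\<rparr>"


section \<open>Weights\<close>

text \<open>Integral vectors, given by their coordinates with respect to \<open>\<epsilon>\<^sub>1, \<dots>, \<epsilon>\<^sub>n\<close>.\<close>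

definition ip :: "nat \<Rightarrow> (nat \<Rightarrow> int) \<Rightarrow> (nat \<Rightarrow> int) \<Rightarrow> int" where
  "ip n x y = (\<Sum>m=1..n. x m * y m)"

definition eps :: "nat \<Rightarrow> nat \<Rightarrow> int" where
  "eps i = (\<lambda>m. if m = i then 1 else 0)"

definition alpha :: "nat \<Rightarrow> nat \<Rightarrow> int" where
  "alpha j = (\<lambda>m. eps j m - eps (j + 1) m)"

definition fund_weight :: "nat \<Rightarrow> nat \<Rightarrow> int" where
  "fund_weight k = (\<lambda>m. \<Sum>i=1..k. eps i m)"


section \<open>The algebra $U_{r,s}(sl_n)$\<close>

text \<open>\<open>GW i, GWinv i, GW' i, GWinv' i\<close> stand for \<open>\<omega>\<^sub>i\<close>, its inverse, \<open>\<omega>'\<^sub>i\<close> and its inverse.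
  The generators for rank \<open>n\<close> are those with index in \<open>{1..<n}\<close>.\<close>

datatype gen = GE nat | GF nat | GW nat | GWinv nat | GW' nat | GWinv' nat

definition gens :: "nat \<Rightarrow> gen set" where
  "gens n = (\<Union>i\<in>{1..<n}. {GE i, GF i, GW i, GWinv i, GW' i, GWinv' i})"

definition cartan_gens :: "nat \<Rightarrow> gen set" where
  "cartan_gens n = (\<Union>i\<in>{1..<n}. {GW i, GWinv i, GW' i, GWinv' i})"

definition free_alg :: "nat \<Rightarrow> gen falg ring" where
  "free_alg n = class_ring {p. Poly_Mapping.keys p \<subseteq> lists (gens n)}"

abbreviation eg :: "nat \<Rightarrow> gen falg" where "eg i \<equiv> mon [GE i]"
abbreviation fg :: "nat \<Rightarrow> gen falg" where "fg i \<equiv> mon [GF i]"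
abbreviation wg :: "nat \<Rightarrow> gen falg" where "wg i \<equiv> mon [GW i]"
abbreviation wg' :: "nat \<Rightarrow> gen falg" where "wg' i \<equiv> mon [GW' i]"

definition R1 :: "nat \<Rightarrow> gen falg set" where
  "R1 n = {mon [g] * mon [h] - mon [h] * mon [g] | g h. g \<in> cartan_gens n \<and> h \<in> cartan_gens n} \<union>
     (\<Union>i\<in>{1..<n}. {mon [GW i] * mon [GWinv i] - 1, mon [GWinv i] * mon [GW i] - 1,
                    mon [GW' i] * mon [GWinv' i] - 1, mon [GWinv' i] * mon [GW' i] - 1})"

definition R2 :: "nat \<Rightarrow> complex \<Rightarrow> complex \<Rightarrow> gen falg set" where
  "R2 n r s = (\<Union>i\<in>{1..<n}. \<Union>j\<in>{1..<n}.
     {wg i * eg j - const (r powi ip n (eps i) (alpha j) * s powi ip n (eps (i+1)) (alpha j)) * eg j * wg i,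
      wg i * fg j - const (r powi (- ip n (eps i) (alpha j)) * s powi (- ip n (eps (i+1)) (alpha j))) * fg j * wg i})"

definition R3 :: "nat \<Rightarrow> complex \<Rightarrow> complex \<Rightarrow> gen falg set" where
  "R3 n r s = (\<Union>i\<in>{1..<n}. \<Union>j\<in>{1..<n}.
     {wg' i * eg j - const (r powi ip n (eps (i+1)) (alpha j) * s powi ip n (eps i) (alpha j)) * eg j * wg' i,
      wg' i * fg j - const (r powi (- ip n (eps (i+1)) (alpha j)) * s powi (- ip n (eps i) (alpha j))) * fg j * wg' i})"

definition R4 :: "nat \<Rightarrow> complex \<Rightarrow> complex \<Rightarrow> gen falg set" where
  "R4 n r s = (\<Union>i\<in>{1..<n}. \<Union>j\<in>{1..<n}.
     {(eg i * fg j - fg j * eg i) - const ((if i = j then 1 else 0) / (r - s)) * (wg i - wg' i)})"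

definition R5 :: "nat \<Rightarrow> gen falg set" where
  "R5 n = (\<Union>i\<in>{1..<n}. \<Union>j\<in>{j\<in>{1..<n}. \<bar>int i - int j\<bar> > 1}.
     {eg i * eg j - eg j * eg i, fg i * fg j - fg j * fg i})"

definition R6 :: "nat \<Rightarrow> complex \<Rightarrow> complex \<Rightarrow> gen falg set" where
  "R6 n r s = (\<Union>i\<in>{i. 1 \<le> i \<and> i + 1 < n}.
     {eg i ^ 2 * eg (i+1) - const (r + s) * eg i * eg (i+1) * eg i + const (r * s) * eg (i+1) * eg i ^ 2,
      eg i * eg (i+1) ^ 2 - const (r + s) * eg (i+1) * eg i * eg (i+1) + const (r * s) * eg (i+1) ^ 2 * eg i})"

definition R7 :: "nat \<Rightarrow> complex \<Rightarrow> complex \<Rightarrow> gen falg set" where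
  "R7 n r s = (\<Union>i\<in>{i. 1 \<le> i \<and> i + 1 < n}.
     {fg i ^ 2 * fg (i+1) - const (inverse r + inverse s) * fg i * fg (i+1) * fg i
        + const (inverse r * inverse s) * fg (i+1) * fg i ^ 2,
      fg i * fg (i+1) ^ 2 - const (inverse r + inverse s) * fg (i+1) * fg i * fg (i+1)
        + const (inverse r * inverse s) * fg (i+1) ^ 2 * fg i})"

definition rel_ideal :: "nat \<Rightarrow> complex \<Rightarrow> complex \<Rightarrow> gen falg set" where
  "rel_ideal n r s = Idl\<^bsub>free_alg n\<^esub>
     (R1 n \<union> R2 n r s \<union> R3 n r s \<union> R4 n r s \<union> R5 n \<union> R6 n r s \<union> R7 n r s)"

text \<open>The complex scalars sit inside \<open>Urs\<close> as the classes of the constants, so unital modules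
  over the ring \<open>Urs\<close> and their homomorphisms are automatically complex-linear.\<close>

definition Urs :: "nat \<Rightarrow> complex \<Rightarrow> complex \<Rightarrow> gen falg set ring" where
  "Urs n r s = free_alg n Quot rel_ideal n r s"

definition cls :: "nat \<Rightarrow> complex \<Rightarrow> complex \<Rightarrow> gen falg \<Rightarrow> gen falg set" where
  "cls n r s p = rel_ideal n r s +>\<^bsub>free_alg n\<^esub> p"


section \<open>Tensor powers of the natural representation\<close>

text \<open>The basis vector \<open>v\<^sub>i\<close> is \<open>mon [i]\<close>; the tensor of the basis vectors with indices in
  a list is \<open>mon\<close> of this list.\<close>

text \<open>The matrix unit $E_{ij}$ applied to $v_a$.\<close>
definition munit :: "nat \<Rightarrow> nat \<Rightarrow> nat \<Rightarrow> nat falg" where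
  "munit i j a = (if j = a then mon [i] else 0)"

definition diag :: "nat \<Rightarrow> nat \<Rightarrow> complex \<Rightarrow> complex \<Rightarrow> nat \<Rightarrow> nat falg" where
  "diag n j c d a = tscale c (munit j j a) + tscale d (munit (j+1) (j+1) a)
     + (\<Sum>m\<in>{1..n} - {j, j+1}. munit m m a)"

primrec nat_gen :: "nat \<Rightarrow> complex \<Rightarrow> complex \<Rightarrow> gen \<Rightarrow> nat \<Rightarrow> nat falg" where
  "nat_gen n r s (GE j) = munit j (j+1)"
| "nat_gen n r s (GF j) = munit (j+1) j"
| "nat_gen n r s (GW j) = diag n j r s"
| "nat_gen n r s (GWinv j) = diag n j (inverse r) (inverse s)"
| "nat_gen n r s (GW' j) = diag n j s r"
| "nat_gen n r s (GWinv' j) = diag n j (inverse s) (inverse r)"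

definition nat_op :: "nat \<Rightarrow> complex \<Rightarrow> complex \<Rightarrow> gen \<Rightarrow> nat falg \<Rightarrow> nat falg" where
  "nat_op n r s g = lin_ext (\<lambda>u. nat_gen n r s g (hd u))"

text \<open>The coproduct of a generator, as a sum (list) of pure tensors of words.\<close>

primrec comult :: "gen \<Rightarrow> (gen list \<times> gen list) list" where
  "comult (GE i) = [([GE i], []), ([GW i], [GE i])]"
| "comult (GF i) = [([], [GF i]), ([GF i], [GW' i])]"
| "comult (GW i) = [([GW i], [GW i])]"
| "comult (GWinv i) = [([GWinv i], [GWinv i])]"
| "comult (GW' i) = [([GW' i], [GW' i])]"
| "comult (GWinv' i) = [([GWinv' i], [GWinv' i])]"

primrec counit :: "gen \<Rightarrow> complex" where
  "counit (GE i) = 0"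
| "counit (GF i) = 0"
| "counit (GW i) = 1"
| "counit (GWinv i) = 1"
| "counit (GW' i) = 1"
| "counit (GWinv' i) = 1"

text \<open>\<open>A \<otimes> B\<close> for operators \<open>A\<close> on \<open>V\<close> and \<open>B\<close> on a tensor power of \<open>V\<close>.\<close>
definition tensor_op ::
  "(nat falg \<Rightarrow> nat falg) \<Rightarrow> (nat falg \<Rightarrow> nat falg) \<Rightarrow> nat falg \<Rightarrow> nat falg" where
  "tensor_op A B = lin_ext (\<lambda>u. A (mon [hd u]) * B (mon (tl u)))"

text \<open>The action of a generator on the \<open>k\<close>-th tensor power: the trivial representation for
  \<open>k = 0\<close>, then \<open>\<rho>\<^sub>k\<^sub>+\<^sub>1 = (\<rho>\<^sub>1 \<otimes> \<rho>\<^sub>k) \<circ> \<Delta>\<close>. As \<open>\<Delta>\<close> is an algebra map, this suffices on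
  generators; a word acts by composition (\<open>foldr\<close>).\<close>

primrec tens_op :: "nat \<Rightarrow> complex \<Rightarrow> complex \<Rightarrow> nat \<Rightarrow> gen \<Rightarrow> nat falg \<Rightarrow> nat falg" where
  "tens_op n r s 0 g = tscale (counit g)"
| "tens_op n r s (Suc k) g = (\<lambda>x. \<Sum>(p, q)\<leftarrow>comult g.
     tensor_op (foldr (nat_op n r s) p) (foldr (tens_op n r s k) q) x)"

definition free_act :: "nat \<Rightarrow> complex \<Rightarrow> complex \<Rightarrow> nat \<Rightarrow> gen falg \<Rightarrow> nat falg \<Rightarrow> nat falg" where
  "free_act n r s k p x = lin_ext (\<lambda>u. foldr (tens_op n r s k) u x) p"

definition tens_space :: "nat \<Rightarrow> nat \<Rightarrow> nat falg set" where
  "tens_space n k = {x. \<forall>u\<in>Poly_Mapping.keys x. length u = k \<and> set u \<subseteq> {1..n}}"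

text \<open>An element of \<open>Urs\<close> is a coset; it acts through any of its representatives.\<close>
definition tens_power :: "nat \<Rightarrow> complex \<Rightarrow> complex \<Rightarrow> nat \<Rightarrow> (gen falg set, nat falg) module" where
  "tens_power n r s k =
     \<lparr>carrier = tens_space n k, monoid.mult = undefined, one = undefined, ring.zero = 0, ring.add = (+),
      smult = (\<lambda>u x. THE y. \<exists>p\<in>u. y = free_act n r s k p x)\<rparr>"

definition S2 :: "nat \<Rightarrow> complex \<Rightarrow> nat falg set" where
  "S2 n s = tvs.span ({mon [i] * mon [i] | i. i \<in> {1..n}} \<union>
     {mon [i] * mon [j] + tscale s (mon [j] * mon [i]) | i j. i \<in> {1..n} \<and> j \<in> {1..n} \<and> i < j})"

definition tens_sub :: "nat falg set \<Rightarrow> nat falg set \<Rightarrow> nat falg set" where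
  "tens_sub A B = tvs.span {x * y | x y. x \<in> A \<and> y \<in> B}"

text \<open>The sum over \<open>i\<close> from 0 to \<open>k - 2\<close>; for \<open>k = 1\<close> it is the zero subspace.\<close>
definition sym_sum :: "nat \<Rightarrow> complex \<Rightarrow> nat \<Rightarrow> nat falg set" where
  "sym_sum n s k = tvs.span (\<Union>i\<in>{i. i + 2 \<le> k}.
     tens_sub (tens_sub (tens_space n i) (S2 n s)) (tens_space n (k - i - 2)))"


section \<open>Verma modules\<close>

definition borel_subalg :: "nat \<Rightarrow> complex \<Rightarrow> complex \<Rightarrow> gen falg set set" where
  "borel_subalg n r s = generate_ring (Urs n r s)
     (range (\<lambda>c. cls n r s (const c)) \<union> (\<lambda>g. cls n r s (mon [g])) ` (cartan_gens n \<union> GE ` {1..<n}))"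

text \<open>The algebra homomorphism by which \<open>borel_subalg\<close> acts on the one-dimensional module: the character
  $\hat\lambda$ on $U^0$, zero on the \<open>eg i\<close>. Its values on \<open>borel_subalg\<close> are determined by these conditions.\<close>

definition is_borel_char ::
  "nat \<Rightarrow> complex \<Rightarrow> complex \<Rightarrow> (nat \<Rightarrow> int) \<Rightarrow> (gen falg set \<Rightarrow> complex) \<Rightarrow> bool" where
  "is_borel_char n r s lam chi \<longleftrightarrow>
     chi \<in> ring_hom ((Urs n r s)\<lparr>carrier := borel_subalg n r s\<rparr>) (class_ring UNIV) \<and>
     (\<forall>c. chi (cls n r s (const c)) = c) \<and>
     (\<forall>i\<in>{1..<n}.
        chi (cls n r s (wg i)) = r powi ip n (eps i) lam * s powi ip n (eps (i+1)) lam \<and>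
        chi (cls n r s (wg' i)) = r powi ip n (eps (i+1)) lam * s powi ip n (eps i) lam \<and>
        chi (cls n r s (eg i)) = 0)"

definition one_dim_module ::
  "nat \<Rightarrow> complex \<Rightarrow> complex \<Rightarrow> (nat \<Rightarrow> int) \<Rightarrow> (gen falg set, complex) module" where
  "one_dim_module n r s lam =
     \<lparr>carrier = UNIV, monoid.mult = undefined, one = undefined, ring.zero = 0, ring.add = (+),
      smult = (\<lambda>b c. (SOME chi. is_borel_char n r s lam chi) b * c)\<rparr>"

definition verma ::
  "nat \<Rightarrow> complex \<Rightarrow> complex \<Rightarrow> (nat \<Rightarrow> int) \<Rightarrow>
   (gen falg set, ((gen falg set \<times> complex) \<Rightarrow>\<^sub>0 int) set) module" where
  "verma n r s lam = induced_module (Urs n r s) (borel_subalg n r s) (one_dim_module n r s lam)"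

end

theory Submission
  imports Defs
begin

text \<open>Modulo \<open>sym_sum\<close> every word in the basis vectors becomes a multiple of a strictly increasing one,
  since adjacent letters may be swapped at the cost of a factor \<open>- 1 / s\<close> and repeated adjacent letters
  vanish. On an increasing word \<open>e\<^sub>i\<close> either vanishes or replaces the letter \<open>i + 1\<close> by \<open>i\<close>, up to a
  nonzero scalar, and it does so injectively. Hence applying \<open>e\<^sub>i\<close>'s to a nonzero combination of
  increasing words, as long as some \<open>e\<^sub>i\<close> acts nontrivially, ends at the word \<open>1 2 \<dots> k\<close>; from there the
  \<open>f\<^sub>i\<close> reach all other increasing words. So every vector outside \<open>sym_sum\<close> generates the quotient, which
  is simple without any genericity assumption on \<open>r\<close> and \<open>s\<close>. That it is nonzero is seen by the functional
  sending a word without repetitions to \<open>(- 1 / s)\<close> to the number of its inversions. The Borel subalgebra acts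
  on the class of \<open>1 2 \<dots> k\<close> by a character, which both shows that the character defining the Verma module
  exists and yields the surjection from the Verma module.\<close>

subsection \<open>Quotient modules and induced modules\<close>

text \<open>Two choices hidden in the definitions shape the proof. The action on a tensor power is a
  definite description over the representatives of a coset, so it is first replaced by operators on
  the whole tensor algebra. There the coproduct becomes a twisted product rule for concatenation,
  and each defining relation becomes an identity that is proved one letter at a time. The
  one-dimensional module of the Borel subalgebra uses some character picked by \<open>SOME\<close>,
  so existence of one character is only half of the matter: every character with the prescribed
  values must be shown to agree with the action on the class of 1 2 ... k. The constant s of the
  symmetric square is the eigenvalue of \<omega>_i on v_(i+1): applying e_i to v_(i+1) \<otimes>
  v_(i+1) gives v_i \<otimes> v_(i+1) + s v_(i+1) \<otimes> v_i. The passage to the word 1 2 ... k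
  terminates because the sum of all letters of all words in the support drops at each step.
  Injectivity is what rules out cancellation between different words.\<close>

definition left_module_hom ::
  "('a, 'b) ring_scheme \<Rightarrow> ('a, 'm) module \<Rightarrow> ('a, 'l) module \<Rightarrow> ('m \<Rightarrow> 'l) \<Rightarrow> bool" where
  "left_module_hom R M L \<phi> \<longleftrightarrow> (\<forall>x\<in>carrier M. \<phi> x \<in> carrier L) \<and>
     (\<forall>x\<in>carrier M. \<forall>y\<in>carrier M. \<phi> (x \<oplus>\<^bsub>M\<^esub> y) = \<phi> x \<oplus>\<^bsub>L\<^esub> \<phi> y) \<and>
     (\<forall>a\<in>carrier R. \<forall>x\<in>carrier M. \<phi> (a \<odot>\<^bsub>M\<^esub> x) = a \<odot>\<^bsub>L\<^esub> \<phi> x)"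

lemma left_module_homI:
  assumes "\<And>x. x \<in> carrier M \<Longrightarrow> \<phi> x \<in> carrier L"
    and "\<And>x y. x \<in> carrier M \<Longrightarrow> y \<in> carrier M \<Longrightarrow> \<phi> (x \<oplus>\<^bsub>M\<^esub> y) = \<phi> x \<oplus>\<^bsub>L\<^esub> \<phi> y"
    and "\<And>a x. a \<in> carrier R \<Longrightarrow> x \<in> carrier M \<Longrightarrow> \<phi> (a \<odot>\<^bsub>M\<^esub> x) = a \<odot>\<^bsub>L\<^esub> \<phi> x"
  shows "left_module_hom R M L \<phi>"
  using assms by (simp add: left_module_hom_def)

lemma left_module_homD:
  assumes "left_module_hom R M L \<phi>"
  shows "x \<in> carrier M \<Longrightarrow> \<phi> x \<in> carrier L"
    and "x \<in> carrier M \<Longrightarrow> y \<in> carrier M \<Longrightarrow> \<phi> (x \<oplus>\<^bsub>M\<^esub> y) = \<phi> x \<oplus>\<^bsub>L\<^esub> \<phi> y"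
    and "a \<in> carrier R \<Longrightarrow> x \<in> carrier M \<Longrightarrow> \<phi> (a \<odot>\<^bsub>M\<^esub> x) = a \<odot>\<^bsub>L\<^esub> \<phi> x"
  using assms by (simp_all add: left_module_hom_def)

lemma module_iso_iff:
  "module_iso R M L \<longleftrightarrow> left_module R M \<and> left_module R L \<and>
     (\<exists>\<phi>. bij_betw \<phi> (carrier M) (carrier L) \<and> left_module_hom R M L \<phi>)"
  unfolding module_iso_def left_module_hom_def by (simp add: bij_betw_apply cong: conj_cong)

text \<open>The module axioms modulo a subgroup \<open>N\<close>. Besides ordinary quotients this covers the induced module:
  on the free abelian group on pairs, scalar multiplication is distributive only modulo the relations.\<close>

locale module_mod = R?: ring R + M?: abelian_subgroup N M
  for R :: "('a, 'b) ring_scheme" (structure) and M :: "('a, 'm) module" (structure) and N +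
  assumes smult_closed: "a \<in> carrier R \<Longrightarrow> x \<in> carrier M \<Longrightarrow> a \<odot>\<^bsub>M\<^esub> x \<in> carrier M"
    and smult_r_distr: "a \<in> carrier R \<Longrightarrow> x \<in> carrier M \<Longrightarrow> y \<in> carrier M \<Longrightarrow>
      a \<odot>\<^bsub>M\<^esub> (x \<oplus>\<^bsub>M\<^esub> y) = a \<odot>\<^bsub>M\<^esub> x \<oplus>\<^bsub>M\<^esub> a \<odot>\<^bsub>M\<^esub> y"
    and smult_sub: "a \<in> carrier R \<Longrightarrow> x \<in> N \<Longrightarrow> a \<odot>\<^bsub>M\<^esub> x \<in> N"
    and smult_l_distr: "a \<in> carrier R \<Longrightarrow> b \<in> carrier R \<Longrightarrow> x \<in> carrier M \<Longrightarrow>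
      N +>\<^bsub>M\<^esub> (a \<oplus>\<^bsub>R\<^esub> b) \<odot>\<^bsub>M\<^esub> x = N +>\<^bsub>M\<^esub> (a \<odot>\<^bsub>M\<^esub> x \<oplus>\<^bsub>M\<^esub> b \<odot>\<^bsub>M\<^esub> x)"
    and smult_assoc: "a \<in> carrier R \<Longrightarrow> b \<in> carrier R \<Longrightarrow> x \<in> carrier M \<Longrightarrow>
      N +>\<^bsub>M\<^esub> (a \<otimes>\<^bsub>R\<^esub> b) \<odot>\<^bsub>M\<^esub> x = N +>\<^bsub>M\<^esub> a \<odot>\<^bsub>M\<^esub> (b \<odot>\<^bsub>M\<^esub> x)"
    and smult_one: "x \<in> carrier M \<Longrightarrow> N +>\<^bsub>M\<^esub> \<one>\<^bsub>R\<^esub> \<odot>\<^bsub>M\<^esub> x = N +>\<^bsub>M\<^esub> x"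
begin

abbreviation Q where "Q \<equiv> quot_module M N"

lemma carrier_quot: "carrier Q = (\<lambda>x. N +>\<^bsub>M\<^esub> x) ` carrier M"
  by (auto simp: quot_module_def A_RCOSETS_def')

lemma quot_memE:
  assumes "X \<in> carrier Q"
  obtains x where "x \<in> carrier M" "X = N +>\<^bsub>M\<^esub> x"
  using assms by (auto simp: carrier_quot)

lemma coset_eqI: "h \<in> N \<Longrightarrow> x \<in> carrier M \<Longrightarrow> N +>\<^bsub>M\<^esub> (h \<oplus>\<^bsub>M\<^esub> x) = N +>\<^bsub>M\<^esub> x"
  using a_repr_independence[OF a_rcosI[OF _ a_subset] _ a_subgroup] by metis

lemma coset_eq_iff:
  assumes "x \<in> carrier M" "y \<in> carrier M"
  shows "N +>\<^bsub>M\<^esub> x = N +>\<^bsub>M\<^esub> y \<longleftrightarrow> x \<ominus>\<^bsub>M\<^esub> y \<in> N"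
proof
  assume "N +>\<^bsub>M\<^esub> x = N +>\<^bsub>M\<^esub> y"
  then have "N +>\<^bsub>M\<^esub> (x \<oplus>\<^bsub>M\<^esub> \<ominus>\<^bsub>M\<^esub> y) = N"
    by (rule a_coset_add_inv2[OF _ assms a_subset])
  then show "x \<ominus>\<^bsub>M\<^esub> y \<in> N"
    using a_coset_join1[OF _ _ a_subgroup] assms by (simp add: a_minus_def)
next
  assume *: "x \<ominus>\<^bsub>M\<^esub> y \<in> N"
  have "(x \<ominus>\<^bsub>M\<^esub> y) \<oplus>\<^bsub>M\<^esub> y = x"
    using assms by (simp add: a_minus_def M.a_assoc M.l_neg)
  then show "N +>\<^bsub>M\<^esub> x = N +>\<^bsub>M\<^esub> y"
    using coset_eqI[OF * assms(2)] by simp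
qed

lemma quot_add:
  "x \<in> carrier M \<Longrightarrow> y \<in> carrier M \<Longrightarrow>
    (N +>\<^bsub>M\<^esub> x) \<oplus>\<^bsub>Q\<^esub> (N +>\<^bsub>M\<^esub> y) = N +>\<^bsub>M\<^esub> (x \<oplus>\<^bsub>M\<^esub> y)"
  using a_rcos_sum by (simp add: quot_module_def)

lemma quot_zero: "\<zero>\<^bsub>Q\<^esub> = N +>\<^bsub>M\<^esub> \<zero>\<^bsub>M\<^esub>"
  using a_coset_add_zero[OF a_subset] by (simp add: quot_module_def)

text \<open>All members of a coset contribute the same coset to the union in
  \<open>quot_module\<close>: they differ by an element of \<open>N\<close>, and scalars are
  additive and preserve \<open>N\<close>.\<close>

lemma quot_smult:
  assumes "a \<in> carrier R" "x \<in> carrier M"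
  shows "a \<odot>\<^bsub>Q\<^esub> (N +>\<^bsub>M\<^esub> x) = N +>\<^bsub>M\<^esub> (a \<odot>\<^bsub>M\<^esub> x)"
proof -
  have "N +>\<^bsub>M\<^esub> (a \<odot>\<^bsub>M\<^esub> y) = N +>\<^bsub>M\<^esub> (a \<odot>\<^bsub>M\<^esub> x)" if "y \<in> N +>\<^bsub>M\<^esub> x" for y
  proof -
    from that obtain h where h: "h \<in> N" "y = h \<oplus>\<^bsub>M\<^esub> x" by (auto simp: a_r_coset_def')
    then have "h \<in> carrier M" using a_subset by auto
    then show ?thesis
      using h assms by (simp add: smult_r_distr coset_eqI smult_sub smult_closed)
  qed
  moreover have "x \<in> N +>\<^bsub>M\<^esub> x" using assms a_rcos_self by blast
  ultimately have "(\<Union>y\<in>N +>\<^bsub>M\<^esub> x. N +>\<^bsub>M\<^esub> (a \<odot>\<^bsub>M\<^esub> y)) = N +>\<^bsub>M\<^esub> (a \<odot>\<^bsub>M\<^esub> x)"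
    by (intro UN_constant_eq[of x]) blast+
  then show ?thesis by (simp add: quot_module_def)
qed

lemma coset_in_quot: "x \<in> carrier M \<Longrightarrow> N +>\<^bsub>M\<^esub> x \<in> carrier Q"
  by (simp add: carrier_quot)

lemma quot_left_module: "left_module R Q"
proof -
  have "\<exists>Y\<in>carrier Q. Y \<oplus>\<^bsub>Q\<^esub> X = \<zero>\<^bsub>Q\<^esub>" if X: "X \<in> carrier Q" for X
  proof -
    obtain x where x: "x \<in> carrier M" "X = N +>\<^bsub>M\<^esub> x" using quot_memE[OF X] by blast
    then have "(N +>\<^bsub>M\<^esub> (\<ominus>\<^bsub>M\<^esub> x)) \<oplus>\<^bsub>Q\<^esub> X = \<zero>\<^bsub>Q\<^esub>"
      by (simp add: quot_add quot_zero M.l_neg)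
    then show ?thesis using x by (auto simp: carrier_quot)
  qed
  then have "abelian_group Q"
    by (intro abelian_groupI) (auto simp: carrier_quot quot_add quot_zero M.a_ac)
  then interpret Q: abelian_group Q .
  show ?thesis
  proof unfold_locales
    fix a X assume a: "a \<in> carrier R" and X: "X \<in> carrier Q"
    obtain x where x: "x \<in> carrier M" "X = N +>\<^bsub>M\<^esub> x" using quot_memE[OF X] by blast
    show "a \<odot>\<^bsub>Q\<^esub> X \<in> carrier Q"
      by (simp add: a x quot_smult coset_in_quot smult_closed)
    show "a \<odot>\<^bsub>Q\<^esub> (X \<oplus>\<^bsub>Q\<^esub> Y) = a \<odot>\<^bsub>Q\<^esub> X \<oplus>\<^bsub>Q\<^esub> a \<odot>\<^bsub>Q\<^esub> Y" if Y: "Y \<in> carrier Q" for Y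
    proof -
      obtain y where y: "y \<in> carrier M" "Y = N +>\<^bsub>M\<^esub> y" using quot_memE[OF Y] by blast
      then show ?thesis by (simp add: a x quot_smult quot_add smult_r_distr smult_closed)
    qed
    fix b assume b: "b \<in> carrier R"
    show "(a \<oplus>\<^bsub>R\<^esub> b) \<odot>\<^bsub>Q\<^esub> X = a \<odot>\<^bsub>Q\<^esub> X \<oplus>\<^bsub>Q\<^esub> b \<odot>\<^bsub>Q\<^esub> X"
      by (simp add: a b x quot_smult quot_add smult_l_distr smult_closed)
    show "(a \<otimes>\<^bsub>R\<^esub> b) \<odot>\<^bsub>Q\<^esub> X = a \<odot>\<^bsub>Q\<^esub> (b \<odot>\<^bsub>Q\<^esub> X)"
      by (simp add: a b x quot_smult smult_assoc smult_closed)
  next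
    fix X assume "X \<in> carrier Q"
    then obtain x where x: "x \<in> carrier M" "X = N +>\<^bsub>M\<^esub> x" by (rule quot_memE) blast
    show "\<one>\<^bsub>R\<^esub> \<odot>\<^bsub>Q\<^esub> X = X"
      by (simp add: x quot_smult smult_one)
  qed
qed

text \<open>Stated inside \<open>module_mod\<close>, so that it also serves maps out of the free
  abelian group on pairs, where \<open>M\<close> is a module only after passing to cosets.\<close>

lemma quot_hom:
  assumes vanish: "\<And>x. x \<in> N \<Longrightarrow> \<phi> x = \<zero>\<^bsub>L\<^esub>" and L: "left_module R L" and hom: "left_module_hom R M L \<phi>"
  shows "\<exists>\<Phi>. left_module_hom R Q L \<Phi> \<and> (\<forall>x\<in>carrier M. \<Phi> (N +>\<^bsub>M\<^esub> x) = \<phi> x)"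
proof -
  note closed = left_module_homD(1)[OF hom] and add = left_module_homD(2)[OF hom] and smult = left_module_homD(3)[OF hom]
  interpret L: left_module R L by (rule L)
  \<comment> \<open>An arbitrary representative; two of them differ by an element of
    \<open>N\<close>, which \<phi> kills.\<close>
  define \<Phi> where "\<Phi> X = \<phi> (SOME x. x \<in> X)" for X
  have key: "\<Phi> (N +>\<^bsub>M\<^esub> x) = \<phi> x" if x: "x \<in> carrier M" for x
  proof -
    have "x \<in> N +>\<^bsub>M\<^esub> x" using x a_rcos_self by blast
    then have "(SOME y. y \<in> N +>\<^bsub>M\<^esub> x) \<in> N +>\<^bsub>M\<^esub> x" by (rule someI)
    then obtain h where h: "h \<in> N" "(SOME y. y \<in> N +>\<^bsub>M\<^esub> x) = h \<oplus>\<^bsub>M\<^esub> x"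
      by (auto simp: a_r_coset_def')
    then have "h \<in> carrier M" using a_subset by auto
    then show ?thesis using h x by (simp add: \<Phi>_def add vanish closed)
  qed
  have "left_module_hom R Q L \<Phi>"
  proof (rule left_module_homI)
    fix X assume "X \<in> carrier Q"
    then obtain x where x: "x \<in> carrier M" "X = N +>\<^bsub>M\<^esub> x" by (rule quot_memE) blast
    show "\<Phi> X \<in> carrier L" by (simp add: x key closed)
    show "\<Phi> (a \<odot>\<^bsub>Q\<^esub> X) = a \<odot>\<^bsub>L\<^esub> \<Phi> X" if "a \<in> carrier R" for a
      using that by (simp add: x key quot_smult smult_closed smult)
    fix Y assume "Y \<in> carrier Q"
    then obtain y where y: "y \<in> carrier M" "Y = N +>\<^bsub>M\<^esub> y" by (rule quot_memE) blast
    show "\<Phi> (X \<oplus>\<^bsub>Q\<^esub> Y) = \<Phi> X \<oplus>\<^bsub>L\<^esub> \<Phi> Y"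
      by (simp add: x y key quot_add add)
  qed
  with key show ?thesis by blast
qed

end

section \<open>The first isomorphism theorem and simplicity of quotients\<close>

lemma (in left_module) smult_r_zero:
  assumes "a \<in> carrier R"
  shows "a \<odot>\<^bsub>M\<^esub> \<zero>\<^bsub>M\<^esub> = \<zero>\<^bsub>M\<^esub>"
proof -
  have "a \<odot>\<^bsub>M\<^esub> \<zero>\<^bsub>M\<^esub> \<oplus>\<^bsub>M\<^esub> a \<odot>\<^bsub>M\<^esub> \<zero>\<^bsub>M\<^esub> = a \<odot>\<^bsub>M\<^esub> \<zero>\<^bsub>M\<^esub>"
    using smult_r_distr[OF assms, of "\<zero>\<^bsub>M\<^esub>" "\<zero>\<^bsub>M\<^esub>"] by simp
  then show ?thesis
    using M.add.l_cancel_one[of "a \<odot>\<^bsub>M\<^esub> \<zero>\<^bsub>M\<^esub>" "a \<odot>\<^bsub>M\<^esub> \<zero>\<^bsub>M\<^esub>"] smult_closed[OF assms] by simp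
qed

lemma (in left_module) module_mod:
  assumes "submodule N R M"
  shows "module_mod R M N"
proof -
  interpret N: submodule N R M by (rule assms)
  show ?thesis
  proof (intro module_mod.intro module_mod_axioms.intro)
    show "abelian_subgroup N M"
      by (rule abelian_subgroupI3[OF additive_subgroup.intro[OF N.subgroup_axioms] M.abelian_group_axioms])
  qed (simp_all add: R.ring_axioms smult_closed smult_r_distr smult_l_distr
      smult_assoc smult_one)
qed

text \<open>The submodule is the kernel of \<phi>. It stays anonymous because
  \<open>simple_quotient\<close> asks only for some submodule.\<close>

lemma (in left_module) ex_first_iso:
  assumes L: "left_module R L" and \<phi>: "left_module_hom R M L \<phi>"
    and surj: "\<And>y. y \<in> carrier L \<Longrightarrow> \<exists>x\<in>carrier M. \<phi> x = y"
  shows "\<exists>N. submodule N R M \<and> module_iso R (quot_module M N) L"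
proof -
  note closed = left_module_homD(1)[OF \<phi>] and add = left_module_homD(2)[OF \<phi>] and smult = left_module_homD(3)[OF \<phi>]
  interpret L: left_module R L by (rule L)
  define N where "N = {x \<in> carrier M. \<phi> x = \<zero>\<^bsub>L\<^esub>}"
  have gh: "group_hom (add_monoid M) (add_monoid L) \<phi>"
    by (intro group_hom.intro group_hom_axioms.intro M.a_group L.M.a_group)
      (auto simp: hom_def closed add)
  have sg: "subgroup N (add_monoid M)"
    using group_hom.subgroup_kernel[OF gh] by (simp add: N_def kernel_def)
  have "a \<odot>\<^bsub>M\<^esub> x \<in> N" if "a \<in> carrier R" "x \<in> N" for a x
    using that by (simp add: N_def smult_closed smult L.smult_r_zero)
  then have sub: "submodule N R M"
    by (rule submodule.intro[OF sg submodule_axioms.intro])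
  interpret module_mod R M N by (rule module_mod[OF sub])
  have vanish: "\<phi> x = \<zero>\<^bsub>L\<^esub>" if "x \<in> N" for x
    using that unfolding N_def by blast
  obtain \<Phi> where hom\<Phi>: "left_module_hom R Q L \<Phi>"
    and \<Phi>: "\<And>x. x \<in> carrier M \<Longrightarrow> \<Phi> (N +>\<^bsub>M\<^esub> x) = \<phi> x"
    using quot_hom[OF vanish L \<phi>] by blast
  have inj: "inj_on \<Phi> (carrier Q)"
  proof (rule inj_onI)
    fix X Y assume "X \<in> carrier Q" "Y \<in> carrier Q" and eq: "\<Phi> X = \<Phi> Y"
    then obtain x y where x: "x \<in> carrier M" "X = N +>\<^bsub>M\<^esub> x"
      and y: "y \<in> carrier M" "Y = N +>\<^bsub>M\<^esub> y" by (meson quot_memE)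
    then have "\<phi> x = \<phi> y" using eq \<Phi> by auto
    moreover have "\<phi> (\<ominus>\<^bsub>M\<^esub> y) = \<ominus>\<^bsub>L\<^esub> \<phi> y"
      using group_hom.hom_inv[OF gh] y by (simp add: a_inv_def)
    ultimately have "\<phi> (x \<ominus>\<^bsub>M\<^esub> y) = \<zero>\<^bsub>L\<^esub>"
      using x y by (simp add: a_minus_def add closed L.M.r_neg)
    then have "x \<ominus>\<^bsub>M\<^esub> y \<in> N" using x y unfolding N_def by blast
    then show "X = Y" using x y coset_eq_iff by blast
  qed
  moreover have "\<Phi> ` carrier Q = carrier L"
  proof
    show "\<Phi> ` carrier Q \<subseteq> carrier L" using left_module_homD(1)[OF hom\<Phi>] by auto
    show "carrier L \<subseteq> \<Phi> ` carrier Q"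
    proof
      fix y assume "y \<in> carrier L"
      then obtain x where x: "x \<in> carrier M" "\<phi> x = y" using surj by blast
      then show "y \<in> \<Phi> ` carrier Q" using \<Phi> coset_in_quot by (metis image_eqI)
    qed
  qed
  ultimately have "module_iso R Q L"
    unfolding module_iso_iff bij_betw_def using quot_left_module L hom\<Phi> by blast
  with sub show ?thesis by blast
qed

lemma module_iso_sym:
  assumes "module_iso R M L"
  shows "module_iso R L M"
proof -
  obtain \<phi> where M: "left_module R M" and L: "left_module R L"
    and bij: "bij_betw \<phi> (carrier M) (carrier L)"
    and hom: "left_module_hom R M L \<phi>"
    using assms unfolding module_iso_iff by blast
  note add = left_module_homD(2)[OF hom] and smult = left_module_homD(3)[OF hom]
  interpret M: left_module R M by (rule M)
  let ?\<psi> = "inv_into (carrier M) \<phi>"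
  have bij': "bij_betw ?\<psi> (carrier L) (carrier M)" by (rule bij_betw_inv_into[OF bij])
  note in_M = bij_betw_apply[OF bij'] and r = bij_betw_inv_into_right[OF bij]
    and l = bij_betw_inv_into_left[OF bij]
  have "left_module_hom R L M ?\<psi>"
  proof (rule left_module_homI)
    show "?\<psi> (x \<oplus>\<^bsub>L\<^esub> y) = ?\<psi> x \<oplus>\<^bsub>M\<^esub> ?\<psi> y" if "x \<in> carrier L" "y \<in> carrier L" for x y
      using that add[of "?\<psi> x" "?\<psi> y"] l[of "?\<psi> x \<oplus>\<^bsub>M\<^esub> ?\<psi> y"] in_M r by simp
    show "?\<psi> (a \<odot>\<^bsub>L\<^esub> x) = a \<odot>\<^bsub>M\<^esub> ?\<psi> x" if "a \<in> carrier R" "x \<in> carrier L" for a x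
      using that smult[of a "?\<psi> x"] l[of "a \<odot>\<^bsub>M\<^esub> ?\<psi> x"] in_M r M.smult_closed by simp
  qed (rule in_M)
  then show ?thesis
    unfolding module_iso_iff using M L bij' by blast
qed

text \<open>A submodule of \<open>M\<close> has a submodule of \<open>L\<close> as image, and by
  injectivity it is determined by that image.\<close>

lemma module_iso_simple:
  assumes iso: "module_iso R M L" and simple: "simple_module R L"
  shows "simple_module R M"
proof -
  obtain \<phi> where M: "left_module R M" and L: "left_module R L"
    and bij: "bij_betw \<phi> (carrier M) (carrier L)"
    and hom: "left_module_hom R M L \<phi>"
    using iso unfolding module_iso_iff by blast
  note add = left_module_homD(2)[OF hom] and smult = left_module_homD(3)[OF hom]
  interpret M: left_module R M by (rule M)
  interpret L: left_module R L by (rule L)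
  have img: "\<phi> ` carrier M = carrier L" and inj: "inj_on \<phi> (carrier M)"
    using bij by (auto simp: bij_betw_def)
  have gh: "group_hom (add_monoid M) (add_monoid L) \<phi>"
    using img by (intro group_hom.intro group_hom_axioms.intro M.a_group L.M.a_group)
      (auto simp: hom_def add)
  have zero: "\<phi> \<zero>\<^bsub>M\<^esub> = \<zero>\<^bsub>L\<^esub>" using group_hom.hom_one[OF gh] by simp
  have "N = {\<zero>\<^bsub>M\<^esub>} \<or> N = carrier M" if N: "submodule N R M" for N
  proof -
    interpret N: submodule N R M by (rule N)
    have NM: "N \<subseteq> carrier M" using N.subset by simp
    have "subgroup (\<phi> ` N) (add_monoid L)"
      using group_hom.subgroup_img_is_subgroup[OF gh N.subgroup_axioms] .
    moreover have "a \<odot>\<^bsub>L\<^esub> y \<in> \<phi> ` N" if a: "a \<in> carrier R" and y: "y \<in> \<phi> ` N" for a y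
    proof -
      obtain x where x: "x \<in> N" "y = \<phi> x" using y by blast
      then have "a \<odot>\<^bsub>L\<^esub> y = \<phi> (a \<odot>\<^bsub>M\<^esub> x)" using smult[OF a, of x] NM by auto
      then show ?thesis using N.smult_closed[OF a x(1)] by blast
    qed
    ultimately have "submodule (\<phi> ` N) R L"
      by (intro submodule.intro submodule_axioms.intro)
    then consider "\<phi> ` N = {\<zero>\<^bsub>L\<^esub>}" | "\<phi> ` N = carrier L"
      using simple by (auto simp: simple_module_def)
    then show ?thesis
    proof cases
      case 1
      then have "\<phi> ` N = \<phi> ` {\<zero>\<^bsub>M\<^esub>}" using zero by simp
      then show ?thesis using inj_on_image_eq_iff[OF inj NM, of "{\<zero>\<^bsub>M\<^esub>}"] by simp
    next
      case 2
      then show ?thesis using inj_on_image_eq_iff[OF inj NM subset_refl] img by simp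
    qed
  qed
  moreover have "carrier M \<noteq> {\<zero>\<^bsub>M\<^esub>}"
    using simple img zero by (auto simp: simple_module_def)
  ultimately show ?thesis using M by (simp add: simple_module_def)
qed

text \<open>If every element outside \<open>S\<close> generates the module modulo \<open>S\<close>,
  then a submodule of the quotient with a nonzero element is everything.\<close>

lemma (in left_module) quot_simpleI:
  assumes S: "submodule S R M" and ne: "S \<noteq> carrier M"
    and gen: "\<And>x y. x \<in> carrier M \<Longrightarrow> x \<notin> S \<Longrightarrow> y \<in> carrier M \<Longrightarrow>
      \<exists>a\<in>carrier R. S +>\<^bsub>M\<^esub> y = S +>\<^bsub>M\<^esub> a \<odot>\<^bsub>M\<^esub> x"
  shows "simple_module R (quot_module M S)"
proof -
  interpret module_mod R M S by (rule module_mod[OF S])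
  interpret Q: left_module R Q by (rule quot_left_module)
  have Q0: "S +>\<^bsub>M\<^esub> x = \<zero>\<^bsub>Q\<^esub> \<longleftrightarrow> x \<in> S" if "x \<in> carrier M" for x
    using a_coset_join1[OF _ that a_subgroup] a_coset_join2[OF that a_subgroup]
    by (auto simp: quot_module_def)
  have "N = {\<zero>\<^bsub>Q\<^esub>} \<or> N = carrier Q" if N: "submodule N R Q" for N
  proof (rule disjCI)
    interpret N: submodule N R Q by (rule N)
    have NQ: "N \<subseteq> carrier Q" and N0: "\<zero>\<^bsub>Q\<^esub> \<in> N" using N.subset N.one_closed by simp_all
    assume nf: "N \<noteq> carrier Q"
    show "N = {\<zero>\<^bsub>Q\<^esub>}"
    proof (rule ccontr)
      assume "N \<noteq> {\<zero>\<^bsub>Q\<^esub>}"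
      then obtain X where X: "X \<in> N" "X \<noteq> \<zero>\<^bsub>Q\<^esub>" using N0 by blast
      then obtain x where x: "x \<in> carrier M" "X = S +>\<^bsub>M\<^esub> x" using NQ quot_memE by blast
      with X have "x \<notin> S" using Q0 by simp
      have "Y \<in> N" if Y: "Y \<in> carrier Q" for Y
      proof -
        obtain y where y: "y \<in> carrier M" "Y = S +>\<^bsub>M\<^esub> y" using Y quot_memE by blast
        obtain a where a: "a \<in> carrier R" "S +>\<^bsub>M\<^esub> y = S +>\<^bsub>M\<^esub> a \<odot>\<^bsub>M\<^esub> x"
          using gen[OF x(1) \<open>x \<notin> S\<close> y(1)] by blast
        then show "Y \<in> N" using N.smult_closed[OF a(1) X(1)] x y by (simp add: quot_smult)
      qed
      then show False using nf NQ by blast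
    qed
  qed
  moreover have "carrier Q \<noteq> {\<zero>\<^bsub>Q\<^esub>}"
  proof -
    obtain x where x: "x \<in> carrier M" "x \<notin> S" using ne a_subset by blast
    then show ?thesis using Q0 coset_in_quot[OF x(1)] by blast
  qed
  ultimately show ?thesis unfolding simple_module_def using quot_left_module by blast
qed

section \<open>The induced module and its universal property\<close>

definition free_pre_module ::
  "('a, 'b) ring_scheme \<Rightarrow> ('a, 'w) module \<Rightarrow> ('a, ('a \<times> 'w) \<Rightarrow>\<^sub>0 int) module" where
  "free_pre_module R W = \<lparr>carrier = {c. Poly_Mapping.keys c \<subseteq> carrier R \<times> carrier W},
     monoid.mult = undefined, one = undefined, ring.zero = 0, ring.add = (+),
     smult = (\<lambda>u. frag_extend (\<lambda>(a, w). frag_of (u \<otimes>\<^bsub>R\<^esub> a, w)))\<rparr>"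

lemma r_coset_free_pre_module:
  "H +>\<^bsub>free_pre_module R W\<^esub> x = H #>\<^bsub>free_Abelian_group (carrier R \<times> carrier W)\<^esub> x"
  by (simp add: a_r_coset_def r_coset_def free_pre_module_def)

lemma subgroup_free_pre_module:
  assumes "subgroup H (free_Abelian_group (carrier R \<times> carrier W))"
  shows "subgroup H (add_monoid (free_pre_module R W))"
proof -
  let ?F = "free_pre_module R W" and ?G = "free_Abelian_group (carrier R \<times> carrier W)"
  have "carrier (add_monoid ?F) = carrier ?G" "mult (add_monoid ?F) = mult ?G"
    "one (add_monoid ?F) = one ?G" "m_inv (add_monoid ?F) = m_inv ?G"
    by (simp_all add: fun_eq_iff m_inv_def free_pre_module_def free_Abelian_group_def)
  then show ?thesis using assms unfolding subgroup_def by metis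
qed

text \<open>Written as a \<open>quot_module\<close>, the induced module falls under
  \<open>module_mod\<close>, with the free abelian group in the role of \<open>M\<close> and the
  span of the balanced relations in the role of \<open>N\<close>.\<close>

lemma induced_module_eq:
  "induced_module R B W = quot_module (free_pre_module R W)
     (generate (free_Abelian_group (carrier R \<times> carrier W)) (balanced_rels R B W))"
  by (simp add: induced_module_def quot_module_def Let_def A_RCOSETS_def' RCOSETS_def
      r_coset_free_pre_module set_add_def set_mult_def fun_eq_iff)
    (simp add: free_pre_module_def free_Abelian_group_def)

locale induced =
  fixes R :: "('a, 'b) ring_scheme" and B :: "'a set" and W :: "('a, 'w) module"
  assumes R: "ring R" and B: "B \<subseteq> carrier R"
    and W_add: "\<And>x y. x \<in> carrier W \<Longrightarrow> y \<in> carrier W \<Longrightarrow> x \<oplus>\<^bsub>W\<^esub> y \<in> carrier W"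
    and W_smult: "\<And>b x. b \<in> B \<Longrightarrow> x \<in> carrier W \<Longrightarrow> b \<odot>\<^bsub>W\<^esub> x \<in> carrier W"
begin

abbreviation F where "F \<equiv> free_pre_module R W"
abbreviation G where "G \<equiv> free_Abelian_group (carrier R \<times> carrier W)"
abbreviation K where "K \<equiv> generate G (balanced_rels R B W)"

lemma relsE:
  assumes "x \<in> balanced_rels R B W"
  obtains
    (l) a a' w where "a \<in> carrier R" "a' \<in> carrier R" "w \<in> carrier W"
      "x = frag_of (a \<oplus>\<^bsub>R\<^esub> a', w) - frag_of (a, w) - frag_of (a', w)"
  | (r) a w w' where "a \<in> carrier R" "w \<in> carrier W" "w' \<in> carrier W"
      "x = frag_of (a, w \<oplus>\<^bsub>W\<^esub> w') - frag_of (a, w) - frag_of (a, w')"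
  | (b) a b w where "a \<in> carrier R" "b \<in> B" "w \<in> carrier W"
      "x = frag_of (a \<otimes>\<^bsub>R\<^esub> b, w) - frag_of (a, b \<odot>\<^bsub>W\<^esub> w)"
  using assms unfolding balanced_rels_def by blast

lemma G_diff: "x \<in> carrier G \<Longrightarrow> y \<in> carrier G \<Longrightarrow> x - y \<in> carrier G"
  using keys_diff[of x y] by auto

lemma rels_carrier: "balanced_rels R B W \<subseteq> carrier G"
proof
  interpret ring R by (rule R)
  fix x assume "x \<in> balanced_rels R B W"
  then show "x \<in> carrier G"
  proof (cases rule: relsE)
    case (l a a' w)
    show ?thesis unfolding l(4) by (intro G_diff) (simp_all add: l)
  next
    case (r a w w')
    show ?thesis unfolding r(4) by (intro G_diff) (simp_all add: r W_add)
  next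
    case (b a b w)
    with B have "b \<in> carrier R" by blast
    with b show ?thesis unfolding b(4) by (intro G_diff) (simp_all add: W_smult)
  qed
qed

lemma K_subgroup: "subgroup K G"
  by (rule group.generate_is_subgroup[OF group_free_Abelian_group rels_carrier])

lemma K_diff:
  assumes "x \<in> K" "y \<in> K"
  shows "x - y \<in> K"
proof -
  have "y \<in> carrier G" using assms subgroup.subset[OF K_subgroup] by blast
  then show ?thesis
    using subgroup.m_closed[OF K_subgroup assms(1) subgroup.m_inv_closed[OF K_subgroup assms(2)]]
    by simp
qed

lemma K_coset_eqI:
  assumes xy: "x - y \<in> K" and "y \<in> carrier G"
  shows "K +>\<^bsub>F\<^esub> x = K +>\<^bsub>F\<^esub> y"
proof -
  have "(x - y) \<otimes>\<^bsub>G\<^esub> y \<in> K #>\<^bsub>G\<^esub> y" using xy unfolding r_coset_def by blast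
  then have "x \<in> K #>\<^bsub>G\<^esub> y" by simp
  then show ?thesis
    unfolding r_coset_free_pre_module
    using group.repr_independence[OF group_free_Abelian_group _ assms(2) K_subgroup] by metis
qed

lemma smult_F: "u \<odot>\<^bsub>F\<^esub> x = frag_extend (\<lambda>(a, w). frag_of (u \<otimes>\<^bsub>R\<^esub> a, w)) x"
  by (simp add: free_pre_module_def)

lemma smult_F_diff: "u \<odot>\<^bsub>F\<^esub> (x - y) = u \<odot>\<^bsub>F\<^esub> x - u \<odot>\<^bsub>F\<^esub> y"
  by (simp add: smult_F frag_extend_diff)

lemma relsI:
  "a \<in> carrier R \<Longrightarrow> a' \<in> carrier R \<Longrightarrow> w \<in> carrier W \<Longrightarrow>
     frag_of (a \<oplus>\<^bsub>R\<^esub> a', w) - frag_of (a, w) - frag_of (a', w) \<in> balanced_rels R B W"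
  "a \<in> carrier R \<Longrightarrow> w \<in> carrier W \<Longrightarrow> w' \<in> carrier W \<Longrightarrow>
     frag_of (a, w \<oplus>\<^bsub>W\<^esub> w') - frag_of (a, w) - frag_of (a, w') \<in> balanced_rels R B W"
  "a \<in> carrier R \<Longrightarrow> b \<in> B \<Longrightarrow> w \<in> carrier W \<Longrightarrow>
     frag_of (a \<otimes>\<^bsub>R\<^esub> b, w) - frag_of (a, b \<odot>\<^bsub>W\<^esub> w) \<in> balanced_rels R B W"
  unfolding balanced_rels_def by blast+

text \<open>Scalars multiply the first entry from the left, while the relations involve only sums
  and right multiplication by elements of \<open>B\<close>. Hence each kind of relation is mapped to
  a relation of the same kind.\<close>

lemma smult_rel:
  assumes u: "u \<in> carrier R" and x: "x \<in> balanced_rels R B W"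
  shows "u \<odot>\<^bsub>F\<^esub> x \<in> balanced_rels R B W"
proof -
  interpret ring R by (rule R)
  from x show ?thesis
  proof (cases rule: relsE)
    case (l a a' w)
    then show ?thesis using u relsI(1)[of "u \<otimes>\<^bsub>R\<^esub> a" "u \<otimes>\<^bsub>R\<^esub> a'" w]
      by (simp add: smult_F frag_extend_diff r_distr)
  next
    case (r a w w')
    then show ?thesis using u relsI(2)[of "u \<otimes>\<^bsub>R\<^esub> a" w w']
      by (simp add: smult_F frag_extend_diff)
  next
    case (b a b w)
    then show ?thesis using u B relsI(3)[of "u \<otimes>\<^bsub>R\<^esub> a" b w]
      by (auto simp: smult_F frag_extend_diff m_assoc)
  qed
qed

lemma smult_K:
  assumes u: "u \<in> carrier R" and x: "x \<in> K"
  shows "u \<odot>\<^bsub>F\<^esub> x \<in> K"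
  using x
proof (induction rule: generate.induct)
  case one
  then show ?case using generate.one[of G] by (simp add: smult_F)
next
  case (incl h)
  then show ?case using smult_rel[OF u] by (simp add: generate.incl)
next
  case (inv h)
  then have "inv\<^bsub>G\<^esub> h = - h" using rels_carrier by auto
  moreover have "u \<odot>\<^bsub>F\<^esub> h \<in> carrier G" using rels_carrier smult_rel[OF u inv] by blast
  ultimately have "u \<odot>\<^bsub>F\<^esub> inv\<^bsub>G\<^esub> h = inv\<^bsub>G\<^esub> (u \<odot>\<^bsub>F\<^esub> h)"
    by (simp add: smult_F frag_extend_minus)
  then show ?case using generate.inv[OF smult_rel[OF u inv], of G] by simp
next
  case (eng h1 h2)
  then show ?case using generate.eng[of "u \<odot>\<^bsub>F\<^esub> h1" G _ "u \<odot>\<^bsub>F\<^esub> h2"]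
    by (simp add: smult_F frag_extend_add)
qed

lemma smult_F_closed:
  assumes u: "u \<in> carrier R" and x: "x \<in> carrier F"
  shows "u \<odot>\<^bsub>F\<^esub> x \<in> carrier F"
proof -
  have "Poly_Mapping.keys (u \<odot>\<^bsub>F\<^esub> x) \<subseteq>
      (\<Union>p\<in>Poly_Mapping.keys x. Poly_Mapping.keys ((\<lambda>(a, w). frag_of (u \<otimes>\<^bsub>R\<^esub> a, w)) p))"
    unfolding smult_F by (rule keys_frag_extend)
  also have "\<dots> \<subseteq> carrier R \<times> carrier W"
    using x u ring.ring_simprules(5)[OF R u] by (auto simp: free_pre_module_def)
  finally show ?thesis by (simp add: free_pre_module_def)
qed

lemma carrier_F: "carrier F = carrier G"
  by (simp add: free_pre_module_def free_Abelian_group_def)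

lemma F_induct [consumes 1, case_names zero diff of]:
  assumes "x \<in> carrier F" "P 0"
    "\<And>x y. x \<in> carrier F \<Longrightarrow> y \<in> carrier F \<Longrightarrow> P x \<Longrightarrow> P y \<Longrightarrow> P (x - y)"
    "\<And>a w. a \<in> carrier R \<Longrightarrow> w \<in> carrier W \<Longrightarrow> P (frag_of (a, w))"
  shows "P x"
proof (rule free_Abelian_group_induct[of x "carrier R \<times> carrier W"])
  show "Poly_Mapping.keys x \<subseteq> carrier R \<times> carrier W"
    using assms(1) by (simp add: free_pre_module_def)
  show "P (y - z)" if "Poly_Mapping.keys y \<subseteq> carrier R \<times> carrier W"
    "Poly_Mapping.keys z \<subseteq> carrier R \<times> carrier W" "P y" "P z" for y z
    by (rule assms(3)) (use that in \<open>simp_all add: free_pre_module_def\<close>)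
  show "P (frag_of p)" if "p \<in> carrier R \<times> carrier W" for p
    using that assms(4) by (cases p) blast
qed (rule assms(2))

lemma F_diff: "x \<in> carrier F \<Longrightarrow> y \<in> carrier F \<Longrightarrow> x - y \<in> carrier F"
  unfolding carrier_F by (rule G_diff)

lemma zero_in_K: "0 \<in> K"
  using generate.one[of G] by simp

text \<open>Associativity and the unit law are proved in \<open>F\<close> itself. For distributivity
  in the scalar, the difference of the two sides on a generator is a balanced relation of the first
  kind, so it lies in \<open>K\<close>.\<close>

lemma induced_module_mod: "module_mod R F K"
proof -
  interpret R: ring R by (rule R)
  interpret F: abelian_group F
  proof (rule abelian_groupI)
    fix x assume "x \<in> carrier F"
    then show "\<exists>y\<in>carrier F. y \<oplus>\<^bsub>F\<^esub> x = \<zero>\<^bsub>F\<^esub>"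
      by (intro bexI[of _ "- x"]) (simp_all add: free_pre_module_def)
  next
    fix x y assume "x \<in> carrier F" "y \<in> carrier F"
    then show "x \<oplus>\<^bsub>F\<^esub> y \<in> carrier F"
      using keys_add[of x y] by (auto simp: free_pre_module_def)
  qed (simp_all add: free_pre_module_def add_ac)
  have K: "abelian_subgroup K F"
    by (rule abelian_subgroupI3[OF additive_subgroup.intro[OF subgroup_free_pre_module[OF K_subgroup]]
          F.abelian_group_axioms])
  have add: "x \<oplus>\<^bsub>F\<^esub> y = x + y" for x y by (simp add: free_pre_module_def)
  have coset: "K +>\<^bsub>F\<^esub> x = K +>\<^bsub>F\<^esub> y" if "x - y \<in> K" "y \<in> carrier F" for x y
    using that K_coset_eqI unfolding carrier_F by blast
  have l: "(a \<oplus>\<^bsub>R\<^esub> b) \<odot>\<^bsub>F\<^esub> x - (a \<odot>\<^bsub>F\<^esub> x + b \<odot>\<^bsub>F\<^esub> x) \<in> K"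
    if a: "a \<in> carrier R" and b: "b \<in> carrier R" and x: "x \<in> carrier F" for a b x
    using x
  proof (induction rule: F_induct)
    case (diff x y)
    then show ?case using K_diff[OF diff(3,4)] by (simp add: smult_F_diff algebra_simps)
  next
    case (of c w)
    then show ?case using a b generate.incl[OF relsI(1)[of "a \<otimes>\<^bsub>R\<^esub> c" "b \<otimes>\<^bsub>R\<^esub> c" w], of G]
      by (simp add: smult_F R.l_distr algebra_simps)
  qed (simp add: smult_F zero_in_K)
  have as: "(a \<otimes>\<^bsub>R\<^esub> b) \<odot>\<^bsub>F\<^esub> x = a \<odot>\<^bsub>F\<^esub> (b \<odot>\<^bsub>F\<^esub> x)"
    if a: "a \<in> carrier R" and b: "b \<in> carrier R" and x: "x \<in> carrier F" for a b x
    using x by (induction rule: F_induct)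
      (simp_all add: smult_F_diff, simp_all add: smult_F a b R.m_assoc)
  have on: "\<one>\<^bsub>R\<^esub> \<odot>\<^bsub>F\<^esub> x = x" if x: "x \<in> carrier F" for x
    using x by (induction rule: F_induct) (simp_all add: smult_F_diff, simp_all add: smult_F)
  show ?thesis
  proof (intro module_mod.intro module_mod_axioms.intro R K)
    fix a b x assume h: "a \<in> carrier R" "b \<in> carrier R" "x \<in> carrier F"
    have "a \<odot>\<^bsub>F\<^esub> x \<oplus>\<^bsub>F\<^esub> b \<odot>\<^bsub>F\<^esub> x \<in> carrier F"
      using h smult_F_closed by blast
    then show "K +>\<^bsub>F\<^esub> (a \<oplus>\<^bsub>R\<^esub> b) \<odot>\<^bsub>F\<^esub> x = K +>\<^bsub>F\<^esub> (a \<odot>\<^bsub>F\<^esub> x \<oplus>\<^bsub>F\<^esub> b \<odot>\<^bsub>F\<^esub> x)"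
      using h smult_F_closed l by (intro coset) (auto simp: add)
  qed (simp_all add: smult_F_closed as on smult_K, simp add: smult_F add frag_extend_add)
qed

lemma induced_left_module: "left_module R (induced_module R B W)"
  unfolding induced_module_eq by (rule module_mod.quot_left_module[OF induced_module_mod])

text \<open>The universal property of induction: a \<open>B\<close>-linear map out of
  \<open>W\<close> extends to the induced module. The second part of the conclusion records which
  elements are hit, for the later proof of surjectivity.\<close>

lemma induced_hom:
  assumes L: "left_module R L"
    and closed: "\<And>w. w \<in> carrier W \<Longrightarrow> \<psi> w \<in> carrier L"
    and add: "\<And>w w'. w \<in> carrier W \<Longrightarrow> w' \<in> carrier W \<Longrightarrow> \<psi> (w \<oplus>\<^bsub>W\<^esub> w') = \<psi> w \<oplus>\<^bsub>L\<^esub> \<psi> w'"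
    and smult: "\<And>b w. b \<in> B \<Longrightarrow> w \<in> carrier W \<Longrightarrow> \<psi> (b \<odot>\<^bsub>W\<^esub> w) = b \<odot>\<^bsub>L\<^esub> \<psi> w"
  shows "\<exists>\<Phi>. left_module_hom R (induced_module R B W) L \<Phi> \<and> (\<forall>a\<in>carrier R. \<forall>w\<in>carrier W.
    \<exists>X\<in>carrier (induced_module R B W). \<Phi> X = a \<odot>\<^bsub>L\<^esub> \<psi> w)"
proof -
  interpret L: left_module R L by (rule L)
  interpret module_mod R F K by (rule induced_module_mod)
  have L_comm: "comm_group (add_monoid L)" by (rule L.M.a_comm_group)
  have "(\<lambda>(a, w). a \<odot>\<^bsub>L\<^esub> \<psi> w) ` (carrier R \<times> carrier W) \<subseteq> carrier (add_monoid L)"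
    using closed L.smult_closed by auto
  from comm_group.free_Abelian_group_universal[OF L_comm this]
  obtain h where h: "h \<in> hom G (add_monoid L)"
    and hof: "\<And>a w. a \<in> carrier R \<Longrightarrow> w \<in> carrier W \<Longrightarrow> h (frag_of (a, w)) = a \<odot>\<^bsub>L\<^esub> \<psi> w"
    by (metis (no_types, lifting) SigmaI case_prod_conv)
  have gh: "group_hom G (add_monoid L) h"
    using h by (intro group_hom.intro group_hom_axioms.intro L.M.a_group group_free_Abelian_group)
  have h_closed: "h x \<in> carrier L" if "x \<in> carrier F" for x
    using that group_hom.hom_closed[OF gh, of x] by (simp add: carrier_F)
  have h_add: "h (x + y) = h x \<oplus>\<^bsub>L\<^esub> h y" if "x \<in> carrier F" "y \<in> carrier F" for x y
    using that group_hom.hom_mult[OF gh, of x y] by (simp add: carrier_F)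
  have h_add': "h (x \<oplus>\<^bsub>F\<^esub> y) = h x \<oplus>\<^bsub>L\<^esub> h y" if "x \<in> carrier F" "y \<in> carrier F" for x y
    using h_add that by (simp add: free_pre_module_def)
  have h_minus: "h (- x) = \<ominus>\<^bsub>L\<^esub> h x" if "x \<in> carrier F" for x
    using that group_hom.hom_inv[OF gh, of x] by (simp add: carrier_F a_inv_def)
  have h_diff: "h (x - y) = h x \<ominus>\<^bsub>L\<^esub> h y" if "x \<in> carrier F" "y \<in> carrier F" for x y
    using that h_add[of x "- y"] h_minus[of y] by (simp add: carrier_F a_minus_def)
  have h_zero: "h 0 = \<zero>\<^bsub>L\<^esub>" using group_hom.hom_one[OF gh] by simp
  have of_F: "frag_of (a, w) \<in> carrier F" if "a \<in> carrier R" "w \<in> carrier W" for a w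
    using that by (simp add: carrier_F)
  \<comment> \<open>The three kinds of relations vanish by the two distributive laws of
    \<open>L\<close>, additivity of \<psi> and its \<open>B\<close>-linearity.\<close>
  have h_rel: "h x = \<zero>\<^bsub>L\<^esub>" if "x \<in> balanced_rels R B W" for x
    using that
  proof (cases rule: relsE)
    case (l a a' w)
    then have "h x = a \<odot>\<^bsub>L\<^esub> \<psi> w \<oplus>\<^bsub>L\<^esub> a' \<odot>\<^bsub>L\<^esub> \<psi> w \<ominus>\<^bsub>L\<^esub> a \<odot>\<^bsub>L\<^esub> \<psi> w \<ominus>\<^bsub>L\<^esub> a' \<odot>\<^bsub>L\<^esub> \<psi> w"
      by (simp add: h_diff F_diff of_F hof L.smult_l_distr closed)
    then show ?thesis using l closed L.smult_closed
      by (simp add: a_minus_def L.M.a_ac L.M.r_neg L.M.r_neg1)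
  next
    case (r a w w')
    then have "h x = a \<odot>\<^bsub>L\<^esub> \<psi> w \<oplus>\<^bsub>L\<^esub> a \<odot>\<^bsub>L\<^esub> \<psi> w' \<ominus>\<^bsub>L\<^esub> a \<odot>\<^bsub>L\<^esub> \<psi> w \<ominus>\<^bsub>L\<^esub> a \<odot>\<^bsub>L\<^esub> \<psi> w'"
      by (simp add: h_diff F_diff of_F hof L.smult_r_distr closed add W_add)
    then show ?thesis using r closed L.smult_closed
      by (simp add: a_minus_def L.M.a_ac L.M.r_neg L.M.r_neg1)
  next
    case (b a b w)
    have "b \<in> carrier R" using b B by blast
    then have "h x = a \<odot>\<^bsub>L\<^esub> (b \<odot>\<^bsub>L\<^esub> \<psi> w) \<ominus>\<^bsub>L\<^esub> a \<odot>\<^bsub>L\<^esub> (b \<odot>\<^bsub>L\<^esub> \<psi> w)"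
      using b by (simp add: h_diff F_diff of_F hof L.smult_assoc closed smult W_smult)
    then show ?thesis using b closed L.smult_closed \<open>b \<in> carrier R\<close>
      by (simp add: a_minus_def L.M.r_neg)
  qed
  have h_K: "h x = \<zero>\<^bsub>L\<^esub>" if "x \<in> K" for x
    using that
  proof (induction rule: generate.induct)
    case (inv x)
    then have x: "x \<in> carrier G" using rels_carrier by blast
    then show ?case using h_rel[OF inv] h_minus[of x] by (simp add: carrier_F)
  next
    case (eng x y)
    then have "x \<in> carrier F" "y \<in> carrier F"
      using subgroup.subset[OF K_subgroup] unfolding carrier_F by blast+
    then show ?case using eng h_add by simp
  qed (simp_all add: h_zero h_rel)
  have h_smult: "h (u \<odot>\<^bsub>F\<^esub> x) = u \<odot>\<^bsub>L\<^esub> h x" if u: "u \<in> carrier R" and x: "x \<in> carrier F" for u x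
    using x
  proof (induction rule: F_induct)
    case zero
    then show ?case using L.smult_r_zero[OF u] by (simp add: smult_F h_zero)
  next
    case (diff x y)
    have "u \<odot>\<^bsub>L\<^esub> (\<ominus>\<^bsub>L\<^esub> h y) = \<ominus>\<^bsub>L\<^esub> (u \<odot>\<^bsub>L\<^esub> h y)"
    proof (rule L.M.minus_equality[symmetric])
      show "u \<odot>\<^bsub>L\<^esub> (\<ominus>\<^bsub>L\<^esub> h y) \<oplus>\<^bsub>L\<^esub> u \<odot>\<^bsub>L\<^esub> h y = \<zero>\<^bsub>L\<^esub>"
        using diff h_closed u L.smult_r_distr[OF u, of "\<ominus>\<^bsub>L\<^esub> h y" "h y"] L.smult_r_zero[OF u]
        by (simp add: L.M.l_neg)
    qed (use diff h_closed u L.smult_closed in auto)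
    then show ?case using diff u h_closed
      by (simp add: smult_F_diff h_diff smult_F_closed a_minus_def L.smult_r_distr)
  next
    case (of a w)
    then show ?case using u by (simp add: smult_F hof L.smult_assoc closed)
  qed
  have "left_module_hom R F L h"
    by (rule left_module_homI) (fact h_closed h_add' h_smult)+
  from quot_hom[OF h_K L this] obtain \<Phi> where hom: "left_module_hom R Q L \<Phi>"
    and \<Phi>: "\<forall>x\<in>carrier F. \<Phi> (K +>\<^bsub>F\<^esub> x) = h x"
    by blast
  have "\<exists>X\<in>carrier Q. \<Phi> X = a \<odot>\<^bsub>L\<^esub> \<psi> w" if a: "a \<in> carrier R" and w: "w \<in> carrier W" for a w
  proof (rule bexI)
    show "\<Phi> (K +>\<^bsub>F\<^esub> frag_of (a, w)) = a \<odot>\<^bsub>L\<^esub> \<psi> w"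
      using bspec[OF \<Phi> of_F[OF a w]] hof[OF a w] by (rule trans)
  qed (rule coset_in_quot[OF of_F[OF a w]])
  then show ?thesis unfolding induced_module_eq
    by (intro exI[of _ \<Phi>] conjI ballI hom)
qed

end

subsection \<open>Linear maps on free algebras\<close>

abbreviation tlinear :: "('a falg \<Rightarrow> 'b falg) \<Rightarrow> bool" where
  "tlinear \<equiv> Vector_Spaces.linear tscale tscale"

lemma tlinear_iff:
  "tlinear f \<longleftrightarrow> (\<forall>x y. f (x + y) = f x + f y) \<and> (\<forall>c x. f (tscale c x) = tscale c (f x))"
  unfolding Vector_Spaces.linear_iff by (simp add: tvs.vector_space_axioms)

lemma tlinear_add: "tlinear f \<Longrightarrow> f (x + y) = f x + f y"
  and tlinear_scale: "tlinear f \<Longrightarrow> f (tscale c x) = tscale c (f x)"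
  by (auto simp: tlinear_iff)

lemma tlinear_0: "tlinear f \<Longrightarrow> f 0 = 0"
  using tlinear_scale[of f 0 0] by simp

lemma tlinear_sum: "tlinear f \<Longrightarrow> f (\<Sum>i\<in>I. g i) = (\<Sum>i\<in>I. f (g i))"
  by (induction I rule: infinite_finite_induct) (simp_all add: tlinear_0 tlinear_add)

lemma const_one [simp]: "const 1 = 1"
  by (simp add: const_def zero_list_def flip: single_one)

lemma poly_mapping_induct [case_names zero single add]:
  fixes x :: "'a \<Rightarrow>\<^sub>0 'b::comm_monoid_add"
  assumes "P 0" "\<And>k v. P (Poly_Mapping.single k v)" "\<And>x y. P x \<Longrightarrow> P y \<Longrightarrow> P (x + y)"
  shows "P x"
proof -
  have "P (\<Sum>k\<in>I. Poly_Mapping.single k (Poly_Mapping.lookup x k))" for I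
    by (induction I rule: infinite_finite_induct) (simp_all add: assms)
  moreover have "x = (\<Sum>k\<in>Poly_Mapping.keys x. Poly_Mapping.single k (Poly_Mapping.lookup x k))"
    by (rule poly_mapping_eqI) (simp add: lookup_sum lookup_single when_def in_keys_iff)
  ultimately show ?thesis by metis
qed

lemma mult_const: "x * const c = const c * x"
proof (rule poly_mapping_eqI)
  fix w
  have a: "Poly_Mapping.lookup (const c * x) w = c * Poly_Mapping.lookup x w" for x :: "'a falg" and w
  proof (induction x rule: poly_mapping_induct)
    case (single k v)
    then show ?case by (simp add: const_def mult_single plus_list_def lookup_single when_def)
  qed (simp_all add: distrib_left lookup_add)
  have b: "Poly_Mapping.lookup (x * const c) w = c * Poly_Mapping.lookup x w" for x :: "'a falg" and w
  proof (induction x rule: poly_mapping_induct)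
    case (single k v)
    then show ?case by (simp add: const_def mult_single plus_list_def lookup_single when_def)
  qed (simp_all add: distrib_left distrib_right lookup_add)
  show "Poly_Mapping.lookup (x * const c) w = Poly_Mapping.lookup (const c * x) w" by (simp add: a b)
qed

lemma lookup_tscale: "Poly_Mapping.lookup (tscale c x) w = c * Poly_Mapping.lookup x w"
proof (induction x rule: poly_mapping_induct)
  case (single k v)
  then show ?case by (simp add: tscale_def const_def mult_single plus_list_def lookup_single when_def)
qed (simp_all add: tvs.scale_right_distrib distrib_left lookup_add)

lemma tscale_mult_left: "tscale c x * y = tscale c (x * y)"
  by (simp add: tscale_def mult.assoc)

lemma tscale_mult_right: "x * tscale c y = tscale c (x * y)"
  by (simp add: tscale_def mult.assoc[symmetric] mult_const)

lemma mon_mult: "mon u * mon v = mon (u @ v)"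
  by (simp add: mon_def mult_single plus_list_def)

lemma mon_Nil: "mon [] = 1"
  by (simp add: mon_def zero_list_def flip: single_one)

lemma mon_Cons: "mon (a # u) = mon [a] * mon u"
  by (simp add: mon_mult)

lemma mon_snoc: "mon (u @ [a]) = mon u * mon [a]"
  by (simp add: mon_mult)

lemma lookup_mon: "Poly_Mapping.lookup (mon u) v = (if u = v then 1 else 0)"
  by (auto simp: mon_def lookup_single when_def)

lemma keys_mon: "Poly_Mapping.keys (mon u) = {u}"
  by (simp add: mon_def)

lemma const_eq_tscale: "const c = tscale c (mon [])"
  by (simp add: tscale_def mon_Nil)

lemma falg_expansion:
  "x = (\<Sum>w\<in>Poly_Mapping.keys x. tscale (Poly_Mapping.lookup x w) (mon w))"
proof (rule poly_mapping_eqI)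
  fix v
  have "Poly_Mapping.lookup (\<Sum>w\<in>Poly_Mapping.keys x. tscale (Poly_Mapping.lookup x w) (mon w)) v
      = (\<Sum>w\<in>Poly_Mapping.keys x. if w = v then Poly_Mapping.lookup x w else 0)"
    by (simp add: lookup_sum lookup_tscale lookup_mon if_distrib cong: if_cong)
  also have "\<dots> = Poly_Mapping.lookup x v"
    by (simp add: in_keys_iff)
  finally show "Poly_Mapping.lookup x v = Poly_Mapping.lookup (\<Sum>w\<in>Poly_Mapping.keys x. tscale (Poly_Mapping.lookup x w) (mon w)) v" ..
qed

lemma falg_induct [case_names zero mon add scale]:
  assumes "Poly_Mapping.keys x \<subseteq> A" and zero: "P 0" and mon: "\<And>w. w \<in> A \<Longrightarrow> P (mon w)"
    and add: "\<And>x y. P x \<Longrightarrow> P y \<Longrightarrow> P (x + y)"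
    and scale: "\<And>c x. P x \<Longrightarrow> P (tscale c x)"
  shows "P x"
proof -
  have "P (\<Sum>w\<in>I. tscale (Poly_Mapping.lookup x w) (mon w))" if "finite I" "I \<subseteq> A" for I
    using that by (induction I rule: finite_induct) (auto intro: zero add scale mon)
  then show ?thesis using assms(1) falg_expansion[of x] by (metis finite_keys)
qed

lemma tlinear_eq_on:
  assumes "tlinear f" "tlinear g" "Poly_Mapping.keys x \<subseteq> A" "\<And>w. w \<in> A \<Longrightarrow> f (mon w) = g (mon w)"
  shows "f x = g x"
  by (rule falg_induct[OF assms(3)])
    (simp_all add: assms(1,2,4) tlinear_0 tlinear_add tlinear_scale)

lemma tlinear_eqI:
  assumes "tlinear f" "tlinear g" "\<And>w. f (mon w) = g (mon w)"
  shows "f x = g x"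
  by (rule tlinear_eq_on[OF assms(1,2), of x UNIV]) (simp_all add: assms)

lemma lin_ext_mon [simp]: "lin_ext h (mon w) = h w"
  by (simp add: lin_ext_def keys_mon lookup_mon)

lemma lin_ext_superset:
  assumes "finite A" "Poly_Mapping.keys x \<subseteq> A"
  shows "lin_ext h x = (\<Sum>w\<in>A. tscale (Poly_Mapping.lookup x w) (h w))"
  unfolding lin_ext_def using assms
  by (intro sum.mono_neutral_left) (auto simp: in_keys_iff)

lemma tlinear_lin_ext: "tlinear (lin_ext h)"
  unfolding tlinear_iff
proof (intro conjI allI)
  fix x y :: "'a falg"
  let ?A = "Poly_Mapping.keys x \<union> Poly_Mapping.keys y"
  have "lin_ext h (x + y) = (\<Sum>w\<in>?A. tscale (Poly_Mapping.lookup (x + y) w) (h w))"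
    by (rule lin_ext_superset) (simp_all add: keys_add)
  also have "\<dots> = lin_ext h x + lin_ext h y"
    by (simp add: lin_ext_superset[of ?A] lookup_add tvs.scale_left_distrib sum.distrib)
  finally show "lin_ext h (x + y) = lin_ext h x + lin_ext h y" .
next
  fix c and x :: "'a falg"
  have "Poly_Mapping.keys (tscale c x) \<subseteq> Poly_Mapping.keys x"
    by (auto simp: in_keys_iff lookup_tscale)
  then have "lin_ext h (tscale c x) = (\<Sum>w\<in>Poly_Mapping.keys x. tscale (Poly_Mapping.lookup (tscale c x) w) (h w))"
    by (intro lin_ext_superset) simp_all
  also have "\<dots> = tscale c (lin_ext h x)"
    by (simp add: lin_ext_def lookup_tscale tvs.scale_sum_right)
  finally show "lin_ext h (tscale c x) = tscale c (lin_ext h x)" .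
qed

named_theorems tlin

text \<open>Operator identities below are checked on words only; these closure rules discharge the
  linearity of both sides.\<close>

lemma tlinear_id [tlin]: "tlinear (\<lambda>x. x)"
  and tlinear_zero [tlin]: "tlinear (\<lambda>x. 0)"
  and tlinear_plus [tlin]: "tlinear f \<Longrightarrow> tlinear g \<Longrightarrow> tlinear (\<lambda>x. f x + g x)"
  and tlinear_minus [tlin]: "tlinear f \<Longrightarrow> tlinear g \<Longrightarrow> tlinear (\<lambda>x. f x - g x)"
  and tlinear_tscale [tlin]: "tlinear f \<Longrightarrow> tlinear (\<lambda>x. tscale c (f x))"
  and tlinear_mult_left [tlin]: "tlinear f \<Longrightarrow> tlinear (\<lambda>x. y * f x)"
  and tlinear_mult_right [tlin]: "tlinear f \<Longrightarrow> tlinear (\<lambda>x. f x * y)"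
  and tlinear_lin_ext' [tlin]: "tlinear f \<Longrightarrow> tlinear (\<lambda>x. lin_ext h (f x))"
  by (simp_all add: tlinear_iff tvs.scale_right_distrib tvs.scale_right_diff_distrib mult.commute
      distrib_left distrib_right tscale_mult_left tscale_mult_right
      tlinear_lin_ext[unfolded tlinear_iff])

subsection \<open>The action of the generators on the tensor algebra\<close>

text \<open>Letters and indices are not bounded by \<open>n\<close>: the operators below satisfy the relations of \<open>Urs\<close> on words
  in all natural numbers, of any length.\<close>

definition wt :: "complex \<Rightarrow> complex \<Rightarrow> nat \<Rightarrow> nat \<Rightarrow> complex" where
  "wt c d i a = (if a = i then c else if a = i + 1 then d else 1)"

definition wword :: "complex \<Rightarrow> complex \<Rightarrow> nat \<Rightarrow> nat list \<Rightarrow> complex" where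
  "wword c d i u = prod_list (map (wt c d i) u)"

text \<open>The coproduct e_i \<otimes> 1 + \<omega>_i \<otimes> e_i unrolled along the word; the
  value on the empty word is the counit.\<close>

primrec eword :: "complex \<Rightarrow> complex \<Rightarrow> nat \<Rightarrow> nat list \<Rightarrow> nat falg" where
  "eword r s i [] = 0"
| "eword r s i (a # u) = (if a = i + 1 then mon (i # u) else 0) + tscale (wt r s i a) (mon [a] * eword r s i u)"

text \<open>The coproduct 1 \<otimes> f_i + f_i \<otimes> \<omega>'_i unrolled; \<omega>'_i on the
  tail explains the order s, r of the parameters.\<close>

primrec fword :: "complex \<Rightarrow> complex \<Rightarrow> nat \<Rightarrow> nat list \<Rightarrow> nat falg" where
  "fword r s i [] = 0"
| "fword r s i (a # u) = mon [a] * fword r s i u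
     + (if a = i then tscale (wword s r i u) (mon ((i + 1) # u)) else 0)"

definition Eop :: "complex \<Rightarrow> complex \<Rightarrow> nat \<Rightarrow> nat falg \<Rightarrow> nat falg" where
  "Eop r s i = lin_ext (eword r s i)"

definition Fop :: "complex \<Rightarrow> complex \<Rightarrow> nat \<Rightarrow> nat falg \<Rightarrow> nat falg" where
  "Fop r s i = lin_ext (fword r s i)"

definition Wop :: "complex \<Rightarrow> complex \<Rightarrow> nat \<Rightarrow> nat falg \<Rightarrow> nat falg" where
  "Wop c d i = lin_ext (\<lambda>u. tscale (wword c d i u) (mon u))"

lemma tlinear_ops [tlin]:
  "tlinear f \<Longrightarrow> tlinear (\<lambda>x. Eop r s i (f x))"
  "tlinear f \<Longrightarrow> tlinear (\<lambda>x. Fop r s i (f x))"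
  "tlinear f \<Longrightarrow> tlinear (\<lambda>x. Wop r s i (f x))"
  unfolding Eop_def Fop_def Wop_def by (rule tlin, assumption)+

lemma ops_linear [simp]:
  "Eop r s i (x + y) = Eop r s i x + Eop r s i y" "Eop r s i (tscale c x) = tscale c (Eop r s i x)"
  "Fop r s i (x + y) = Fop r s i x + Fop r s i y" "Fop r s i (tscale c x) = tscale c (Fop r s i x)"
  "Wop r s i (x + y) = Wop r s i x + Wop r s i y" "Wop r s i (tscale c x) = tscale c (Wop r s i x)"
  "Eop r s i 0 = 0" "Fop r s i 0 = 0" "Wop r s i 0 = 0"
  unfolding Eop_def Fop_def Wop_def
  by (simp_all add: tlinear_lin_ext tlinear_add tlinear_scale tlinear_0)

lemma ops_mon:
  "Eop r s i (mon u) = eword r s i u" "Fop r s i (mon u) = fword r s i u"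
  "Wop r s i (mon u) = tscale (wword r s i u) (mon u)"
  by (simp_all add: Eop_def Fop_def Wop_def)

lemma tlinear2_eqI:
  assumes "\<And>y. tlinear (\<lambda>x. f x y)" "\<And>x. tlinear (f x)" "\<And>y. tlinear (\<lambda>x. g x y)" "\<And>x. tlinear (g x)"
    and "\<And>u v. f (mon u) (mon v) = g (mon u) (mon v)"
  shows "f x y = g x y"
proof (rule tlinear_eqI[OF assms(1) assms(3)])
  fix u show "f (mon u) y = g (mon u) y"
    by (rule tlinear_eqI[OF assms(2,4,5)])
qed

lemma wword_append: "wword c d i (u @ v) = wword c d i u * wword c d i v"
  and wword_Cons: "wword c d i (a # u) = wt c d i a * wword c d i u"
  and wword_Nil: "wword c d i [] = 1"
  by (simp_all add: wword_def)

text \<open>Since the product of the tensor algebra is the tensor product, the coproduct of a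
  generator turns into a rule for its action on products: multiplicative for the diagonal operators,
  a twisted Leibniz rule for e_i and f_i in the next two lemmas.\<close>

lemma Wop_mult: "Wop c d i (x * y) = Wop c d i x * Wop c d i y"
  by (rule tlinear2_eqI[where f = "\<lambda>x y. Wop c d i (x * y)"]; (intro tlin)?)
    (simp add: mon_mult ops_mon wword_append tscale_mult_left tscale_mult_right mult.commute)

lemma Eop_mult: "Eop r s i (x * y) = Eop r s i x * y + Wop r s i x * Eop r s i y"
proof (rule tlinear2_eqI[where f = "\<lambda>x y. Eop r s i (x * y)"]; (intro tlin)?)
  fix u v
  have "eword r s i (u @ v) = eword r s i u * mon v + tscale (wword r s i u) (mon u) * eword r s i v"
  proof (induction u)
    case Nil
    then show ?case by (simp add: wword_Nil mon_Nil)
  next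
    case (Cons a u)
    have "mon (i # u) * mon v = mon (i # u @ v)" "mon (a # u) = mon [a] * mon u"
      by (simp_all add: mon_mult)
    then show ?case
      by (simp add: Cons wword_Cons distrib_left distrib_right tscale_mult_left tscale_mult_right
          tvs.scale_right_distrib mult.assoc add.assoc)
  qed
  then show "Eop r s i (mon u * mon v) = Eop r s i (mon u) * mon v + Wop r s i (mon u) * Eop r s i (mon v)"
    by (simp add: mon_mult ops_mon)
qed

lemma Fop_mult: "Fop r s i (x * y) = x * Fop r s i y + Fop r s i x * Wop s r i y"
proof (rule tlinear2_eqI[where f = "\<lambda>x y. Fop r s i (x * y)"]; (intro tlin)?)
  fix u v
  have "fword r s i (u @ v) = mon u * fword r s i v + fword r s i u * tscale (wword s r i v) (mon v)"
  proof (induction u)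
    case Nil
    then show ?case by (simp add: wword_Nil mon_Nil)
  next
    case (Cons a u)
    have "mon (Suc i # u) * mon v = mon (Suc i # u @ v)" "mon (a # u) = mon [a] * mon u"
      by (simp_all add: mon_mult)
    then show ?case
      by (simp add: Cons wword_append distrib_left distrib_right tscale_mult_left tscale_mult_right
          tvs.scale_right_distrib mult.assoc add.assoc mult.commute)
  qed
  then show "Fop r s i (mon u * mon v) = mon u * Fop r s i (mon v) + Fop r s i (mon u) * Wop s r i (mon v)"
    by (simp add: mon_mult ops_mon)
qed

lemma Wop_letter: "Wop c d i (mon [a]) = tscale (wt c d i a) (mon [a])"
  by (simp add: ops_mon wword_def)

lemma Eop_Cons:
  "Eop r s i (mon [a] * x) = (if a = i + 1 then mon [i] * x else 0) + tscale (wt r s i a) (mon [a] * Eop r s i x)"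
  unfolding Eop_mult Wop_letter by (simp add: ops_mon tscale_mult_left)

lemma Fop_Cons:
  "Fop r s i (mon [a] * x) = mon [a] * Fop r s i x + (if a = i then mon [i + 1] * Wop s r i x else 0)"
  unfolding Fop_mult by (simp add: ops_mon wword_Nil)

lemma Fop_snoc:
  "Fop r s i (x * mon [a]) = (if a = i then x * mon [i + 1] else 0) + tscale (wt s r i a) (Fop r s i x * mon [a])"
  unfolding Fop_mult Wop_letter by (simp add: ops_mon wword_Nil tscale_mult_right)

lemma Wop_Cons: "Wop c d i (mon [a] * x) = tscale (wt c d i a) (mon [a] * Wop c d i x)"
  by (simp add: Wop_mult Wop_letter tscale_mult_left)

lemma Wop_snoc: "Wop c d i (x * mon [a]) = tscale (wt c d i a) (Wop c d i x * mon [a])"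
  by (simp add: Wop_mult Wop_letter tscale_mult_right)

lemma ops_one [simp]: "Eop r s i 1 = 0" "Fop r s i 1 = 0" "Wop c d i 1 = 1"
  using ops_mon[of r s i "[]"] ops_mon(3)[of c d i "[]"] by (simp_all add: mon_Nil wword_Nil)

text \<open>Relations among the \<open>e\<^sub>i\<close> are checked by splitting off the first letter and those among the \<open>f\<^sub>i\<close> by
  splitting off the last one: then the coproduct produces only scalars besides the operators themselves.\<close>

lemma eq_by_Cons:
  assumes "tlinear f" "tlinear g" "f 1 = g 1" "\<And>a x. f x = g x \<Longrightarrow> f (mon [a] * x) = g (mon [a] * x)"
  shows "f x = g x"
proof (rule tlinear_eqI[OF assms(1,2)])
  fix u show "f (mon u) = g (mon u)"
  proof (induction u)
    case (Cons a u)
    then show ?case unfolding mon_Cons[of a u] by (rule assms(4))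
  qed (simp add: mon_Nil assms(3))
qed

lemma eq_by_snoc:
  assumes "tlinear f" "tlinear g" "f 1 = g 1" "\<And>a x. f x = g x \<Longrightarrow> f (x * mon [a]) = g (x * mon [a])"
  shows "f x = g x"
proof (rule tlinear_eqI[OF assms(1,2)])
  fix u show "f (mon u) = g (mon u)"
  proof (induction u rule: rev_induct)
    case (snoc a u)
    then show ?case unfolding mon_snoc[of u a] by (rule assms(4))
  qed (simp add: mon_Nil assms(3))
qed

lemmas tscale_simps = tvs.scale_right_distrib tvs.scale_left_distrib tvs.scale_right_diff_distrib
  tvs.scale_left_diff_distrib tscale_mult_left tscale_mult_right

section \<open>The defining relations as operator identities\<close>

lemma Wop_comm: "Wop c d i (Wop c' d' j x) = Wop c' d' j (Wop c d i x)"
  by (rule tlinear_eqI; (intro tlin)?) (simp add: ops_mon mult.commute)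

lemma Wop_inverse:
  assumes "c \<noteq> 0" "d \<noteq> 0"
  shows "Wop c d i (Wop (inverse c) (inverse d) i x) = x"
proof (rule tlinear_eqI; (intro tlin)?)
  fix u
  have "wword c d i u * wword (inverse c) (inverse d) i u = 1"
  proof (induction u)
    case (Cons a u)
    have "wt c d i a * wt (inverse c) (inverse d) i a = 1" using assms by (simp add: wt_def)
    with Cons show ?case by (simp add: wword_Cons algebra_simps)
  qed (simp add: wword_Nil)
  then show "Wop c d i (Wop (inverse c) (inverse d) i (mon u)) = mon u"
    by (simp add: ops_mon mult.commute)
qed

text \<open>e_j turns one letter j + 1 into j, so the eigenvalue of a diagonal operator changes by
  the quotient of the weights of these two letters. For f_j the quotient is inverted.\<close>

lemma Wop_Eop:
  assumes "c \<noteq> 0" "d \<noteq> 0"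
  shows "Wop c d i (Eop r s j x) = tscale (wt c d i j / wt c d i (j + 1)) (Eop r s j (Wop c d i x))"
proof (rule eq_by_Cons[where x = x]; (intro tlin)?)
  fix a x
  assume "Wop c d i (Eop r s j x) = tscale (wt c d i j / wt c d i (j + 1)) (Eop r s j (Wop c d i x))"
  moreover have "wt c d i (j + 1) \<noteq> 0" using assms by (simp add: wt_def)
  ultimately show "Wop c d i (Eop r s j (mon [a] * x))
    = tscale (wt c d i j / wt c d i (j + 1)) (Eop r s j (Wop c d i (mon [a] * x)))"
    by (simp add: Eop_Cons Wop_Cons tscale_simps mult_ac)
qed simp

lemma Wop_Fop:
  assumes "c \<noteq> 0" "d \<noteq> 0"
  shows "Wop c d i (Fop r s j x) = tscale (wt c d i (j + 1) / wt c d i j) (Fop r s j (Wop c d i x))"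
proof (rule eq_by_snoc[where x = x]; (intro tlin)?)
  fix a x
  assume "Wop c d i (Fop r s j x) = tscale (wt c d i (j + 1) / wt c d i j) (Fop r s j (Wop c d i x))"
  moreover have "wt c d i j \<noteq> 0" using assms by (simp add: wt_def)
  ultimately show "Wop c d i (Fop r s j (x * mon [a]))
    = tscale (wt c d i (j + 1) / wt c d i j) (Fop r s j (Wop c d i (x * mon [a])))"
    by (simp add: Fop_snoc Wop_snoc tscale_simps mult_ac)
qed simp

text \<open>The assumption says that the two cross terms cancel: those where f_j acts on the first
  letter and e_i on the rest, in either order of application. For i = j there remains the term where
  both act on the first letter.\<close>

lemma Eop_Fop_Cons_same:
  assumes "tscale (wt r s i j) (mon [j + 1] * Wop s r j (Eop r s i x))
      = tscale (wt r s i (j + 1)) (mon [j + 1] * Eop r s i (Wop s r j x))"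
  shows "Eop r s i (Fop r s j (mon [j] * x)) - Fop r s j (Eop r s i (mon [j] * x))
    = tscale (wt r s i j) (mon [j] * (Eop r s i (Fop r s j x) - Fop r s j (Eop r s i x)))
      + (if i = j then mon [j] * Wop s r i x else 0)"
proof (cases "i = j")
  case True
  show ?thesis using assms unfolding True
    by (simp add: Eop_Cons Fop_Cons tscale_simps right_diff_distrib)
next
  case False
  then show ?thesis using assms
    by (cases "j = i + 1") (simp_all add: Eop_Cons Fop_Cons tscale_simps right_diff_distrib)
qed

lemma Eop_Fop_Cons_other:
  assumes "a \<noteq> j"
  shows "Eop r s i (Fop r s j (mon [a] * x)) - Fop r s j (Eop r s i (mon [a] * x))
    = tscale (wt r s i a) (mon [a] * (Eop r s i (Fop r s j x) - Fop r s j (Eop r s i x)))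
      - (if i = j \<and> a = i + 1 then mon [a] * Wop s r i x else 0)"
proof (cases "i = j")
  case True
  show ?thesis using assms unfolding True
    by (cases "a = j + 1") (simp_all add: Eop_Cons Fop_Cons tscale_simps right_diff_distrib)
next
  case False
  then show ?thesis using assms
    by (cases "a = i + 1") (simp_all add: Eop_Cons Fop_Cons tscale_simps right_diff_distrib)
qed

text \<open>Prepending the letter i multiplies the commutator by r and adds a term in \<omega>'_i.
  After scaling by r - s the induction step is r (\<omega> - \<omega>') + (r - s) \<omega>' = r
  \<omega> - s \<omega>'. The letter i + 1 gives s (\<omega> - \<omega>') - (r - s) \<omega>' = s
  \<omega> - r \<omega>'.\<close>

lemma Eop_Fop:
  assumes "r \<noteq> 0" "s \<noteq> 0"
  shows "tscale (r - s) (Eop r s i (Fop r s j x) - Fop r s j (Eop r s i x))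
    = (if i = j then Wop r s i x - Wop s r i x else 0)"
proof (rule eq_by_Cons[where x = x]; (intro tlin)?)
  show "tlinear (\<lambda>x. if i = j then Wop r s i x - Wop s r i x else 0)"
    by (cases "i = j") (simp_all add: tlin)
  fix a x
  assume IH: "tscale (r - s) (Eop r s i (Fop r s j x) - Fop r s j (Eop r s i x))
    = (if i = j then Wop r s i x - Wop s r i x else 0)"
  have WE: "Wop s r j (Eop r s i x) = tscale (wt s r j i / wt s r j (i + 1)) (Eop r s i (Wop s r j x))"
    by (rule Wop_Eop[OF assms(2,1)])
  \<comment> \<open>The factor that f_j causes in the weight under \<omega>_i equals the one that
    e_i causes in the weight under \<omega>'_j; this is why the cross terms cancel.\<close>
  have w: "wt r s i (j + 1) = wt r s i j * (wt s r j i / wt s r j (i + 1))"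
    using assms by (auto simp: wt_def)
  have distr: "tscale t (tscale u (m * D) + P - Q) = tscale u (m * tscale t D) + tscale t P - tscale t Q"
    for t u and m D P Q :: "nat falg"
    by (simp add: tscale_mult_right tvs.scale_right_distrib tvs.scale_right_diff_distrib mult.commute)
  have "Eop r s i (Fop r s j (mon [a] * x)) - Fop r s j (Eop r s i (mon [a] * x))
    = tscale (wt r s i a) (mon [a] * (Eop r s i (Fop r s j x) - Fop r s j (Eop r s i x)))
      + (if i = j \<and> a = i then mon [a] * Wop s r i x else 0)
      - (if i = j \<and> a = i + 1 then mon [a] * Wop s r i x else 0)"
  proof (cases "a = j")
    case True
    have "tscale (wt r s i j) (Wop s r j (Eop r s i x)) = tscale (wt r s i (j + 1)) (Eop r s i (Wop s r j x))"
      by (simp only: WE w tvs.scale_scale)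
    then have "tscale (wt r s i j) (mon [j + 1] * Wop s r j (Eop r s i x))
      = tscale (wt r s i (j + 1)) (mon [j + 1] * Eop r s i (Wop s r j x))"
      by (simp only: tscale_mult_right[symmetric])
    from Eop_Fop_Cons_same[OF this] show ?thesis unfolding True by auto
  next
    case False
    from Eop_Fop_Cons_other[OF this] show ?thesis using False by auto
  qed
  then have "tscale (r - s) (Eop r s i (Fop r s j (mon [a] * x)) - Fop r s j (Eop r s i (mon [a] * x)))
    = tscale (wt r s i a) (mon [a] * tscale (r - s) (Eop r s i (Fop r s j x) - Fop r s j (Eop r s i x)))
      + tscale (r - s) (if i = j \<and> a = i then mon [a] * Wop s r i x else 0)
      - tscale (r - s) (if i = j \<and> a = i + 1 then mon [a] * Wop s r i x else 0)"
    by (simp only: distr)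
  then show "tscale (r - s) (Eop r s i (Fop r s j (mon [a] * x)) - Fop r s j (Eop r s i (mon [a] * x)))
    = (if i = j then Wop r s i (mon [a] * x) - Wop s r i (mon [a] * x) else 0)"
    unfolding IH by (cases "i = j") (auto simp: Wop_Cons wt_def tscale_simps right_diff_distrib)
qed simp

lemma Eop_comm:
  assumes "i + 1 < j"
  shows "Eop r s i (Eop r s j x) = Eop r s j (Eop r s i x)"
  by (rule eq_by_Cons[where x = x]; (intro tlin)?)
    (use assms in \<open>auto simp: Eop_Cons wt_def tscale_simps mult_ac\<close>)

lemma Fop_comm:
  assumes "i + 1 < j"
  shows "Fop r s i (Fop r s j x) = Fop r s j (Fop r s i x)"
  by (rule eq_by_snoc[where x = x]; (intro tlin)?)
    (use assms in \<open>auto simp: Fop_snoc wt_def tscale_simps mult_ac\<close>)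

lemmas algebra_distribs = right_diff_distrib left_diff_distrib distrib_left distrib_right

text \<open>The Serre expression u is skew-primitive: its coproduct is u \<otimes> 1 + \<omega>_i^2
  \<omega>_(i+1) \<otimes> u. As u kills single letters, prepending a letter merely rescales the
  defect \<open>S\<close>, by the eigenvalue of \<omega>_i^2 \<omega>_(i+1) on that letter. These
  eigenvalues are the scalars in the four cases.\<close>

lemma Eop_Serre1:
  "tscale (r + s) (Eop r s i (Eop r s (i + 1) (Eop r s i x)))
    = Eop r s i (Eop r s i (Eop r s (i + 1) x)) + tscale (r * s) (Eop r s (i + 1) (Eop r s i (Eop r s i x)))"
proof -
  define S where "S = (\<lambda>x. tscale (r + s) (Eop r s i (Eop r s (i + 1) (Eop r s i x)))
    - (Eop r s i (Eop r s i (Eop r s (i + 1) x)) + tscale (r * s) (Eop r s (i + 1) (Eop r s i (Eop r s i x)))))"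
  have step: "\<exists>c. S (mon [a] * x) = tscale c (mon [a] * S x)" for a x
  proof -
    consider "a = i" | "a = i + 1" | "a = i + 2" | "a \<noteq> i" "a \<noteq> i + 1" "a \<noteq> i + 2" by blast
    then show ?thesis
    proof cases
      case 1
      have "S (mon [i] * x) = tscale (r\<^sup>2) (mon [i] * S x)"
        unfolding S_def by (simp add: Eop_Cons wt_def)
          (simp add: tscale_simps algebra_distribs mult_ac power2_eq_square)
      with 1 show ?thesis by blast
    next
      case 2
      have "S (mon [i + 1] * x) = tscale (s\<^sup>2 * r) (mon [i + 1] * S x)"
        unfolding S_def by (simp add: Eop_Cons wt_def)
          (simp add: tscale_simps algebra_distribs mult_ac power2_eq_square)
      with 2 show ?thesis by blast
    next
      case 3
      have "S (mon [i + 2] * x) = tscale (s) (mon [i + 2] * S x)"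
        unfolding S_def by (simp add: Eop_Cons wt_def)
          (simp add: tscale_simps algebra_distribs mult_ac power2_eq_square)
      with 3 show ?thesis by blast
    next
      case 4
      then have "S (mon [a] * x) = tscale 1 (mon [a] * S x)"
        unfolding S_def by (simp add: Eop_Cons wt_def)
          (simp add: tscale_simps algebra_distribs)
      then show ?thesis by blast
    qed
  qed
  have "S x = 0"
  proof (rule eq_by_Cons[where f = S and g = "\<lambda>_. 0"])
    show "tlinear S" unfolding S_def by (intro tlin)
    show "S 1 = 0" by (simp add: S_def)
    show "S (mon [a] * x) = 0" if "S x = 0" for a x
      using step[of a x] that by auto
  qed (rule tlin)
  then show ?thesis by (simp add: S_def)
qed

text \<open>As before, with the eigenvalues of \<omega>_i \<omega>_(i+1)^2 as scalars.\<close>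

lemma Eop_Serre2:
  "tscale (r + s) (Eop r s (i + 1) (Eop r s i (Eop r s (i + 1) x)))
    = Eop r s i (Eop r s (i + 1) (Eop r s (i + 1) x)) + tscale (r * s) (Eop r s (i + 1) (Eop r s (i + 1) (Eop r s i x)))"
proof -
  define S where "S = (\<lambda>x. tscale (r + s) (Eop r s (i + 1) (Eop r s i (Eop r s (i + 1) x)))
    - (Eop r s i (Eop r s (i + 1) (Eop r s (i + 1) x)) + tscale (r * s) (Eop r s (i + 1) (Eop r s (i + 1) (Eop r s i x)))))"
  have step: "\<exists>c. S (mon [a] * x) = tscale c (mon [a] * S x)" for a x
  proof -
    consider "a = i" | "a = i + 1" | "a = i + 2" | "a \<noteq> i" "a \<noteq> i + 1" "a \<noteq> i + 2" by blast
    then show ?thesis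
    proof cases
      case 1
      have "S (mon [i] * x) = tscale (r) (mon [i] * S x)"
        unfolding S_def by (simp add: Eop_Cons wt_def)
          (simp add: tscale_simps algebra_distribs mult_ac power2_eq_square)
      with 1 show ?thesis by blast
    next
      case 2
      have "S (mon [i + 1] * x) = tscale (s * r\<^sup>2) (mon [i + 1] * S x)"
        unfolding S_def by (simp add: Eop_Cons wt_def)
          (simp add: tscale_simps algebra_distribs mult_ac power2_eq_square)
      with 2 show ?thesis by blast
    next
      case 3
      have "S (mon [i + 2] * x) = tscale (s\<^sup>2) (mon [i + 2] * S x)"
        unfolding S_def by (simp add: Eop_Cons wt_def)
          (simp add: tscale_simps algebra_distribs mult_ac power2_eq_square)
      with 3 show ?thesis by blast
    next
      case 4
      then have "S (mon [a] * x) = tscale 1 (mon [a] * S x)"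
        unfolding S_def by (simp add: Eop_Cons wt_def)
          (simp add: tscale_simps algebra_distribs)
      then show ?thesis by blast
    qed
  qed
  have "S x = 0"
  proof (rule eq_by_Cons[where f = S and g = "\<lambda>_. 0"])
    show "tlinear S" unfolding S_def by (intro tlin)
    show "S 1 = 0" by (simp add: S_def)
    show "S (mon [a] * x) = 0" if "S x = 0" for a x
      using step[of a x] that by auto
  qed (rule tlin)
  then show ?thesis by (simp add: S_def)
qed

text \<open>The mirror image of the argument for the e_i: appending a letter rescales the defect by
  the eigenvalue of \<omega>'_i^2 \<omega>'_(i+1). The relation is cleared of denominators by the
  factor r s, which leaves the coefficients r + s and r s.\<close>

lemma Fop_Serre1:
  "tscale (r + s) (Fop r s i (Fop r s (i + 1) (Fop r s i x)))
    = tscale (r * s) (Fop r s i (Fop r s i (Fop r s (i + 1) x))) + Fop r s (i + 1) (Fop r s i (Fop r s i x))"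
proof -
  define S where "S = (\<lambda>x. tscale (r + s) (Fop r s i (Fop r s (i + 1) (Fop r s i x)))
    - (tscale (r * s) (Fop r s i (Fop r s i (Fop r s (i + 1) x))) + Fop r s (i + 1) (Fop r s i (Fop r s i x))))"
  have step: "\<exists>c. S (x * mon [a]) = tscale c (S x * mon [a])" for a x
  proof -
    consider "a = i" | "a = i + 1" | "a = i + 2" | "a \<noteq> i" "a \<noteq> i + 1" "a \<noteq> i + 2" by blast
    then show ?thesis
    proof cases
      case 1
      have "S (x * mon [i]) = tscale (s\<^sup>2) (S x * mon [i])"
        unfolding S_def by (simp add: Fop_snoc wt_def)
          (simp add: tscale_simps algebra_distribs mult_ac power2_eq_square)
      with 1 show ?thesis by blast
    next
      case 2
      have "S (x * mon [i + 1]) = tscale (r\<^sup>2 * s) (S x * mon [i + 1])"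
        unfolding S_def by (simp add: Fop_snoc wt_def)
          (simp add: tscale_simps algebra_distribs mult_ac power2_eq_square)
      with 2 show ?thesis by blast
    next
      case 3
      have "S (x * mon [i + 2]) = tscale (r) (S x * mon [i + 2])"
        unfolding S_def by (simp add: Fop_snoc wt_def)
          (simp add: tscale_simps algebra_distribs mult_ac power2_eq_square)
      with 3 show ?thesis by blast
    next
      case 4
      then have "S (x * mon [a]) = tscale 1 (S x * mon [a])"
        unfolding S_def by (simp add: Fop_snoc wt_def)
          (simp add: tscale_simps algebra_distribs)
      then show ?thesis by blast
    qed
  qed
  have "S x = 0"
  proof (rule eq_by_snoc[where f = S and g = "\<lambda>_. 0"])
    show "tlinear S" unfolding S_def by (intro tlin)
    show "S 1 = 0" by (simp add: S_def)
    show "S (x * mon [a]) = 0" if "S x = 0" for a x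
      using step[of x a] that by auto
  qed (rule tlin)
  then show ?thesis by (simp add: S_def)
qed

text \<open>Here the scalars are the eigenvalues of \<omega>'_i \<omega>'_(i+1)^2.\<close>

lemma Fop_Serre2:
  "tscale (r + s) (Fop r s (i + 1) (Fop r s i (Fop r s (i + 1) x)))
    = tscale (r * s) (Fop r s i (Fop r s (i + 1) (Fop r s (i + 1) x))) + Fop r s (i + 1) (Fop r s (i + 1) (Fop r s i x))"
proof -
  define S where "S = (\<lambda>x. tscale (r + s) (Fop r s (i + 1) (Fop r s i (Fop r s (i + 1) x)))
    - (tscale (r * s) (Fop r s i (Fop r s (i + 1) (Fop r s (i + 1) x))) + Fop r s (i + 1) (Fop r s (i + 1) (Fop r s i x))))"
  have step: "\<exists>c. S (x * mon [a]) = tscale c (S x * mon [a])" for a x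
  proof -
    consider "a = i" | "a = i + 1" | "a = i + 2" | "a \<noteq> i" "a \<noteq> i + 1" "a \<noteq> i + 2" by blast
    then show ?thesis
    proof cases
      case 1
      have "S (x * mon [i]) = tscale (s) (S x * mon [i])"
        unfolding S_def by (simp add: Fop_snoc wt_def)
          (simp add: tscale_simps algebra_distribs mult_ac power2_eq_square)
      with 1 show ?thesis by blast
    next
      case 2
      have "S (x * mon [i + 1]) = tscale (r * s\<^sup>2) (S x * mon [i + 1])"
        unfolding S_def by (simp add: Fop_snoc wt_def)
          (simp add: tscale_simps algebra_distribs mult_ac power2_eq_square)
      with 2 show ?thesis by blast
    next
      case 3
      have "S (x * mon [i + 2]) = tscale (r\<^sup>2) (S x * mon [i + 2])"
        unfolding S_def by (simp add: Fop_snoc wt_def)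
          (simp add: tscale_simps algebra_distribs mult_ac power2_eq_square)
      with 3 show ?thesis by blast
    next
      case 4
      then have "S (x * mon [a]) = tscale 1 (S x * mon [a])"
        unfolding S_def by (simp add: Fop_snoc wt_def)
          (simp add: tscale_simps algebra_distribs)
      then show ?thesis by blast
    qed
  qed
  have "S x = 0"
  proof (rule eq_by_snoc[where f = S and g = "\<lambda>_. 0"])
    show "tlinear S" unfolding S_def by (intro tlin)
    show "S 1 = 0" by (simp add: S_def)
    show "S (x * mon [a]) = 0" if "S x = 0" for a x
      using step[of x a] that by auto
  qed (rule tlin)
  then show ?thesis by (simp add: S_def)
qed

subsection \<open>The ring and its action on tensor powers\<close>

lemma carrier_free_alg: "carrier (free_alg n) = {p. Poly_Mapping.keys p \<subseteq> lists (gens n)}"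
  and free_alg_ops [simp]: "p \<oplus>\<^bsub>free_alg n\<^esub> q = p + q" "p \<otimes>\<^bsub>free_alg n\<^esub> q = p * q"
    "\<zero>\<^bsub>free_alg n\<^esub> = 0" "\<one>\<^bsub>free_alg n\<^esub> = 1"
  by (simp_all add: free_alg_def class_ring_def)

lemma free_alg_closed:
  assumes "p \<in> carrier (free_alg n)" "q \<in> carrier (free_alg n)"
  shows "p + q \<in> carrier (free_alg n)" "p - q \<in> carrier (free_alg n)"
    "p * q \<in> carrier (free_alg n)"
proof -
  show "p + q \<in> carrier (free_alg n)"
    using assms keys_add[of p q] unfolding carrier_free_alg by blast
  show "p - q \<in> carrier (free_alg n)"
    using assms keys_diff[of p q] unfolding carrier_free_alg by blast
  show "p * q \<in> carrier (free_alg n)"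
    unfolding carrier_free_alg
  proof (intro CollectI subsetI)
    fix w assume "w \<in> Poly_Mapping.keys (p * q)"
    then obtain u v where uv: "u \<in> Poly_Mapping.keys p" "v \<in> Poly_Mapping.keys q" "w = u + v"
      using keys_mult[of p q] by blast
    then have "u \<in> lists (gens n)" "v \<in> lists (gens n)"
      using assms unfolding carrier_free_alg by blast+
    with uv show "w \<in> lists (gens n)" by (simp add: plus_list_def)
  qed
qed

lemma free_alg_minus_closed: "p \<in> carrier (free_alg n) \<Longrightarrow> - p \<in> carrier (free_alg n)"
  by (simp add: carrier_free_alg)

lemma const_in_free_alg [simp]: "const c \<in> carrier (free_alg n)"
  by (simp add: carrier_free_alg const_def)

lemma one_in_free_alg [simp]: "1 \<in> carrier (free_alg n)"
  using const_in_free_alg[of 1] by (simp only: const_one)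

lemma zero_in_free_alg [simp]: "0 \<in> carrier (free_alg n)"
  by (simp add: carrier_free_alg)

lemma gen_in_free_alg [simp]: "mon [g] \<in> carrier (free_alg n) \<longleftrightarrow> g \<in> gens n"
  by (simp add: carrier_free_alg keys_mon)

lemma ring_free_alg: "ring (free_alg n)"
proof (rule ringI)
  show "abelian_group (free_alg n)"
  proof (rule abelian_groupI)
    fix x assume "x \<in> carrier (free_alg n)"
    then show "\<exists>y\<in>carrier (free_alg n). y \<oplus>\<^bsub>free_alg n\<^esub> x = \<zero>\<^bsub>free_alg n\<^esub>"
      by (intro bexI[of _ "- x"]) (simp_all add: free_alg_minus_closed)
  qed (simp_all add: free_alg_closed add_ac)
  show "monoid (free_alg n)"
    by (rule monoidI) (simp_all add: free_alg_closed mult.assoc)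
qed (simp_all add: distrib_left distrib_right)

lemma a_inv_free_alg:
  assumes p: "p \<in> carrier (free_alg n)"
  shows "\<ominus>\<^bsub>free_alg n\<^esub> p = - p"
proof (rule abelian_group.minus_equality[OF ring.is_abelian_group[OF ring_free_alg]])
  show "- p \<oplus>\<^bsub>free_alg n\<^esub> p = \<zero>\<^bsub>free_alg n\<^esub>" by simp
qed (use p free_alg_minus_closed in auto)

primrec opg :: "complex \<Rightarrow> complex \<Rightarrow> gen \<Rightarrow> nat falg \<Rightarrow> nat falg" where
  "opg r s (GE i) = Eop r s i"
| "opg r s (GF i) = Fop r s i"
| "opg r s (GW i) = Wop r s i"
| "opg r s (GWinv i) = Wop (inverse r) (inverse s) i"
| "opg r s (GW' i) = Wop s r i"
| "opg r s (GWinv' i) = Wop (inverse s) (inverse r) i"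

lemma tlinear_opg [tlin]: "tlinear f \<Longrightarrow> tlinear (\<lambda>x. opg r s g (f x))"
  by (cases g) (simp_all add: tlin)

lemma tlinear_foldr_opg [tlin]: "tlinear f \<Longrightarrow> tlinear (\<lambda>x. foldr (opg r s) u (f x))"
  by (induction u) (simp_all add: tlin)

definition act :: "complex \<Rightarrow> complex \<Rightarrow> gen falg \<Rightarrow> nat falg \<Rightarrow> nat falg" where
  "act r s p x = lin_ext (\<lambda>u. foldr (opg r s) u x) p"

lemma act_mon: "act r s (mon u) x = foldr (opg r s) u x"
  by (simp add: act_def)

lemma act_gen [simp]: "act r s (mon [g]) x = opg r s g x"
  by (simp add: act_mon)

lemma tlinear_act_left [tlin]: "tlinear f \<Longrightarrow> tlinear (\<lambda>p. act r s (f p) x)"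
  unfolding act_def by (rule tlin)

lemma act_left [simp]:
  "act r s (p + q) x = act r s p x + act r s q x"
  "act r s (p - q) x = act r s p x - act r s q x"
  "act r s (tscale c p) x = tscale c (act r s p x)"
  "act r s 0 x = 0"
proof -
  have l: "tlinear (\<lambda>p. act r s p x)" by (intro tlin)
  show "act r s (p + q) x = act r s p x + act r s q x" "act r s 0 x = 0"
    "act r s (tscale c p) x = tscale c (act r s p x)"
    using tlinear_add[OF l] tlinear_0[OF l] tlinear_scale[OF l] by simp_all
  show "act r s (p - q) x = act r s p x - act r s q x"
    using tlinear_add[OF l, of "p - q" q] by (simp add: algebra_simps)
qed

lemma tlinear_act_right: "tlinear (act r s p)"
  unfolding tlinear_iff
proof (intro conjI allI)
  have f: "tlinear (foldr (opg r s) u)" for u using tlinear_foldr_opg[OF tlinear_id] .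
  show "act r s p (x + y) = act r s p x + act r s p y" for x y
    by (rule tlinear_eqI[where x = p]; (intro tlin)?) (simp add: act_mon tlinear_add[OF f])
  show "act r s p (tscale c x) = tscale c (act r s p x)" for c x
    by (rule tlinear_eqI[where x = p]; (intro tlin)?) (simp add: act_mon tlinear_scale[OF f])
qed

lemma tlinear_act_right' [tlin]: "tlinear f \<Longrightarrow> tlinear (\<lambda>x. act r s p (f x))"
  using tlinear_act_right[of r s p] by (simp add: tlinear_iff)

lemma act_right [simp]:
  "act r s p (x + y) = act r s p x + act r s p y"
  "act r s p (tscale c x) = tscale c (act r s p x)"
  "act r s p 0 = 0"
  using tlinear_add tlinear_scale tlinear_0 tlinear_act_right by blast+

lemma act_right_diff [simp]: "act r s p (x - y) = act r s p x - act r s p y"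
  using act_right(1)[of r s p "x - y" y] by (simp add: algebra_simps)

lemma act_mult [simp]: "act r s (p * q) x = act r s p (act r s q x)"
  by (rule tlinear2_eqI[where f = "\<lambda>p q. act r s (p * q) x"]; (intro tlin)?)
    (simp add: act_mon mon_mult)

lemma act_const [simp]: "act r s (const c) x = tscale c x"
  by (simp add: const_eq_tscale act_mon)

lemma act_one [simp]: "act r s 1 x = x"
  using act_mon[of r s "[]"] by (simp add: mon_Nil)

lemma ip_eps: "i \<in> {1..n} \<Longrightarrow> ip n (eps i) y = y i"
  by (simp add: ip_def eps_def if_distrib[of "\<lambda>z. z * _"] cong: if_cong)

text \<open>\<epsilon>_i pairs with \<alpha>_j to 1 if i = j, to -1 if i = j + 1 and to 0 otherwise.
  So the powers in (R2) are the weight quotients of \<open>Wop_Eop\<close> and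
  \<open>Wop_Fop\<close>; exchanging r and s gives (R3).\<close>

lemma weight_powi:
  assumes "r \<noteq> 0" "s \<noteq> 0" "i \<in> {1..<n}"
  shows "r powi ip n (eps i) (alpha j) * s powi ip n (eps (i + 1)) (alpha j) = wt r s i j / wt r s i (j + 1)"
    and "r powi - ip n (eps i) (alpha j) * s powi - ip n (eps (i + 1)) (alpha j) = wt r s i (j + 1) / wt r s i j"
proof -
  have e: "ip n (eps i) (alpha j) = alpha j i" "ip n (eps (i + 1)) (alpha j) = alpha j (i + 1)"
    using assms(3) by (simp_all add: ip_eps)
  show "r powi ip n (eps i) (alpha j) * s powi ip n (eps (i + 1)) (alpha j) = wt r s i j / wt r s i (j + 1)"
    and "r powi - ip n (eps i) (alpha j) * s powi - ip n (eps (i + 1)) (alpha j) = wt r s i (j + 1) / wt r s i j"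
    unfolding e using assms(1,2)
    by (auto simp: alpha_def eps_def wt_def power_int_minus field_simps)
qed

lemma gens_mem:
  "i \<in> {1..<n} \<Longrightarrow> GE i \<in> gens n" "i \<in> {1..<n} \<Longrightarrow> GF i \<in> gens n"
  "i \<in> {1..<n} \<Longrightarrow> GW i \<in> gens n" "i \<in> {1..<n} \<Longrightarrow> GWinv i \<in> gens n"
  "i \<in> {1..<n} \<Longrightarrow> GW' i \<in> gens n" "i \<in> {1..<n} \<Longrightarrow> GWinv' i \<in> gens n"
  by (auto simp: gens_def)

section \<open>The relation ideal acts by zero\<close>

locale urs =
  fixes n :: nat and r s :: complex
  assumes r0: "r \<noteq> 0" and s0: "s \<noteq> 0" and rs: "r \<noteq> s"
begin

abbreviation A where "A \<equiv> free_alg n"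
abbreviation U where "U \<equiv> Urs n r s"
abbreviation I where "I \<equiv> rel_ideal n r s"
abbreviation rels where "rels \<equiv> R1 n \<union> R2 n r s \<union> R3 n r s \<union> R4 n r s \<union> R5 n \<union> R6 n r s \<union> R7 n r s"

lemma rels_carrier: "rels \<subseteq> carrier A"
proof -
  have c: "g \<in> gens n" if "g \<in> cartan_gens n" for g
    using that by (auto simp: cartan_gens_def gens_def)
  show ?thesis
    unfolding R1_def R2_def R3_def R4_def R5_def R6_def R7_def power2_eq_square
    by (auto intro!: free_alg_closed simp: gens_mem c)
qed

lemma ideal_I: "ideal I A"
  unfolding rel_ideal_def by (rule ring.genideal_ideal[OF ring_free_alg rels_carrier])

lemma opg_cartan_comm:
  assumes "g \<in> cartan_gens n" "h \<in> cartan_gens n"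
  shows "opg r s g (opg r s h x) = opg r s h (opg r s g x)"
  using assms by (auto simp: cartan_gens_def Wop_comm)

lemma Eop_Fop':
  "Eop r s i (Fop r s j x) - Fop r s j (Eop r s i x)
    = tscale ((if i = j then 1 else 0) / (r - s)) (Wop r s i x - Wop s r i x)"
proof -
  have "tscale (inverse (r - s)) (tscale (r - s) (Eop r s i (Fop r s j x) - Fop r s j (Eop r s i x)))
    = tscale (inverse (r - s)) (if i = j then Wop r s i x - Wop s r i x else 0)"
    by (simp only: Eop_Fop[OF r0 s0])
  then show ?thesis using rs by (simp add: divide_inverse split: if_splits)
qed

lemma Eop_comm':
  assumes "\<bar>int i - int j\<bar> > 1"
  shows "Eop r s i (Eop r s j x) = Eop r s j (Eop r s i x)" "Fop r s i (Fop r s j x) = Fop r s j (Fop r s i x)"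
proof -
  consider "i + 1 < j" | "j + 1 < i" using assms by linarith
  then have "Eop r s i (Eop r s j x) = Eop r s j (Eop r s i x) \<and> Fop r s i (Fop r s j x) = Fop r s j (Fop r s i x)"
    by cases (simp_all add: Eop_comm[of i j] Fop_comm[of i j] Eop_comm[of j i] Fop_comm[of j i])
  then show "Eop r s i (Eop r s j x) = Eop r s j (Eop r s i x)" "Fop r s i (Fop r s j x) = Fop r s j (Fop r s i x)"
    by simp_all
qed

lemma rels_vanish:
  assumes "p \<in> rels"
  shows "act r s p x = 0"
proof -
  have s1: "act r s p x = 0" if "p \<in> R1 n"
    using that Wop_inverse[OF r0 s0] Wop_inverse[OF s0 r0]
      Wop_inverse[of "inverse r" "inverse s"] Wop_inverse[of "inverse s" "inverse r"] r0 s0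
    by (auto simp: R1_def opg_cartan_comm)
  have s2: "act r s p x = 0" if "p \<in> R2 n r s"
    using that
    by (auto simp: R2_def Wop_Eop[OF r0 s0] Wop_Fop[OF r0 s0] weight_powi[OF r0 s0, simplified])
  have w': "r powi ip n (eps (i + 1)) (alpha j) * s powi ip n (eps i) (alpha j) = wt s r i j / wt s r i (j + 1)"
    "r powi - ip n (eps (i + 1)) (alpha j) * s powi - ip n (eps i) (alpha j) = wt s r i (j + 1) / wt s r i j"
    if "i \<in> {1..<n}" for i j
    using weight_powi[OF s0 r0 that, of j] by (simp_all add: mult.commute)
  have s3: "act r s p x = 0" if "p \<in> R3 n r s"
    using that
    by (auto simp: R3_def Wop_Eop[OF s0 r0] Wop_Fop[OF s0 r0] w'[simplified])
  have s4: "act r s p x = 0" if "p \<in> R4 n r s"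
    using that by (auto simp: R4_def Eop_Fop'[simplified] tvs.scale_right_diff_distrib)
  have s5: "act r s p x = 0" if "p \<in> R5 n"
    using that by (auto simp: R5_def Eop_comm')
  have s6: "act r s p x = 0" if "p \<in> R6 n r s"
    using that
    by (auto simp: R6_def power2_eq_square Eop_Serre1[simplified] Eop_Serre2[simplified])
  \<comment> \<open>Division by r s leads from the form of \<open>Fop_Serre1\<close> and
    \<open>Fop_Serre2\<close> back to the coefficients of (R7).\<close>
  have inv: "(inverse r + inverse s) = inverse (r * s) * (r + s)"
    using r0 s0 by (simp add: field_simps)
  have F: "tscale (inverse r + inverse s) y = z + tscale (inverse r * inverse s) w"
    if "tscale (r + s) y = tscale (r * s) z + w" for y z w :: "nat falg"
  proof -
    have "tscale (inverse (r * s)) (tscale (r + s) y) = tscale (inverse (r * s)) (tscale (r * s) z + w)"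
      using that by simp
    moreover have "inverse r * inverse s * (r * s) = 1" using r0 s0 by (simp add: field_simps)
    ultimately show ?thesis by (simp add: inv tvs.scale_right_distrib)
  qed
  have s7: "act r s p x = 0" if "p \<in> R7 n r s"
    using that
    by (auto simp: R7_def power2_eq_square F[OF Fop_Serre1, simplified] F[OF Fop_Serre2, simplified])
  show ?thesis using assms s1 s2 s3 s4 s5 s6 s7 by blast
qed

text \<open>The elements that annihilate the whole tensor algebra form a two-sided ideal, so
  containing the relations it contains the ideal they generate.\<close>

lemma I_vanish:
  assumes "p \<in> I"
  shows "act r s p x = 0"
proof -
  define J where "J = {p \<in> carrier A. \<forall>x. act r s p x = 0}"
  interpret ring A by (rule ring_free_alg)
  have "subgroup J (add_monoid A)"
  proof
    fix p assume p: "p \<in> J"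
    then have "inv\<^bsub>add_monoid A\<^esub> p = - p"
      using a_inv_free_alg[of p n] unfolding a_inv_def J_def by blast
    then show "inv\<^bsub>add_monoid A\<^esub> p \<in> J"
      using p act_left(2)[of r s 0 p] free_alg_minus_closed[of p n] unfolding J_def by simp
  qed (auto simp: J_def free_alg_closed)
  then have "ideal J A"
    by (intro idealI ring_free_alg) (auto simp: J_def free_alg_closed)
  moreover have "rels \<subseteq> J" using rels_carrier rels_vanish by (auto simp: J_def)
  ultimately have "I \<subseteq> J" unfolding rel_ideal_def by (rule genideal_minimal)
  with assms show ?thesis by (auto simp: J_def)
qed

end

section \<open>Stability of the tensor powers and agreement with the defined action\<close>

lemma keys_mult_list:
  assumes "w \<in> Poly_Mapping.keys (x * y :: 'a falg)"
  obtains u v where "u \<in> Poly_Mapping.keys x" "v \<in> Poly_Mapping.keys y" "w = u @ v"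
  using assms keys_mult[of x y] by (auto simp: plus_list_def)

lemma keys_tscale: "Poly_Mapping.keys (tscale c x) \<subseteq> Poly_Mapping.keys x"
  by (auto simp: in_keys_iff lookup_tscale)

lemma subspace_tens_space: "tvs.subspace (tens_space n k)"
proof (rule tvs.subspaceI)
  fix x y assume "x \<in> tens_space n k" "y \<in> tens_space n k"
  then show "x + y \<in> tens_space n k"
    using keys_add[of x y] unfolding tens_space_def by blast
next
  fix c x assume "x \<in> tens_space n k"
  then show "tscale c x \<in> tens_space n k"
    using keys_tscale[of c x] unfolding tens_space_def by blast
qed (simp add: tens_space_def)

lemma mon_tens_space: "mon u \<in> tens_space n k \<longleftrightarrow> length u = k \<and> set u \<subseteq> {1..n}"
  by (simp add: tens_space_def keys_mon)

lemma mult_tens_space: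
  assumes "x \<in> tens_space n k" "y \<in> tens_space n l"
  shows "x * y \<in> tens_space n (k + l)"
  unfolding tens_space_def
proof (intro CollectI ballI)
  fix w assume "w \<in> Poly_Mapping.keys (x * y)"
  then obtain u v where "u \<in> Poly_Mapping.keys x" "v \<in> Poly_Mapping.keys y" "w = u @ v"
    by (rule keys_mult_list)
  then show "length w = k + l \<and> set w \<subseteq> {1..n}"
    using assms by (auto simp: tens_space_def)
qed

lemma tens_space_induct [consumes 1, case_names zero mon add scale]:
  assumes "x \<in> tens_space n k" "P 0" "\<And>w. length w = k \<Longrightarrow> set w \<subseteq> {1..n} \<Longrightarrow> P (mon w)"
    and "\<And>x y. P x \<Longrightarrow> P y \<Longrightarrow> P (x + y)" "\<And>c x. P x \<Longrightarrow> P (tscale c x)"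
  shows "P x"
  by (rule falg_induct[of x "{w. length w = k \<and> set w \<subseteq> {1..n}}"])
    (use assms in \<open>auto simp: tens_space_def\<close>)

lemmas tens_space_closed = tvs.subspace_0[OF subspace_tens_space] tvs.subspace_add[OF subspace_tens_space]
  tvs.subspace_diff[OF subspace_tens_space] tvs.subspace_scale[OF subspace_tens_space]
  tvs.subspace_neg[OF subspace_tens_space]

lemma opg_linear [simp]:
  "opg r s g (x + y) = opg r s g x + opg r s g y" "opg r s g (tscale c x) = tscale c (opg r s g x)"
  "opg r s g 0 = 0"
  by (cases g; simp)+

lemma gens_bound: "g \<in> gens n \<Longrightarrow> (case g of GE i \<Rightarrow> i | GF i \<Rightarrow> i | GW i \<Rightarrow> i | GWinv i \<Rightarrow> i | GW' i \<Rightarrow> i | GWinv' i \<Rightarrow> i) \<in> {1..<n}"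
  by (auto simp: gens_def)

text \<open>The index i of a generator satisfies 1 \<le> i < n, so both letters i and i + 1 that can
  be produced stay within {1..n}.\<close>

lemma opg_tens_space:
  assumes g: "g \<in> gens n" and x: "x \<in> tens_space n k"
  shows "opg r s g x \<in> tens_space n k"
  using x
proof (induction x rule: tens_space_induct)
  case (mon w)
  then show ?case
  proof (induction w arbitrary: k)
    case Nil
    then show ?case by (cases g) (simp_all add: ops_mon wword_Nil tens_space_closed mon_tens_space)
  next
    case (Cons a w)
    have IH: "opg r s g (mon w) \<in> tens_space n (length w)" using Cons by simp
    have k: "k = Suc (length w)" and a: "a \<in> {1..n}" and w: "set w \<subseteq> {1..n}" using Cons.prems by auto
    have L: "mon [b] * y \<in> tens_space n k" if "b \<in> {1..n}" "y \<in> tens_space n (length w)" for b y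
      using mult_tens_space[of "mon [b]" n 1 y "length w"] that by (simp add: mon_tens_space k)
    have M: "mon w \<in> tens_space n (length w)" using w by (simp add: mon_tens_space)
    then have W: "Wop c d i (mon w) \<in> tens_space n (length w)" for c d i
      by (simp add: ops_mon tens_space_closed)
    show ?case unfolding mon_Cons[of a w]
      using gens_bound[OF g] IH a M W
      by (cases g) (auto simp: Eop_Cons Fop_Cons Wop_Cons intro!: tens_space_closed L)
  qed
qed (simp_all add: tens_space_closed)

lemma foldr_opg_closed:
  assumes "\<And>g x. g \<in> gens n \<Longrightarrow> x \<in> V \<Longrightarrow> opg r s g x \<in> V" "u \<in> lists (gens n)" "x \<in> V"
  shows "foldr (opg r s) u x \<in> V"
  using assms(2,3) by (induction u) (auto intro: assms(1))

lemma act_closed: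
  assumes "tvs.subspace V" "\<And>g x. g \<in> gens n \<Longrightarrow> x \<in> V \<Longrightarrow> opg r s g x \<in> V"
    and "p \<in> carrier (free_alg n)" "x \<in> V"
  shows "act r s p x \<in> V"
proof (rule falg_induct[of p "lists (gens n)"])
  show "Poly_Mapping.keys p \<subseteq> lists (gens n)" using assms(3) unfolding carrier_free_alg by blast
  show "act r s (mon w) x \<in> V" if "w \<in> lists (gens n)" for w
    unfolding act_mon by (rule foldr_opg_closed[OF assms(2) that assms(4)])
qed (simp_all add: tvs.subspace_0[OF assms(1)] tvs.subspace_add[OF assms(1)] tvs.subspace_scale[OF assms(1)])

lemma foldr_opg_tens_space:
  "u \<in> lists (gens n) \<Longrightarrow> x \<in> tens_space n k \<Longrightarrow> foldr (opg r s) u x \<in> tens_space n k"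
  using opg_tens_space by (rule foldr_opg_closed)

lemma act_tens_space:
  "p \<in> carrier (free_alg n) \<Longrightarrow> x \<in> tens_space n k \<Longrightarrow> act r s p x \<in> tens_space n k"
  using subspace_tens_space opg_tens_space by (rule act_closed)

lemma tlinear_tens_op: "tlinear (tens_op n r s k g)"
proof (cases k)
  case 0
  then show ?thesis using tlinear_tscale[OF tlinear_id] by simp
next
  case (Suc m)
  then show ?thesis by (cases g) (simp_all add: tensor_op_def tlin)
qed

text \<open>The last sum in \<open>diag\<close> runs over {1..n}, whereas \<open>wt\<close> is 1 on
  all letters besides j and j + 1. This is what ties the comparison of the two actions to letters
  between 1 and n.\<close>

lemma diag_letter:
  assumes "a \<in> {1..n}"
  shows "diag n j c d a = tscale (wt c d j a) (mon [a])"
proof -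
  have "(\<Sum>m\<in>{1..n} - {j, j + 1}. munit m m a) = (\<Sum>m\<in>{1..n} - {j, j + 1}. if m = a then mon [m] else 0)"
    by (simp add: munit_def)
  also have "\<dots> = (if a \<in> {1..n} - {j, j + 1} then mon [a] else 0)"
    by (simp add: sum.delta)
  finally show ?thesis using assms by (auto simp: diag_def munit_def wt_def)
qed

lemma nat_op_letter:
  assumes "a \<in> {1..n}"
  shows "nat_op n r s g (mon [a]) = opg r s g (mon [a])"
  using assms by (cases g) (simp_all add: nat_op_def diag_letter ops_mon wword_def munit_def mon_Nil)

text \<open>\<open>tens_op\<close> splits off the first tensor factor by the coproduct, and the
  product rules of \<open>opg\<close> do the same for a word written as its first letter times the
  rest. Generators of all kinds are treated at once because the coproducts of e_i and f_i involve
  \<omega>_i and \<omega>'_i.\<close>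

lemma tens_op_mon:
  assumes "g \<in> gens n" "set u \<subseteq> {1..n}" "length u = k"
  shows "tens_op n r s k g (mon u) = opg r s g (mon u)"
  using assms
proof (induction u arbitrary: k g)
  case Nil
  then show ?case by (cases g) (simp_all add: mon_Nil)
next
  case (Cons a u)
  have IH: "tens_op n r s (length u) h (mon u) = opg r s h (mon u)" if "h \<in> gens n" for h
    using Cons that by simp
  have k: "k = Suc (length u)" and a: "a \<in> {1..n}" using Cons.prems by auto
  have N: "nat_op n r s h (mon [a]) = opg r s h (mon [a])" for h by (rule nat_op_letter[OF a])
  have T: "tensor_op P Q (mon (a # u)) = P (mon [a]) * Q (mon u)" for P Q
    by (simp add: tensor_op_def)
  have R: "opg r s g (mon (a # u)) = opg r s g (mon [a] * mon u)"
    by (simp only: mon_Cons[of a u])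
  show ?case unfolding R k
    using Cons.prems(1) gens_bound[OF Cons.prems(1)]
    by (cases g) (simp_all add: T N IH gens_mem Eop_mult Fop_mult Wop_mult)
qed

lemma free_act_eq:
  assumes p: "p \<in> carrier (free_alg n)" and x: "x \<in> tens_space n k"
  shows "free_act n r s k p x = act r s p x"
proof -
  have g: "tens_op n r s k h y = opg r s h y" if "h \<in> gens n" "y \<in> tens_space n k" for h y
  proof (rule tlinear_eq_on[where A = "{w. length w = k \<and> set w \<subseteq> {1..n}}" and x = y
        and f = "tens_op n r s k h" and g = "opg r s h"])
    show "Poly_Mapping.keys y \<subseteq> {w. length w = k \<and> set w \<subseteq> {1..n}}"
      using that by (auto simp: tens_space_def)
  qed (use that tens_op_mon in \<open>auto intro: tlinear_tens_op tlinear_opg[OF tlinear_id]\<close>)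
  have f: "foldr (tens_op n r s k) u x = foldr (opg r s) u x" if "u \<in> lists (gens n)" for u
    using that by (induction u) (simp_all add: g foldr_opg_tens_space x)
  show ?thesis
    unfolding free_act_def act_def lin_ext_def
  proof (intro sum.cong refl)
    fix u assume "u \<in> Poly_Mapping.keys p"
    then have "u \<in> lists (gens n)" using p unfolding carrier_free_alg by blast
    then show "tscale (Poly_Mapping.lookup p u) (foldr (tens_op n r s k) u x)
      = tscale (Poly_Mapping.lookup p u) (foldr (opg r s) u x)" by (simp only: f)
  qed
qed

section \<open>The algebra acting on tensor powers\<close>

context urs begin

lemma carrier_U: "carrier U = cls n r s ` carrier A"
  by (auto simp: Urs_def FactRing_def A_RCOSETS_def' cls_def)

lemma ring_U: "ring U"
  unfolding Urs_def by (rule ideal.quotient_is_ring[OF ideal_I])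

lemma cls_ops:
  assumes "p \<in> carrier A" "q \<in> carrier A"
  shows "cls n r s p \<oplus>\<^bsub>U\<^esub> cls n r s q = cls n r s (p + q)"
    and "cls n r s p \<otimes>\<^bsub>U\<^esub> cls n r s q = cls n r s (p * q)"
  using ring_hom_add[OF ideal.rcos_ring_hom[OF ideal_I] assms]
    ring_hom_mult[OF ideal.rcos_ring_hom[OF ideal_I] assms]
  by (simp_all add: Urs_def cls_def)

lemma cls_one: "\<one>\<^bsub>U\<^esub> = cls n r s 1"
  by (simp add: Urs_def cls_def FactRing_def)

lemma cls_minus:
  assumes "p \<in> carrier A"
  shows "\<ominus>\<^bsub>U\<^esub> cls n r s p = cls n r s (- p)"
proof (rule abelian_group.minus_equality[OF ring.is_abelian_group[OF ring_U]])
  have "cls n r s 0 = \<zero>\<^bsub>U\<^esub>"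
    using ring_hom_zero[OF ideal.rcos_ring_hom[OF ideal_I] ring_free_alg ring_U[unfolded Urs_def]]
    by (simp add: Urs_def cls_def)
  then show "cls n r s (- p) \<oplus>\<^bsub>U\<^esub> cls n r s p = \<zero>\<^bsub>U\<^esub>"
    using assms by (simp add: cls_ops free_alg_minus_closed)
qed (use assms free_alg_minus_closed in \<open>auto simp: carrier_U\<close>)

lemma UE:
  assumes "u \<in> carrier U"
  obtains p where "p \<in> carrier A" "u = cls n r s p"
  using assms by (auto simp: carrier_U)

lemma cls_in_U: "p \<in> carrier A \<Longrightarrow> cls n r s p \<in> carrier U"
  by (simp add: carrier_U)

lemma I_subset: "I \<subseteq> carrier A"
  using ideal_I by (auto simp: ideal_def additive_subgroup.a_subset)

text \<open>This resolves the definite description in \<open>tens_power\<close>: representatives of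
  a coset differ by elements of the ideal, which act by zero, and p itself is a
  representative.\<close>

lemma tens_smult:
  assumes p: "p \<in> carrier A" and x: "x \<in> tens_space n k"
  shows "cls n r s p \<odot>\<^bsub>tens_power n r s k\<^esub> x = act r s p x"
proof -
  have "free_act n r s k q x = act r s p x" if q: "q \<in> cls n r s p" for q
  proof -
    obtain h where h: "h \<in> I" "q = h + p" using q by (auto simp: cls_def a_r_coset_def')
    then have "q \<in> carrier A" using I_subset p free_alg_closed(1) by blast
    then show ?thesis using h by (simp add: free_act_eq x I_vanish)
  qed
  moreover have "p \<in> cls n r s p"
  proof -
    have "0 \<in> I" using additive_subgroup.zero_closed[OF ideal.axioms(1)[OF ideal_I]] by simp
    then show ?thesis unfolding cls_def a_r_coset_def' by force
  qed
  ultimately have "(THE y. \<exists>q\<in>cls n r s p. y = free_act n r s k q x) = act r s p x"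
    by (intro the_equality) (metis, metis)
  then show ?thesis by (simp add: tens_power_def)
qed

abbreviation T where "T \<equiv> tens_power n r s"

lemma tens_power_simps [simp]:
  "carrier (T k) = tens_space n k" "\<zero>\<^bsub>T k\<^esub> = 0" "x \<oplus>\<^bsub>T k\<^esub> y = x + y"
  by (simp_all add: tens_power_def)

lemma tens_power_module: "left_module U (T k)"
proof (intro left_module.intro left_module_axioms.intro ring_U)
  show "abelian_group (T k)"
  proof (rule abelian_groupI)
    show "\<exists>y\<in>carrier (T k). y \<oplus>\<^bsub>T k\<^esub> x = \<zero>\<^bsub>T k\<^esub>" if "x \<in> carrier (T k)" for x
      using that by (intro bexI[of _ "- x"]) (simp_all add: tens_space_closed)
  qed (simp_all add: tens_space_closed add_ac)
  fix a x assume a: "a \<in> carrier U" and x: "x \<in> carrier (T k)"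
  obtain p where p: "p \<in> carrier A" "a = cls n r s p" using a by (rule UE)
  show "a \<odot>\<^bsub>T k\<^esub> x \<in> carrier (T k)"
    using x p by (simp add: tens_smult act_tens_space)
  show "a \<odot>\<^bsub>T k\<^esub> (x \<oplus>\<^bsub>T k\<^esub> y) = a \<odot>\<^bsub>T k\<^esub> x \<oplus>\<^bsub>T k\<^esub> a \<odot>\<^bsub>T k\<^esub> y"
    if "y \<in> carrier (T k)" for y
    using x p that by (simp add: tens_smult tens_space_closed)
  fix b assume "b \<in> carrier U"
  then obtain q where q: "q \<in> carrier A" "b = cls n r s q" by (rule UE)
  show "(a \<oplus>\<^bsub>U\<^esub> b) \<odot>\<^bsub>T k\<^esub> x = a \<odot>\<^bsub>T k\<^esub> x \<oplus>\<^bsub>T k\<^esub> b \<odot>\<^bsub>T k\<^esub> x"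
    using x p q by (simp add: tens_smult cls_ops free_alg_closed)
  show "(a \<otimes>\<^bsub>U\<^esub> b) \<odot>\<^bsub>T k\<^esub> x = a \<odot>\<^bsub>T k\<^esub> (b \<odot>\<^bsub>T k\<^esub> x)"
    using x p q by (simp add: tens_smult cls_ops free_alg_closed act_tens_space)
next
  show "\<one>\<^bsub>U\<^esub> \<odot>\<^bsub>T k\<^esub> x = x" if "x \<in> carrier (T k)" for x
    using that by (simp add: cls_one tens_smult)
qed

end

subsection \<open>The quantum symmetric square and the relations of the exterior power\<close>

lemma Eop_letter: "Eop r s i (mon [a]) = (if a = i + 1 then mon [i] else 0)"
  and Fop_letter: "Fop r s i (mon [a]) = (if a = i then mon [i + 1] else 0)"
  by (simp_all add: ops_mon mon_Nil wword_Nil)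

lemma subspace_S2: "tvs.subspace (S2 n s)"
  unfolding S2_def by (rule tvs.subspace_span)

lemmas S2_closed = tvs.subspace_0[OF subspace_S2] tvs.subspace_add[OF subspace_S2] tvs.subspace_scale[OF subspace_S2]

lemma S2_diag: "i \<in> {1..n} \<Longrightarrow> mon [i] * mon [i] \<in> S2 n s"
  unfolding S2_def by (rule tvs.span_base) blast

lemma S2_mixed: "i \<in> {1..n} \<Longrightarrow> j \<in> {1..n} \<Longrightarrow> i < j \<Longrightarrow> mon [i] * mon [j] + tscale s (mon [j] * mon [i]) \<in> S2 n s"
  unfolding S2_def by (rule tvs.span_base) blast

lemma S2_subset:
  assumes "tvs.subspace V" "\<And>i. i \<in> {1..n} \<Longrightarrow> mon [i] * mon [i] \<in> V"
    and "\<And>i j. i \<in> {1..n} \<Longrightarrow> j \<in> {1..n} \<Longrightarrow> i < j \<Longrightarrow> mon [i] * mon [j] + tscale s (mon [j] * mon [i]) \<in> V"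
  shows "S2 n s \<subseteq> V"
  unfolding S2_def by (rule tvs.span_minimal) (use assms in auto)

lemma subspace_vimage:
  assumes "tlinear f" "tvs.subspace V"
  shows "tvs.subspace {x. f x \<in> V}"
  by (rule tvs.subspaceI)
    (simp_all add: tlinear_0[OF assms(1)] tlinear_add[OF assms(1)] tlinear_scale[OF assms(1)]
      tvs.subspace_0[OF assms(2)] tvs.subspace_add[OF assms(2)] tvs.subspace_scale[OF assms(2)])

lemma Wop_S2: "z \<in> S2 n s \<Longrightarrow> Wop c d m z \<in> S2 n s"
proof -
  have "S2 n s \<subseteq> {z. Wop c d m z \<in> S2 n s}"
  proof (rule S2_subset)
    show "tvs.subspace {z. Wop c d m z \<in> S2 n s}"
      by (rule subspace_vimage[OF _ subspace_S2]) (intro tlin)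
    fix i assume i: "i \<in> {1..n}"
    then show "mon [i] * mon [i] \<in> {z. Wop c d m z \<in> S2 n s}"
      by (simp add: Wop_mult Wop_letter tscale_mult_left tscale_mult_right S2_closed S2_diag)
    fix j assume j: "j \<in> {1..n}" "i < j"
    have "Wop c d m (mon [i] * mon [j] + tscale s (mon [j] * mon [i]))
      = tscale (wt c d m i * wt c d m j) (mon [i] * mon [j] + tscale s (mon [j] * mon [i]))"
      by (simp add: Wop_mult Wop_letter tscale_simps mult_ac)
    then show "mon [i] * mon [j] + tscale s (mon [j] * mon [i]) \<in> {z. Wop c d m z \<in> S2 n s}"
      using S2_mixed[OF i j] by (simp only: mem_Collect_eq S2_closed)
  qed
  then show "z \<in> S2 n s \<Longrightarrow> Wop c d m z \<in> S2 n s" by blast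
qed

text \<open>The square of v_(m+1) is sent to a mixed generator, with coefficient s from \<omega>_m
  on the first factor. The mixed generator of m and m + 1 goes to r + s times the square of v_m. In
  the other mixed pairs e_m changes at most one index and keeps the order of the two.\<close>

lemma Eop_S2:
  assumes m: "m \<in> {1..<n}" and z: "z \<in> S2 n s"
  shows "Eop r s m z \<in> S2 n s"
proof -
  have "S2 n s \<subseteq> {z. Eop r s m z \<in> S2 n s}"
  proof (rule S2_subset)
    show "tvs.subspace {z. Eop r s m z \<in> S2 n s}"
      by (rule subspace_vimage[OF _ subspace_S2]) (intro tlin)
    fix i assume i: "i \<in> {1..n}"
    show "mon [i] * mon [i] \<in> {z. Eop r s m z \<in> S2 n s}"
      using S2_mixed[of m n "m + 1" s] m
      by (auto simp: Eop_Cons Eop_letter wt_def S2_closed)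
    fix j assume j: "j \<in> {1..n}" "i < j"
    consider "i = m + 1" | "j = m + 1" "i = m" | "j = m + 1" "i < m" | "i \<noteq> m + 1" "j \<noteq> m + 1"
      using j by linarith
    then show "mon [i] * mon [j] + tscale s (mon [j] * mon [i]) \<in> {z. Eop r s m z \<in> S2 n s}"
    proof cases
      case 1
      then have "Eop r s m (mon [i] * mon [j] + tscale s (mon [j] * mon [i])) = mon [m] * mon [j] + tscale s (mon [j] * mon [m])"
        using j by (simp add: Eop_Cons Eop_letter wt_def)
      then show ?thesis using S2_mixed[of m n j s] m j 1 by simp
    next
      case 2
      then have "Eop r s m (mon [i] * mon [j] + tscale s (mon [j] * mon [i])) = tscale (r + s) (mon [m] * mon [m])"
        by (simp add: Eop_Cons Eop_letter wt_def tvs.scale_left_distrib)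
      then show ?thesis using S2_diag[of m n s] m by (simp add: S2_closed)
    next
      case 3
      then have "Eop r s m (mon [i] * mon [j] + tscale s (mon [j] * mon [i])) = mon [i] * mon [m] + tscale s (mon [m] * mon [i])"
        by (simp add: Eop_Cons Eop_letter wt_def)
      then show ?thesis using S2_mixed[of i n m s] m i 3 by simp
    next
      case 4
      then show ?thesis by (simp add: Eop_Cons Eop_letter S2_closed)
    qed
  qed
  with z show ?thesis by blast
qed

text \<open>Here the coefficient s in the image of the square of v_m comes from \<omega>'_m on the
  second factor.\<close>

lemma Fop_S2:
  assumes m: "m \<in> {1..<n}" and z: "z \<in> S2 n s"
  shows "Fop r s m z \<in> S2 n s"
proof -
  have "S2 n s \<subseteq> {z. Fop r s m z \<in> S2 n s}"
  proof (rule S2_subset)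
    show "tvs.subspace {z. Fop r s m z \<in> S2 n s}"
      by (rule subspace_vimage[OF _ subspace_S2]) (intro tlin)
    fix i assume i: "i \<in> {1..n}"
    show "mon [i] * mon [i] \<in> {z. Fop r s m z \<in> S2 n s}"
      using S2_mixed[of m n "m + 1" s] m
      by (auto simp: Fop_snoc Fop_letter tscale_mult_left wt_def S2_closed)
    fix j assume j: "j \<in> {1..n}" "i < j"
    consider "j = m" | "i = m" "j = m + 1" | "i = m" "j > m + 1" | "i \<noteq> m" "j \<noteq> m"
      using j by linarith
    then show "mon [i] * mon [j] + tscale s (mon [j] * mon [i]) \<in> {z. Fop r s m z \<in> S2 n s}"
    proof cases
      case 1
      then have "Fop r s m (mon [i] * mon [j] + tscale s (mon [j] * mon [i])) = mon [i] * mon [m + 1] + tscale s (mon [m + 1] * mon [i])"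
        using j by (simp add: Fop_snoc Fop_letter wt_def)
      then show ?thesis using S2_mixed[of i n "m + 1" s] m i j 1 by simp
    next
      case 2
      then have "Fop r s m (mon [i] * mon [j] + tscale s (mon [j] * mon [i])) = tscale (r + s) (mon [m + 1] * mon [m + 1])"
        by (simp add: Fop_snoc Fop_letter wt_def tvs.scale_left_distrib)
      then show ?thesis using S2_diag[of "m + 1" n s] m by (simp add: S2_closed)
    next
      case 3
      then have "Fop r s m (mon [i] * mon [j] + tscale s (mon [j] * mon [i])) = mon [m + 1] * mon [j] + tscale s (mon [j] * mon [m + 1])"
        by (simp add: Fop_snoc Fop_letter wt_def)
      then show ?thesis using S2_mixed[of "m + 1" n j s] m j 3 by simp
    next
      case 4
      then show ?thesis by (simp add: Fop_snoc Fop_letter S2_closed)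
    qed
  qed
  with z show ?thesis by blast
qed

lemma S2_tens_space: "S2 n s \<subseteq> tens_space n 2"
  by (rule S2_subset[OF subspace_tens_space])
    (auto intro!: tens_space_closed simp: mon_mult mon_tens_space)

section \<open>The relation space as a submodule of the tensor power\<close>

lemma subspace_sym_sum: "tvs.subspace (sym_sum n s k)"
  unfolding sym_sum_def by (rule tvs.subspace_span)

lemmas sym_sum_closed = tvs.subspace_0[OF subspace_sym_sum] tvs.subspace_add[OF subspace_sym_sum]
  tvs.subspace_diff[OF subspace_sym_sum] tvs.subspace_scale[OF subspace_sym_sum]
  tvs.subspace_neg[OF subspace_sym_sum]

lemma sym_sumI:
  assumes "x \<in> tens_space n a" "z \<in> S2 n s" "y \<in> tens_space n b" "k = a + 2 + b"
  shows "x * z * y \<in> sym_sum n s k"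
proof -
  have "x * z \<in> tens_sub (tens_space n a) (S2 n s)"
    unfolding tens_sub_def using assms by (intro tvs.span_base) blast
  then have "x * z * y \<in> tens_sub (tens_sub (tens_space n a) (S2 n s)) (tens_space n (k - a - 2))"
    unfolding tens_sub_def[of "tens_sub _ _"] using assms by (intro tvs.span_base) force
  then show ?thesis
    unfolding sym_sum_def using assms(4) by (intro tvs.span_base UN_I[of a]) auto
qed

lemma tens_sub_subset:
  assumes "tvs.subspace V" "\<And>x y. x \<in> X \<Longrightarrow> y \<in> Y \<Longrightarrow> x * y \<in> V"
  shows "tens_sub X Y \<subseteq> V"
  unfolding tens_sub_def by (rule tvs.span_minimal) (use assms in auto)

text \<open>With \<open>sym_sumI\<close> this describes \<open>sym_sum\<close> as the span of triple
  products, which replaces the three nested spans of its definition.\<close>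

lemma sym_sum_subset:
  assumes V: "tvs.subspace V"
    and prod: "\<And>a b x y z. k = a + 2 + b \<Longrightarrow> x \<in> tens_space n a \<Longrightarrow> z \<in> S2 n s \<Longrightarrow> y \<in> tens_space n b \<Longrightarrow> x * z * y \<in> V"
  shows "sym_sum n s k \<subseteq> V"
  unfolding sym_sum_def
proof (rule tvs.span_minimal[OF UN_least V])
  fix i assume "i \<in> {i. i + 2 \<le> k}"
  then have k: "k = i + 2 + (k - i - 2)" by simp
  show "tens_sub (tens_sub (tens_space n i) (S2 n s)) (tens_space n (k - i - 2)) \<subseteq> V"
  proof (rule tens_sub_subset[OF V])
    fix x y assume x: "x \<in> tens_sub (tens_space n i) (S2 n s)" and y: "y \<in> tens_space n (k - i - 2)"
    have "tens_sub (tens_space n i) (S2 n s) \<subseteq> {x. x * y \<in> V}"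
    proof (rule tens_sub_subset)
      show "tvs.subspace {x. x * y \<in> V}"
        by (rule subspace_vimage[OF _ V]) (intro tlin)
    qed (use prod[OF k _ _ y] in blast)
    with x show "x * y \<in> V" by blast
  qed
qed

lemma sym_sum_tens_space: "sym_sum n s k \<subseteq> tens_space n k"
proof (rule sym_sum_subset[OF subspace_tens_space])
  fix a b x y z
  assume k: "k = a + 2 + b" and x: "x \<in> tens_space n a" and z: "z \<in> S2 n s" and y: "y \<in> tens_space n b"
  have "z \<in> tens_space n 2" using z S2_tens_space by blast
  from mult_tens_space[OF mult_tens_space[OF x this] y] show "x * z * y \<in> tens_space n k"
    unfolding k .
qed

text \<open>Each summand of the twofold coproduct acts factor by factor on x z y, and each of these
  operators preserves the tensor space or \<open>S2\<close> that its factor lies in.\<close>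

lemma opg_sym_sum:
  assumes g: "g \<in> gens n" and w: "w \<in> sym_sum n s k"
  shows "opg r s g w \<in> sym_sum n s k"
proof -
  have "sym_sum n s k \<subseteq> {w. opg r s g w \<in> sym_sum n s k}"
  proof (rule sym_sum_subset)
    show "tvs.subspace {w. opg r s g w \<in> sym_sum n s k}"
      by (rule subspace_vimage[OF _ subspace_sym_sum]) (intro tlin)
    fix a b x y z
    assume k: "k = a + 2 + b" and x: "x \<in> tens_space n a" and z: "z \<in> S2 n s" and y: "y \<in> tens_space n b"
    note I = sym_sumI[OF _ _ _ k, of _ n _ s]
    have W: "Wop c d i u \<in> tens_space n l" if "i \<in> {1..<n}" "u \<in> tens_space n l" for c d i u l
      \<comment> \<open>\<open>Wop c d i\<close> is the operator of \<open>GW i\<close> for the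
        parameters c, d in place of r, s, so one instance covers all diagonal operators.\<close>
      using opg_tens_space[of "GW i" n u l c d] that by (simp add: gens_mem)
    have E: "Eop r s i u \<in> tens_space n l" if "i \<in> {1..<n}" "u \<in> tens_space n l" for i u l
      using opg_tens_space[of "GE i" n u l r s] that by (simp add: gens_mem)
    have F: "Fop r s i u \<in> tens_space n l" if "i \<in> {1..<n}" "u \<in> tens_space n l" for i u l
      using opg_tens_space[of "GF i" n u l r s] that by (simp add: gens_mem)
    have WW: "Wop c d i (x * z * y) \<in> sym_sum n s k" if "i \<in> {1..<n}" for c d i
      unfolding Wop_mult using that x y z by (intro I W Wop_S2)
    have EE: "Eop r s i (x * z * y) \<in> sym_sum n s k" if i: "i \<in> {1..<n}" for i
    proof -
      have "Eop r s i (x * z * y) = Eop r s i x * z * y + Wop r s i x * Eop r s i z * y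
          + Wop r s i x * Wop r s i z * Eop r s i y"
        by (simp add: Eop_mult Wop_mult distrib_left distrib_right add.assoc)
      then show ?thesis using i x y z by (simp add: sym_sum_closed I W E Wop_S2 Eop_S2)
    qed
    have FF: "Fop r s i (x * z * y) \<in> sym_sum n s k" if i: "i \<in> {1..<n}" for i
    proof -
      have "Fop r s i (x * z * y) = x * z * Fop r s i y + x * Fop r s i z * Wop s r i y
          + Fop r s i x * Wop s r i z * Wop s r i y"
        by (simp add: Fop_mult Wop_mult distrib_left distrib_right add.assoc)
      then show ?thesis using i x y z by (simp add: sym_sum_closed I W F Wop_S2 Fop_S2)
    qed
    show "x * z * y \<in> {w. opg r s g w \<in> sym_sum n s k}"
      using gens_bound[OF g] by (cases g) (simp_all add: WW EE FF)
  qed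
  with w show ?thesis by blast
qed

lemma act_sym_sum:
  assumes "p \<in> carrier (free_alg n)" "x \<in> sym_sum n s k"
  shows "act r s p x \<in> sym_sum n s k"
  using subspace_sym_sum opg_sym_sum assms by (rule act_closed)

lemma (in urs) submodule_sym_sum: "submodule (sym_sum n s k) U (T k)"
proof -
  interpret M: left_module U "T k" by (rule tens_power_module)
  have "subgroup (sym_sum n s k) (add_monoid (T k))"
  proof
    fix x assume x: "x \<in> sym_sum n s k"
    have "x \<in> tens_space n k" using x sym_sum_tens_space by blast
    then have "\<ominus>\<^bsub>T k\<^esub> x = - x"
      by (intro M.minus_equality[of "- x" x]) (simp_all add: tens_space_closed)
    then have "inv\<^bsub>add_monoid (T k)\<^esub> x = - x" by (simp only: a_inv_def)
    then show "inv\<^bsub>add_monoid (T k)\<^esub> x \<in> sym_sum n s k" using x sym_sum_closed(5) by metis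
  qed (use sym_sum_tens_space in \<open>auto simp: sym_sum_closed\<close>)
  moreover have "a \<odot>\<^bsub>T k\<^esub> x \<in> sym_sum n s k" if "a \<in> carrier U" "x \<in> sym_sum n s k" for a x
  proof -
    obtain p where p: "p \<in> carrier A" "a = cls n r s p" using \<open>a \<in> carrier U\<close> by (rule UE)
    have "x \<in> tens_space n k" using that sym_sum_tens_space by blast
    then show ?thesis using p that by (simp add: tens_smult act_sym_sum)
  qed
  ultimately show ?thesis by (intro submodule.intro submodule_axioms.intro)
qed

lemma sym_sum_words:
  assumes "set u \<subseteq> {1..n}" "set v \<subseteq> {1..n}" "k = length u + 2 + length v" "i \<in> {1..n}"
  shows "mon (u @ i # i # v) \<in> sym_sum n s k"
    and "j \<in> {1..n} \<Longrightarrow> i < j \<Longrightarrow> mon (u @ i # j # v) + tscale s (mon (u @ j # i # v)) \<in> sym_sum n s k"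
proof -
  have I: "mon u * z * mon v \<in> sym_sum n s k" if "z \<in> S2 n s" for z
    using assms that by (intro sym_sumI[of _ n "length u" _ s _ "length v"]) (simp_all add: mon_tens_space)
  show "mon (u @ i # i # v) \<in> sym_sum n s k"
    using I[OF S2_diag[OF assms(4)]] by (simp add: mon_mult)
  show "mon (u @ i # j # v) + tscale s (mon (u @ j # i # v)) \<in> sym_sum n s k" if "j \<in> {1..n}" "i < j"
    using I[OF S2_mixed[OF assms(4) that]]
    by (simp add: mon_mult distrib_left distrib_right tscale_mult_left tscale_mult_right)
qed

lemma tens_space_subset:
  assumes "tvs.subspace V" "\<And>w. length w = k \<Longrightarrow> set w \<subseteq> {1..n} \<Longrightarrow> mon w \<in> V"
  shows "tens_space n k \<subseteq> V"
proof
  fix x assume "x \<in> tens_space n k"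
  then show "x \<in> V"
    by (induction rule: tens_space_induct)
      (simp_all add: assms tvs.subspace_0 tvs.subspace_add tvs.subspace_scale)
qed

text \<open>The counterpart of \<open>sym_sum_words\<close>, for proving that something vanishes on
  \<open>sym_sum\<close>. Linearity reduces the middle factor to generators and then the left and
  the right one to words.\<close>

lemma sym_sum_subset_words:
  assumes V: "tvs.subspace V"
    and diag: "\<And>u v i. mon (u @ i # i # v) \<in> V"
    and mixed: "\<And>u v i j. i < j \<Longrightarrow> mon (u @ i # j # v) + tscale s (mon (u @ j # i # v)) \<in> V"
  shows "sym_sum n s k \<subseteq> V"
proof (rule sym_sum_subset[OF V])
  fix a b x y z
  assume x: "x \<in> tens_space n a" and z: "z \<in> S2 n s" and y: "y \<in> tens_space n b"
  have 1: "mon u * z * mon v \<in> V" for u v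
  proof -
    have "S2 n s \<subseteq> {z. mon u * z * mon v \<in> V}"
    proof (rule S2_subset)
      show "tvs.subspace {z. mon u * z * mon v \<in> V}"
        by (rule subspace_vimage[OF _ V]) (intro tlin)
    qed (use diag mixed in \<open>auto simp: mon_mult distrib_left distrib_right tscale_mult_left tscale_mult_right\<close>)
    with z show ?thesis by blast
  qed
  have 2: "x * z * mon v \<in> V" for v
  proof -
    have "tens_space n a \<subseteq> {x. x * z * mon v \<in> V}"
      by (rule tens_space_subset) (use 1 in \<open>auto intro!: subspace_vimage[OF _ V] tlin\<close>)
    with x show ?thesis by blast
  qed
  have "tens_space n b \<subseteq> {y. x * z * y \<in> V}"
    by (rule tens_space_subset) (use 2 in \<open>auto intro!: subspace_vimage[OF _ V] tlin\<close>)
  with y show "x * z * y \<in> V" by blast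
qed

subsection \<open>A functional detecting the highest weight vector\<close>

primrec invs :: "nat list \<Rightarrow> nat" where
  "invs [] = 0"
| "invs (a # u) = length (filter (\<lambda>b. b < a) u) + invs u"

text \<open>Only the pair a, b changes its relative order.\<close>

lemma invs_swap: "b < a \<Longrightarrow> invs (u @ a # b # v) = Suc (invs (u @ b # a # v))"
  by (induction u) simp_all

lemma invs_sorted: "sorted_wrt (<) u \<Longrightarrow> invs u = 0"
  by (induction u) (auto simp: filter_empty_conv)

definition dcoef :: "complex \<Rightarrow> nat list \<Rightarrow> complex" where
  "dcoef s u = (if distinct u then (- inverse s) ^ invs u else 0)"

text \<open>\<open>lin_ext\<close> builds maps into a free algebra, so the functional is encoded
  with values in the multiples of the empty word, whose coefficient is then read off.\<close>

definition Dfun :: "complex \<Rightarrow> nat falg \<Rightarrow> complex" where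
  "Dfun s x = Poly_Mapping.lookup (lin_ext (\<lambda>u. tscale (dcoef s u) (mon [])) x :: nat falg) []"

lemma Dfun_linear [simp]:
  "Dfun s (x + y) = Dfun s x + Dfun s y" "Dfun s (tscale c x) = c * Dfun s x" "Dfun s 0 = 0"
  by (simp_all add: Dfun_def tlinear_add[OF tlinear_lin_ext] tlinear_scale[OF tlinear_lin_ext]
      tlinear_0[OF tlinear_lin_ext] lookup_add lookup_tscale)

lemma Dfun_diff [simp]: "Dfun s (x - y) = Dfun s x - Dfun s y"
  using Dfun_linear(1)[of s "x - y" y] by simp

lemma Dfun_mon: "Dfun s (mon u) = dcoef s u"
  by (simp add: Dfun_def lookup_tscale lookup_mon)

text \<open>Words with a repeated letter have coefficient 0. In a mixed relation the second word has
  one inversion more than the first, so its factor - 1 / s cancels against s.\<close>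

lemma Dfun_sym_sum:
  assumes "s \<noteq> 0" "x \<in> sym_sum n s k"
  shows "Dfun s x = 0"
proof -
  have "sym_sum n s k \<subseteq> {x. Dfun s x = 0}"
  proof (rule sym_sum_subset_words)
    show "tvs.subspace {x. Dfun s x = 0}" by (rule tvs.subspaceI) simp_all
    show "mon (u @ i # i # v) \<in> {x. Dfun s x = 0}" for u v i
      by (simp add: Dfun_mon dcoef_def)
    show "mon (u @ i # j # v) + tscale s (mon (u @ j # i # v)) \<in> {x. Dfun s x = 0}"
      if "i < j" for u v i j
    proof -
      have "distinct (u @ j # i # v) = distinct (u @ i # j # v)" by auto
      then have "dcoef s (u @ j # i # v) = - inverse s * dcoef s (u @ i # j # v)"
        unfolding dcoef_def invs_swap[OF that]
        by (cases "distinct (u @ i # j # v)") (simp_all only: power_Suc if_True if_False mult_zero_right)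
      then show ?thesis using assms(1) by (simp add: Dfun_mon)
    qed
  qed
  with assms show ?thesis by blast
qed

subsection \<open>Strictly increasing words\<close>

definition strict :: "nat \<Rightarrow> nat \<Rightarrow> nat list set" where
  "strict n k = {w. length w = k \<and> set w \<subseteq> {1..n} \<and> sorted_wrt (<) w}"

lemma not_sorted_descent:
  fixes w :: "nat list"
  assumes "\<not> sorted_wrt (<) w"
  obtains u a b v where "w = u @ a # b # v" "b \<le> a"
proof -
  have "\<exists>u a b v. w = u @ a # b # v \<and> b \<le> a" using assms
  proof (induction w)
    case (Cons c w)
    show ?case
    proof (cases "sorted_wrt (<) w")
      case True
      with Cons.prems obtain x where x: "x \<in> set w" "x \<le> c" by (auto simp: not_less)
      then obtain b v where w: "w = b # v" by (cases w) auto
      with True x have "b \<le> c" by auto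
      with w show ?thesis by (metis append_Nil)
    next
      case False
      with Cons.IH obtain u a b v where "w = u @ a # b # v" "b \<le> a" by blast
      then show ?thesis by (metis append_Cons)
    qed
  qed simp
  with that show thesis by blast
qed

text \<open>Bubble sort, with the number of inversions as induction measure: exchanging an adjacent
  descent lowers it by one.\<close>

lemma word_normal_form:
  assumes "s \<noteq> 0" "length w = k" "set w \<subseteq> {1..n}"
  shows "\<exists>y. Poly_Mapping.keys y \<subseteq> strict n k \<and> mon w - y \<in> sym_sum n s k"
  using assms(2,3)
proof (induction "invs w" arbitrary: w rule: less_induct)
  case less
  show ?case
  proof (cases "sorted_wrt (<) w")
    case True
    then show ?thesis using less.prems
      by (intro exI[of _ "mon w"]) (simp add: keys_mon strict_def sym_sum_closed)
  next
    case False
    then obtain u a b v where w: "w = u @ a # b # v" "b \<le> a" by (rule not_sorted_descent)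
    then have uv: "set u \<subseteq> {1..n}" "set v \<subseteq> {1..n}" "k = length u + 2 + length v" "a \<in> {1..n}" "b \<in> {1..n}"
      using less.prems by auto
    show ?thesis
    proof (cases "a = b")
      case True
      then show ?thesis using sym_sum_words(1)[OF uv(1-4)] w by (intro exI[of _ 0]) simp
    next
      case False
      with w have ba: "b < a" by simp
      let ?w = "u @ b # a # v"
      have "invs ?w < invs w" using invs_swap[OF ba] w by simp
      moreover have "length ?w = k" "set ?w \<subseteq> {1..n}" using uv by auto
      ultimately obtain y where y: "Poly_Mapping.keys y \<subseteq> strict n k" "mon ?w - y \<in> sym_sum n s k"
        using less.hyps by blast
      have m: "mon ?w + tscale s (mon w) \<in> sym_sum n s k"
        using sym_sum_words(2)[OF uv(1-3,5,4) ba] w by simp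
      \<comment> \<open>The mixed relation makes w congruent to - 1 / s times the swapped word,
        whose normal form is y.\<close>
      have "mon w - tscale (- inverse s) y
        = tscale (inverse s) ((mon ?w + tscale s (mon w)) - (mon ?w - y))"
        using assms(1) by (simp add: tvs.scale_right_distrib tvs.scale_right_diff_distrib algebra_simps)
      also have "\<dots> \<in> sym_sum n s k" by (intro sym_sum_closed m y)
      finally have "mon w - tscale (- inverse s) y \<in> sym_sum n s k" .
      moreover have "Poly_Mapping.keys (tscale (- inverse s) y) \<subseteq> strict n k"
        using keys_tscale y by blast
      ultimately show ?thesis by blast
    qed
  qed
qed

lemma normal_form:
  assumes "s \<noteq> 0" "x \<in> tens_space n k"
  shows "\<exists>y. Poly_Mapping.keys y \<subseteq> strict n k \<and> x - y \<in> sym_sum n s k"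
  using assms(2)
proof (induction x rule: tens_space_induct)
  case zero
  then show ?case by (intro exI[of _ 0]) (simp add: sym_sum_closed)
next
  case (mon w)
  then show ?case by (rule word_normal_form[OF assms(1)])
next
  case (add x y)
  then obtain x' y' where "Poly_Mapping.keys x' \<subseteq> strict n k" "x - x' \<in> sym_sum n s k"
    "Poly_Mapping.keys y' \<subseteq> strict n k" "y - y' \<in> sym_sum n s k" by blast
  moreover from this have "(x - x') + (y - y') \<in> sym_sum n s k" by (simp only: sym_sum_closed)
  ultimately show ?case using keys_add[of x' y']
    by (intro exI[of _ "x' + y'"]) (auto simp: algebra_simps)
next
  case (scale c x)
  then obtain x' where "Poly_Mapping.keys x' \<subseteq> strict n k" "x - x' \<in> sym_sum n s k" by blast
  moreover from this have "tscale c (x - x') \<in> sym_sum n s k" by (simp only: sym_sum_closed)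
  ultimately show ?case using keys_tscale[of c x']
    by (intro exI[of _ "tscale c x'"]) (auto simp: tvs.scale_right_diff_distrib)
qed

section \<open>The generators on increasing words\<close>

lemma wword_nonzero: "c \<noteq> 0 \<Longrightarrow> d \<noteq> 0 \<Longrightarrow> wword c d i u \<noteq> 0"
  by (induction u) (simp_all add: wword_Nil wword_Cons wt_def)

lemma Eop_absent: "i + 1 \<notin> set w \<Longrightarrow> Eop r s i (mon w) = 0"
  unfolding ops_mon by (induction w) auto

lemma Fop_absent: "i \<notin> set w \<Longrightarrow> Fop r s i (mon w) = 0"
  unfolding ops_mon by (induction w) auto

lemma mon_insert: "mon (u @ a # v) = mon u * mon [a] * mon v"
  by (simp add: mon_mult)

lemma Eop_single:
  assumes "i + 1 \<notin> set u" "i + 1 \<notin> set v"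
  shows "Eop r s i (mon (u @ (i + 1) # v)) = tscale (wword r s i u) (mon (u @ i # v))"
  unfolding mon_insert Eop_mult Wop_mult Eop_absent[OF assms(1)] Eop_absent[OF assms(2)]
  by (simp add: Eop_letter ops_mon tscale_mult_left)

lemma Fop_single:
  assumes "i \<notin> set u" "i \<notin> set v"
  shows "Fop r s i (mon (u @ i # v)) = tscale (wword s r i v) (mon (u @ (i + 1) # v))"
  unfolding mon_insert Fop_mult Wop_mult Fop_absent[OF assms(1)] Fop_absent[OF assms(2)]
  by (simp add: Fop_letter ops_mon wword_Nil tscale_mult_right)

definition lower :: "nat \<Rightarrow> nat list \<Rightarrow> nat list" where
  "lower i w = map (\<lambda>a. if a = i + 1 then i else a) w"

text \<open>The case in which e_i acts nontrivially modulo \<open>sym_sum\<close>: without the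
  letter i + 1 there is nothing to change, and with both letters the result repeats i.\<close>

definition lowerable :: "nat \<Rightarrow> nat list \<Rightarrow> bool" where
  "lowerable i w \<longleftrightarrow> i \<notin> set w \<and> i + 1 \<in> set w"

lemma strict_split:
  assumes "w \<in> strict n k" "a \<in> set w"
  obtains u v where "w = u @ a # v" "a \<notin> set u" "a \<notin> set v"
proof -
  obtain u v where w: "w = u @ a # v" using assms(2) by (meson split_list)
  with assms(1) have "a \<notin> set u" "a \<notin> set v" by (auto simp: strict_def sorted_wrt_append)
  with w that show thesis by blast
qed

lemma lower_absent: "i + 1 \<notin> set u \<Longrightarrow> lower i u = u"
  unfolding lower_def by (rule map_idI) auto

lemma lowerable_split:
  assumes "w \<in> strict n k" "lowerable i w"
  obtains u v where "w = u @ (i + 1) # v" "lower i w = u @ i # v"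
    "i + 1 \<notin> set u" "i + 1 \<notin> set v" "i \<notin> set u" "i \<notin> set v"
proof -
  obtain u v where w: "w = u @ (i + 1) # v" "i + 1 \<notin> set u" "i + 1 \<notin> set v"
    using assms strict_split unfolding lowerable_def by blast
  then have "lower i w = u @ i # v"
    using lower_absent[of i u] lower_absent[of i v] by (simp add: lower_def)
  moreover have "i \<notin> set u" "i \<notin> set v" using assms(2) w unfolding lowerable_def by auto
  ultimately show thesis using that w by blast
qed

lemma lower_strict:
  assumes "w \<in> strict n k" "lowerable i w" "1 \<le> i"
  shows "lower i w \<in> strict n k"
proof -
  have "sorted_wrt (<) (lower i w)"
    unfolding lower_def sorted_wrt_map
    by (rule sorted_wrt_mono_rel[of _ "(<)"])
      (use assms in \<open>auto simp: strict_def lowerable_def less_Suc_eq\<close>)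
  then show ?thesis using assms by (auto simp: strict_def lower_def)
qed

text \<open>As i does not occur beforehand, each i in the result stems from an i + 1, and the word
  can be recovered.\<close>

lemma inj_on_lower: "inj_on (lower i) {w. lowerable i w}"
proof (rule inj_onI)
  fix w w' assume w: "w \<in> {w. lowerable i w}" "w' \<in> {w. lowerable i w}" and eq: "lower i w = lower i w'"
  show "w = w'"
    using eq unfolding lower_def
    by (rule map_inj_on) (use w in \<open>auto simp: lowerable_def inj_on_def split: if_splits\<close>)
qed

lemma lower_sum:
  assumes "w \<in> strict n k" "lowerable i w"
  shows "sum_list (lower i w) < sum_list w"
proof -
  obtain u v where w: "w = u @ (i + 1) # v" "lower i w = u @ i # v"
    by (rule lowerable_split[OF assms])
  then show ?thesis by (simp only: w) simp
qed

lemma Eop_lowerable: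
  assumes "r \<noteq> 0" "s \<noteq> 0" "w \<in> strict n k" "lowerable i w"
  shows "\<exists>c. c \<noteq> 0 \<and> Eop r s i (mon w) = tscale c (mon (lower i w))"
proof -
  obtain u v where "w = u @ (i + 1) # v" "lower i w = u @ i # v" "i + 1 \<notin> set u" "i + 1 \<notin> set v"
    by (rule lowerable_split[OF assms(3,4)])
  then show ?thesis using Eop_single[of i u v r s] wword_nonzero[OF assms(1,2), of i u] by auto
qed

lemma Fop_lowerable:
  assumes "r \<noteq> 0" "s \<noteq> 0" "w \<in> strict n k" "lowerable i w"
  shows "\<exists>c. c \<noteq> 0 \<and> Fop r s i (mon (lower i w)) = tscale c (mon w)"
proof -
  obtain u v where "w = u @ (i + 1) # v" "lower i w = u @ i # v" "i \<notin> set u" "i \<notin> set v"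
    by (rule lowerable_split[OF assms(3,4)])
  then show ?thesis using Fop_single[of i u v r s] wword_nonzero[OF assms(2,1), of i v] by auto
qed

text \<open>If i and i + 1 both occur in an increasing word, they are neighbours, and e_i turns them
  into a repeated adjacent letter i. The scalar is the eigenvalue of \<omega>_i on the letters up to
  and including i.\<close>

lemma Eop_not_lowerable:
  assumes "i \<in> {1..<n}" "w \<in> strict n k" "\<not> lowerable i w"
  shows "Eop r s i (mon w) \<in> sym_sum n s k"
proof (cases "i + 1 \<in> set w")
  case False
  then show ?thesis using Eop_absent sym_sum_closed by metis
next
  case True
  with assms have i: "i \<in> set w" by (auto simp: lowerable_def)
  obtain u t where w: "w = u @ i # t" using i by (meson split_list)
  have srt: "sorted_wrt (<) w" using assms by (simp add: strict_def)
  with w True have "i + 1 \<in> set t" by (auto simp: sorted_wrt_append)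
  then obtain b v where t: "t = b # v" by (cases t) auto
  \<comment> \<open>The first letter after i exceeds i and is at most i + 1, which occurs in
    t.\<close>
  have "b = i + 1" using srt w t \<open>i + 1 \<in> set t\<close> by (auto simp: sorted_wrt_append)
  with w t have w: "w = u @ i # (i + 1) # v" by simp
  have u: "i + 1 \<notin> set u" and v: "i + 1 \<notin> set v" using srt w by (auto simp: sorted_wrt_append)
  have z: "Eop r s i (mon u) = 0" "Eop r s i (mon v) = 0"
    using u v Eop_absent by blast+
  have "mon w = mon u * (mon [i] * (mon [i + 1] * mon v))"
    by (simp add: w mon_mult)
  then have "Eop r s i (mon w) = Eop r s i (mon u * (mon [i] * (mon [i + 1] * mon v)))"
    by (rule arg_cong)
  also have "\<dots> = tscale (wword r s i u * r) (mon (u @ i # i # v))"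
    by (simp add: Eop_mult z Eop_letter Wop_mult Wop_letter wt_def tscale_simps)
      (simp add: ops_mon(3) tscale_simps mon_mult mult.commute)
  finally have "Eop r s i (mon w) = tscale (wword r s i u * r) (mon (u @ i # i # v))" .
  moreover have "mon (u @ i # i # v) \<in> sym_sum n s k"
    by (rule sym_sum_words(1)) (use assms w in \<open>auto simp: strict_def\<close>)
  ultimately show ?thesis by (simp add: sym_sum_closed)
qed

definition topw :: "nat \<Rightarrow> nat list" where
  "topw k = [1..<Suc k]"

text \<open>If no index is lowerable, the set of letters contains j whenever it contains j + 1 with
  j \<ge> 1. It is then an initial segment with k elements.\<close>

lemma not_lowerable_top:
  assumes w: "w \<in> strict n k" and nl: "\<And>i. i \<in> {1..<n} \<Longrightarrow> \<not> lowerable i w"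
  shows "w = topw k"
proof -
  have srt: "sorted_wrt (<) w" and len: "length w = k" and sub: "set w \<subseteq> {1..n}"
    using w by (simp_all add: strict_def)
  have card: "card (set w) = k"
    using srt len by (simp add: distinct_card strict_sorted_iff)
  have down: "{1..j} \<subseteq> set w" if "j \<in> set w" for j
    using that
  proof (induction j)
    case (Suc j)
    have "{1..j} \<subseteq> set w"
    proof (cases "j = 0")
      case False
      \<comment> \<open>\<open>Suc j\<close> is a letter, hence at most n, so j is a legal index of
        a generator.\<close>
      with Suc.prems sub have "j \<in> {1..<n}" by auto
      then have "j \<in> set w" using nl[of j] Suc.prems by (auto simp: lowerable_def)
      then show ?thesis by (rule Suc.IH)
    qed simp
    then show ?case using Suc.prems by (auto simp: le_Suc_eq)
  qed simp
  have "j \<le> k" if "j \<in> set w" for j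
    using card_mono[OF _ down[OF that]] card by simp
  then have "set w \<subseteq> {1..k}" using sub by auto
  then have "set w = {1..k}" using card by (simp add: card_subset_eq)
  then have "set w = set (topw k)"
    by (simp add: topw_def atLeastLessThanSuc_atLeastAtMost del: upt_Suc)
  then show ?thesis using strict_sorted_equal[of "topw k" w] srt
    unfolding topw_def by (simp only: sorted_wrt_upt)
qed

lemma top_strict: "k \<le> n \<Longrightarrow> topw k \<in> strict n k"
  by (auto simp: strict_def topw_def simp del: upt_Suc)

text \<open>y' is e_i y without the contributions of the words that are not lowerable, which fall
  into \<open>sym_sum\<close>. It is nonzero as a combination of words because distinct words keep
  distinct images.\<close>

lemma lower_step:
  assumes r: "r \<noteq> 0" "s \<noteq> 0" and i: "i \<in> {1..<n}" and y: "Poly_Mapping.keys y \<subseteq> strict n k"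
    and w: "w \<in> Poly_Mapping.keys y" "lowerable i w"
  shows "\<exists>y'. y' \<noteq> 0 \<and> Poly_Mapping.keys y' \<subseteq> strict n k \<and> Eop r s i y - y' \<in> sym_sum n s k \<and>
    sum sum_list (Poly_Mapping.keys y') < sum sum_list (Poly_Mapping.keys y)"
proof -
  define G where "G = {w \<in> Poly_Mapping.keys y. lowerable i w}"
  have G: "finite G" "G \<subseteq> strict n k" "\<And>w. w \<in> G \<Longrightarrow> lowerable i w" "G \<subseteq> Poly_Mapping.keys y"
    and wG: "w \<in> G"
    using y w by (auto simp: G_def)
  have "\<forall>w\<in>G. \<exists>c. c \<noteq> 0 \<and> Eop r s i (mon w) = tscale c (mon (lower i w))"
    using Eop_lowerable[OF r] G by blast
  then obtain c where c: "\<And>w. w \<in> G \<Longrightarrow> c w \<noteq> 0"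
    and E: "\<And>w. w \<in> G \<Longrightarrow> Eop r s i (mon w) = tscale (c w) (mon (lower i w))"
    by metis
  define f where "f w = Poly_Mapping.lookup y w * c w" for w
  define y' where "y' = (\<Sum>w\<in>G. tscale (f w) (mon (lower i w)))"
  have inj: "inj_on (lower i) G" by (rule inj_on_subset[OF inj_on_lower]) (use G in blast)
  have lk: "Poly_Mapping.lookup y' v = (\<Sum>w\<in>G. if lower i w = v then f w else 0)" for v
    by (simp add: y'_def lookup_sum lookup_tscale lookup_mon if_distrib cong: if_cong)
  \<comment> \<open>By injectivity only w itself contributes to the coefficient of
    \<open>lower i w\<close>.\<close>
  have "Poly_Mapping.lookup y' (lower i w) = (\<Sum>w'\<in>G. if w' = w then f w' else 0)"
    unfolding lk using inj wG by (intro sum.cong refl) (auto dest: inj_onD)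
  also have "\<dots> = f w" using G wG by simp
  also have "\<dots> \<noteq> 0" using c[OF wG] w by (simp add: f_def in_keys_iff)
  finally have ne: "y' \<noteq> 0" by auto
  have keys: "Poly_Mapping.keys y' \<subseteq> lower i ` G"
  proof
    fix v assume "v \<in> Poly_Mapping.keys y'"
    then have "(\<Sum>w\<in>G. if lower i w = v then f w else 0) \<noteq> 0" by (simp add: in_keys_iff lk)
    then obtain w where "w \<in> G" "(if lower i w = v then f w else 0) \<noteq> 0" by (rule sum.not_neutral_contains_not_neutral)
    then show "v \<in> lower i ` G" by (auto split: if_splits)
  qed
  have strict': "lower i ` G \<subseteq> strict n k"
    using lower_strict G i by auto
  have "Eop r s i y = Eop r s i (\<Sum>w\<in>Poly_Mapping.keys y. tscale (Poly_Mapping.lookup y w) (mon w))"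
    by (rule arg_cong[OF falg_expansion])
  also have "\<dots> = (\<Sum>w\<in>Poly_Mapping.keys y. tscale (Poly_Mapping.lookup y w) (Eop r s i (mon w)))"
    by (simp add: tlinear_sum[OF tlinear_ops(1)[OF tlinear_id]])
  also have "\<dots> = (\<Sum>w\<in>Poly_Mapping.keys y - G. tscale (Poly_Mapping.lookup y w) (Eop r s i (mon w)))
      + (\<Sum>w\<in>G. tscale (Poly_Mapping.lookup y w) (Eop r s i (mon w)))"
    using G by (intro sum.subset_diff) simp_all
  also have "(\<Sum>w\<in>G. tscale (Poly_Mapping.lookup y w) (Eop r s i (mon w))) = y'"
    unfolding y'_def f_def by (intro sum.cong refl) (simp add: E)
  finally have "Eop r s i y - y' = (\<Sum>w\<in>Poly_Mapping.keys y - G. tscale (Poly_Mapping.lookup y w) (Eop r s i (mon w)))"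
    by simp
  also have "\<dots> \<in> sym_sum n s k"
  proof (rule tvs.subspace_sum[OF subspace_sym_sum])
    fix w assume "w \<in> Poly_Mapping.keys y - G"
    then show "tscale (Poly_Mapping.lookup y w) (Eop r s i (mon w)) \<in> sym_sum n s k"
      using y Eop_not_lowerable[OF i, of w k r s] by (intro sym_sum_closed) (auto simp: G_def)
  qed
  finally have diff: "Eop r s i y - y' \<in> sym_sum n s k" .
  have "sum sum_list (Poly_Mapping.keys y') \<le> sum sum_list (lower i ` G)"
    using keys G by (intro sum_mono2) auto
  also have "\<dots> = (\<Sum>w\<in>G. sum_list (lower i w))"
    by (simp add: sum.reindex[OF inj])
  also have "\<dots> < (\<Sum>w\<in>G. sum_list w)"
    using G wG by (intro sum_strict_mono) (auto intro: lower_sum)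
  also have "\<dots> \<le> sum sum_list (Poly_Mapping.keys y)"
    using G by (intro sum_mono2) auto
  finally show ?thesis using ne keys strict' diff by blast
qed

text \<open>Induction on the sum of all letters over the support, which \<open>lower_step\<close>
  decreases. When no word of the support is lowerable for any i, the support consists of
  \<open>topw k\<close> alone.\<close>

lemma highest_weight_reached:
  assumes r: "r \<noteq> 0" "s \<noteq> 0" and N: "tvs.subspace N" "sym_sum n s k \<subseteq> N"
    and E: "\<And>i x. i \<in> {1..<n} \<Longrightarrow> x \<in> N \<Longrightarrow> Eop r s i x \<in> N"
    and y: "y \<in> N" "y \<noteq> 0" "Poly_Mapping.keys y \<subseteq> strict n k"
  shows "mon (topw k) \<in> N"
  using y
proof (induction "sum sum_list (Poly_Mapping.keys y)" arbitrary: y rule: less_induct)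
  case less
  show ?case
  proof (cases "\<exists>i\<in>{1..<n}. \<exists>w\<in>Poly_Mapping.keys y. lowerable i w")
    case True
    then obtain i w where iw: "i \<in> {1..<n}" "w \<in> Poly_Mapping.keys y" "lowerable i w" by blast
    obtain y' where y': "y' \<noteq> 0" "Poly_Mapping.keys y' \<subseteq> strict n k" "Eop r s i y - y' \<in> sym_sum n s k"
      "sum sum_list (Poly_Mapping.keys y') < sum sum_list (Poly_Mapping.keys y)"
      using lower_step[OF r iw(1) less.prems(3) iw(2,3)] by blast
    \<comment> \<open>Only e_i y is known to lie in N; since N contains \<open>sym_sum\<close>, it
      also contains the normalised y'.\<close>
    have "Eop r s i y - (Eop r s i y - y') \<in> N"
      using tvs.subspace_diff[OF N(1) E[OF iw(1) less.prems(1)]] y'(3) N(2) by blast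
    then have "y' \<in> N" by simp
    then show ?thesis using less.hyps[OF y'(4)] y' by blast
  next
    case False
    then have keys: "w = topw k" if "w \<in> Poly_Mapping.keys y" for w
      using not_lowerable_top[of w n k] less.prems(3) that by blast
    obtain w where w: "w \<in> Poly_Mapping.keys y" using less.prems(2) keys_eq_empty[of y] by blast
    then have ks: "Poly_Mapping.keys y = {topw k}" using keys by blast
    have "(\<Sum>w\<in>Poly_Mapping.keys y. tscale (Poly_Mapping.lookup y w) (mon w))
      = tscale (Poly_Mapping.lookup y (topw k)) (mon (topw k))"
      unfolding ks by simp
    with falg_expansion[of y] have "y = tscale (Poly_Mapping.lookup y (topw k)) (mon (topw k))"
      by (rule trans)
    moreover have "Poly_Mapping.lookup y (topw k) \<noteq> 0"
      unfolding in_keys_iff[symmetric] ks by (rule singletonI)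
    ultimately have "mon (topw k) = tscale (inverse (Poly_Mapping.lookup y (topw k))) y"
      by (metis left_inverse tvs.scale_one tvs.scale_scale)
    then show ?thesis using less.prems(1) N(1) by (metis tvs.subspace_scale)
  qed
qed

text \<open>Every increasing word other than \<open>topw k\<close> is, up to a nonzero scalar, f_i
  of a word with smaller letter sum, namely of \<open>lower i w\<close>. Normal forms then give the
  whole tensor space.\<close>

lemma highest_weight_generates:
  assumes r: "r \<noteq> 0" "s \<noteq> 0" and N: "tvs.subspace N" "sym_sum n s k \<subseteq> N"
    and F: "\<And>i x. i \<in> {1..<n} \<Longrightarrow> x \<in> N \<Longrightarrow> Fop r s i x \<in> N"
    and top: "mon (topw k) \<in> N"
  shows "tens_space n k \<subseteq> N"
proof
  have strict: "mon w \<in> N" if "w \<in> strict n k" for w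
    using that
  proof (induction "sum_list w" arbitrary: w rule: less_induct)
    case less
    show ?case
    proof (cases "\<exists>i\<in>{1..<n}. lowerable i w")
      case True
      then obtain i where i: "i \<in> {1..<n}" "lowerable i w" by blast
      obtain c where c: "c \<noteq> 0" "Fop r s i (mon (lower i w)) = tscale c (mon w)"
        using Fop_lowerable[OF r less.prems i(2)] by blast
      have "mon (lower i w) \<in> N"
        using less.hyps[OF lower_sum[OF less.prems i(2)]] lower_strict[OF less.prems i(2)] i by simp
      then have "tscale c (mon w) \<in> N" using F[OF i(1)] c by metis
      then have "tscale (inverse c) (tscale c (mon w)) \<in> N" by (rule tvs.subspace_scale[OF N(1)])
      then show ?thesis using c by simp
    next
      case False
      then show ?thesis using not_lowerable_top[OF less.prems] top by blast
    qed
  qed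
  fix x assume "x \<in> tens_space n k"
  then obtain y where y: "Poly_Mapping.keys y \<subseteq> strict n k" "x - y \<in> sym_sum n s k"
    using normal_form[OF r(2)] by blast
  have "y \<in> N"
    by (rule falg_induct[OF y(1)])
      (simp_all add: strict tvs.subspace_0[OF N(1)] tvs.subspace_add[OF N(1)] tvs.subspace_scale[OF N(1)])
  then have "(x - y) + y \<in> N" using tvs.subspace_add[OF N(1)] y(2) N(2) by blast
  then show "x \<in> N" by simp
qed

subsection \<open>Simplicity of the exterior power\<close>

locale exterior = urs +
  fixes k :: nat
  assumes k: "1 \<le> k" "k \<le> n"
begin

abbreviation S where "S \<equiv> sym_sum n s k"
abbreviation v where "v \<equiv> mon (topw k) :: nat falg"
abbreviation Q where "Q \<equiv> quot_module (T k) S"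

lemma v_tens_space: "v \<in> tens_space n k"
  using k by (auto simp: mon_tens_space topw_def simp del: upt_Suc)

lemma Dfun_v: "Dfun s v = 1"
  using top_strict[OF k(2)] by (simp add: Dfun_mon dcoef_def strict_def invs_sorted strict_sorted_iff)

text \<open>The set N below is the preimage in the tensor power of the submodule generated by the
  class of x. It is closed under all generators, so the two preceding lemmas apply to it.\<close>

lemma cyclic:
  assumes x: "x \<in> tens_space n k" "x \<notin> S" and y: "y \<in> tens_space n k"
  shows "\<exists>p\<in>carrier A. y - act r s p x \<in> S"
proof -
  define N where "N = {y. \<exists>p\<in>carrier A. y - act r s p x \<in> S}"
  have N: "tvs.subspace N"
  proof (rule tvs.subspaceI)
    show "0 \<in> N" unfolding N_def by (auto intro!: bexI[of _ 0] simp: sym_sum_closed)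
  next
    fix y z assume "y \<in> N" "z \<in> N"
    then obtain p q where "p \<in> carrier A" "y - act r s p x \<in> S" "q \<in> carrier A" "z - act r s q x \<in> S"
      unfolding N_def by blast
    then have "p + q \<in> carrier A" "(y - act r s p x) + (z - act r s q x) \<in> S"
      by (simp_all only: free_alg_closed sym_sum_closed)
    moreover have "(y - act r s p x) + (z - act r s q x) = (y + z) - act r s (p + q) x" by simp
    ultimately show "y + z \<in> N" unfolding N_def mem_Collect_eq by metis
  next
    fix c y assume "y \<in> N"
    then obtain p where "p \<in> carrier A" "y - act r s p x \<in> S" unfolding N_def by blast
    then have "tscale c p \<in> carrier A" "tscale c (y - act r s p x) \<in> S"
      by (simp_all only: tscale_def[of _ p] free_alg_closed const_in_free_alg sym_sum_closed)
    moreover have "tscale c (y - act r s p x) = tscale c y - act r s (tscale c p) x"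
      by (simp add: tvs.scale_right_diff_distrib)
    ultimately show "tscale c y \<in> N" unfolding N_def mem_Collect_eq by metis
  qed
  have S_N: "S \<subseteq> N" unfolding N_def by (auto intro!: bexI[of _ 0])
  have x_N: "x \<in> N" unfolding N_def by (auto intro!: bexI[of _ 1] simp: sym_sum_closed)
  have op: "opg r s g y \<in> N" if g: "g \<in> gens n" and y: "y \<in> N" for g y
  proof -
    obtain p where p: "p \<in> carrier A" "y - act r s p x \<in> S" using y unfolding N_def by blast
    have "opg r s g (y - act r s p x) \<in> S" by (rule opg_sym_sum[OF g p(2)])
    moreover have "opg r s g (y - act r s p x) = opg r s g y - act r s (mon [g] * p) x"
      using opg_linear(1)[of r s g "y - act r s p x" "act r s p x"] by (simp add: algebra_simps)
    moreover have "mon [g] * p \<in> carrier A" using g p by (intro free_alg_closed) simp_all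
    ultimately show ?thesis unfolding N_def mem_Collect_eq by metis
  qed
  have E: "Eop r s i y \<in> N" if "i \<in> {1..<n}" "y \<in> N" for i y
    using op[OF gens_mem(1)[OF that(1)] that(2)] by simp
  have F: "Fop r s i y \<in> N" if "i \<in> {1..<n}" "y \<in> N" for i y
    using op[OF gens_mem(2)[OF that(1)] that(2)] by simp
  obtain z where z: "Poly_Mapping.keys z \<subseteq> strict n k" "x - z \<in> S"
    using normal_form[OF s0 x(1)] by blast
  \<comment> \<open>Otherwise x = x - z would lie in S.\<close>
  have "z \<noteq> 0" using z x by auto
  have "x - (x - z) \<in> N" using tvs.subspace_diff[OF N x_N] z(2) S_N by blast
  then have "z \<in> N" by simp
  then have "v \<in> N"
    using highest_weight_reached[OF r0 s0 N S_N E _ \<open>z \<noteq> 0\<close> z(1)] by blast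
  then have "tens_space n k \<subseteq> N"
    using highest_weight_generates[OF r0 s0 N S_N F] by blast
  with y show ?thesis unfolding N_def by blast
qed

lemma v_notin_S: "v \<notin> S"
  using Dfun_sym_sum[OF s0, of v n k] Dfun_v by auto

lemma Q_mod: "module_mod U (T k) S"
  by (rule left_module.module_mod[OF tens_power_module submodule_sym_sum])

lemma coset_eq_iff':
  assumes "x \<in> tens_space n k" "y \<in> tens_space n k"
  shows "S +>\<^bsub>T k\<^esub> x = S +>\<^bsub>T k\<^esub> y \<longleftrightarrow> x - y \<in> S"
proof -
  interpret M: left_module U "T k" by (rule tens_power_module)
  have "\<ominus>\<^bsub>T k\<^esub> y = - y"
    using assms by (intro M.minus_equality[of "- y" y]) (simp_all add: tens_space_closed)
  then have "x \<ominus>\<^bsub>T k\<^esub> y = x - y" by (simp add: a_minus_def)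
  then show ?thesis using module_mod.coset_eq_iff[OF Q_mod, of x y] assms by simp
qed

lemma Q_simple: "simple_module U Q"
proof (rule left_module.quot_simpleI[OF tens_power_module submodule_sym_sum])
  show "S \<noteq> carrier (T k)" using v_tens_space v_notin_S by auto
  fix x y assume x: "x \<in> carrier (T k)" "x \<notin> S" and y: "y \<in> carrier (T k)"
  then obtain p where p: "p \<in> carrier A" "y - act r s p x \<in> S" using cyclic[of x y] by auto
  then have "S +>\<^bsub>T k\<^esub> y = S +>\<^bsub>T k\<^esub> cls n r s p \<odot>\<^bsub>T k\<^esub> x"
    using x y by (simp add: tens_smult coset_eq_iff' act_tens_space)
  then show "\<exists>a\<in>carrier U. S +>\<^bsub>T k\<^esub> y = S +>\<^bsub>T k\<^esub> a \<odot>\<^bsub>T k\<^esub> x"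
    using cls_in_U[OF p(1)] by blast
qed

subsection \<open>The character of the Borel subalgebra\<close>

abbreviation B where "B \<equiv> borel_subalg n r s"

lemma cartan_gens_subset: "cartan_gens n \<subseteq> gens n"
  by (auto simp: cartan_gens_def gens_def)

lemma borel_gens_subset:
  "range (\<lambda>c. cls n r s (const c)) \<union> (\<lambda>g. cls n r s (mon [g])) ` (cartan_gens n \<union> GE ` {1..<n}) \<subseteq> carrier U"
  using cartan_gens_subset by (auto intro!: cls_in_U simp: gens_mem)

lemma B_subset: "B \<subseteq> carrier U"
  unfolding borel_subalg_def by (rule ring.generate_ring_incl[OF ring_U borel_gens_subset])

text \<open>\<open>topw k\<close> contains i whenever it contains i + 1, so it is not lowerable for
  any i.\<close>

lemma Eop_v: "i \<in> {1..<n} \<Longrightarrow> Eop r s i v \<in> S"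
  by (rule Eop_not_lowerable[OF _ top_strict[OF k(2)]]) (auto simp: lowerable_def topw_def simp del: upt_Suc)

lemma wword_top:
  assumes "1 \<le> i"
  shows "wword c d i (topw m) = (if i \<le> m then c else 1) * (if i + 1 \<le> m then d else 1)"
proof (induction m)
  case (Suc m)
  have "topw (Suc m) = topw m @ [Suc m]" by (simp add: topw_def)
  then have "wword c d i (topw (Suc m)) = wword c d i (topw m) * wt c d i (Suc m)"
    by (simp add: wword_append) (simp add: wword_def)
  then show ?case using assms by (auto simp: Suc wt_def)
qed (use assms in \<open>simp add: topw_def wword_Nil\<close>)

text \<open>The fundamental weight pairs with \<epsilon>_i to 1 if i \<le> k and to 0 otherwise,
  which is the number of occurrences of i in \<open>topw k\<close>.\<close>

lemma weight_v:
  assumes "i \<in> {1..<n}" "c \<noteq> 0" "d \<noteq> 0"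
  shows "wword c d i (topw k) = c powi ip n (eps i) (fund_weight k) * d powi ip n (eps (i + 1)) (fund_weight k)"
proof -
  have f: "fund_weight k m = (if m \<in> {1..k} then 1 else 0)" for m
    by (simp add: fund_weight_def eps_def)
  have "ip n (eps i) (fund_weight k) = fund_weight k i" "ip n (eps (i + 1)) (fund_weight k) = fund_weight k (i + 1)"
    using assms(1) by (simp_all add: ip_eps)
  then show ?thesis using assms(1) by (simp add: wword_top f)
qed

text \<open>Elements for which v is an eigenvector modulo S are closed under the ring operations,
  and the eigenvalue behaves like a ring homomorphism. The three parts match the closure rules of
  \<open>generate_ring\<close>.\<close>

lemma borel_add_eigen:
  assumes a: "a \<in> carrier U" "a \<odot>\<^bsub>T k\<^esub> v - tscale c v \<in> S"
    and b: "b \<in> carrier U" "b \<odot>\<^bsub>T k\<^esub> v - tscale d v \<in> S"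
  shows "(a \<oplus>\<^bsub>U\<^esub> b) \<odot>\<^bsub>T k\<^esub> v - tscale (c + d) v \<in> S"
    and "(a \<otimes>\<^bsub>U\<^esub> b) \<odot>\<^bsub>T k\<^esub> v - tscale (c * d) v \<in> S"
    and "(\<ominus>\<^bsub>U\<^esub> a) \<odot>\<^bsub>T k\<^esub> v - tscale (- c) v \<in> S"
proof -
  obtain p where p: "p \<in> carrier A" "a = cls n r s p" using a(1) by (rule UE)
  obtain q where q: "q \<in> carrier A" "b = cls n r s q" using b(1) by (rule UE)
  have pS: "act r s p v - tscale c v \<in> S" and qS: "act r s q v - tscale d v \<in> S"
    using a(2) b(2) p q v_tens_space by (simp_all add: tens_smult)
  have "(a \<oplus>\<^bsub>U\<^esub> b) \<odot>\<^bsub>T k\<^esub> v - tscale (c + d) v = (act r s p v - tscale c v) + (act r s q v - tscale d v)"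
    using p q v_tens_space
    by (simp add: cls_ops tens_smult free_alg_closed tvs.scale_left_distrib)
  also have "\<dots> \<in> S" by (rule sym_sum_closed(2)[OF pS qS])
  finally show "(a \<oplus>\<^bsub>U\<^esub> b) \<odot>\<^bsub>T k\<^esub> v - tscale (c + d) v \<in> S" .
  have "(a \<otimes>\<^bsub>U\<^esub> b) \<odot>\<^bsub>T k\<^esub> v - tscale (c * d) v
    = act r s p (act r s q v - tscale d v) + tscale d (act r s p v - tscale c v)"
    using p q v_tens_space
    by (simp add: cls_ops tens_smult free_alg_closed tvs.scale_right_diff_distrib mult.commute)
  also have "\<dots> \<in> S" by (intro sym_sum_closed act_sym_sum p pS qS)
  finally show "(a \<otimes>\<^bsub>U\<^esub> b) \<odot>\<^bsub>T k\<^esub> v - tscale (c * d) v \<in> S" .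
  have "act r s (- p) v = - act r s p v" using act_left(2)[of r s 0 p v] by simp
  then have "(\<ominus>\<^bsub>U\<^esub> a) \<odot>\<^bsub>T k\<^esub> v - tscale (- c) v = - (act r s p v - tscale c v)"
    using p v_tens_space by (simp add: cls_minus tens_smult free_alg_minus_closed)
  also have "\<dots> \<in> S" by (rule sym_sum_closed(5)[OF pS])
  finally show "(\<ominus>\<^bsub>U\<^esub> a) \<odot>\<^bsub>T k\<^esub> v - tscale (- c) v \<in> S" .
qed

lemma cls_v: "p \<in> carrier A \<Longrightarrow> cls n r s p \<odot>\<^bsub>T k\<^esub> v = act r s p v"
  by (rule tens_smult[OF _ v_tens_space])

lemma one_v: "\<one>\<^bsub>U\<^esub> \<odot>\<^bsub>T k\<^esub> v = v"
  unfolding cls_one by (simp add: cls_v)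

text \<open>Eigenvalues on the class of \<open>v\<close>; the value on \<open>GF i\<close>, which is not in the Borel subalgebra, is junk.\<close>

primrec eigen :: "gen \<Rightarrow> complex" where
  "eigen (GE i) = 0"
| "eigen (GF i) = 0"
| "eigen (GW i) = wword r s i (topw k)"
| "eigen (GWinv i) = wword (inverse r) (inverse s) i (topw k)"
| "eigen (GW' i) = wword s r i (topw k)"
| "eigen (GWinv' i) = wword (inverse s) (inverse r) i (topw k)"

lemma gen_eigen:
  assumes "g \<in> cartan_gens n \<union> GE ` {1..<n}"
  shows "cls n r s (mon [g]) \<odot>\<^bsub>T k\<^esub> v - tscale (eigen g) v \<in> S"
proof -
  have g: "g \<in> gens n" using assms cartan_gens_subset by (auto simp: gens_mem)
  have "opg r s g v - tscale (eigen g) v \<in> S"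
  proof (cases "g \<in> cartan_gens n")
    case True
    then have "opg r s g v = tscale (eigen g) v"
      by (auto simp: cartan_gens_def ops_mon)
    then show ?thesis by (simp add: sym_sum_closed)
  next
    case False
    with assms obtain i where "i \<in> {1..<n}" "g = GE i" by auto
    then show ?thesis using Eop_v by simp
  qed
  then show ?thesis using g by (simp add: cls_v)
qed

text \<open>The functional is 1 on v and 0 on S, so it reads off the eigenvalue of b on the class of
  v whenever there is one, in particular on the Borel subalgebra.\<close>

definition chi0 :: "gen falg set \<Rightarrow> complex" where
  "chi0 b = Dfun s (b \<odot>\<^bsub>T k\<^esub> v)"

lemma chi0_eqI:
  assumes "b \<odot>\<^bsub>T k\<^esub> v - tscale c v \<in> S"
  shows "chi0 b = c"
  using Dfun_sym_sum[OF s0 assms] Dfun_v by (simp add: chi0_def)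

lemma chi0_eigen:
  assumes "b \<in> B"
  shows "b \<odot>\<^bsub>T k\<^esub> v - tscale (chi0 b) v \<in> S"
proof -
  have "\<exists>c. b \<odot>\<^bsub>T k\<^esub> v - tscale c v \<in> S"
    using assms[unfolded borel_subalg_def]
  proof (induction rule: generate_ring.induct)
    case one
    show ?case by (rule exI[of _ 1]) (simp add: one_v sym_sum_closed)
  next
    case (incl h)
    then show ?case
    proof
      assume "h \<in> range (\<lambda>c. cls n r s (const c))"
      then obtain c where "h = cls n r s (const c)" by blast
      then show ?thesis by (intro exI[of _ c]) (simp add: cls_v sym_sum_closed)
    qed (use gen_eigen in blast)
  next
    case (a_inv h)
    then have "h \<in> carrier U" using B_subset unfolding borel_subalg_def by blast
    then show ?case using a_inv borel_add_eigen(3) by blast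
  next
    case (eng_add a b)
    then have "a \<in> carrier U" "b \<in> carrier U" using B_subset unfolding borel_subalg_def by blast+
    then show ?case using eng_add borel_add_eigen(1) by blast
  next
    case (eng_mult a b)
    then have "a \<in> carrier U" "b \<in> carrier U" using B_subset unfolding borel_subalg_def by blast+
    then show ?case using eng_mult borel_add_eigen(2) by blast
  qed
  then show ?thesis using chi0_eqI by blast
qed

text \<open>This guarantees that the \<open>SOME\<close> in \<open>one_dim_module\<close> yields a
  genuine character.\<close>

lemma chi0_char: "is_borel_char n r s (fund_weight k) chi0"
  unfolding is_borel_char_def
proof (intro conjI allI ballI)
  show "chi0 \<in> ring_hom (U\<lparr>carrier := B\<rparr>) (class_ring UNIV)"
  proof (rule ring_hom_memI)
    fix a b assume "a \<in> carrier (U\<lparr>carrier := B\<rparr>)" "b \<in> carrier (U\<lparr>carrier := B\<rparr>)"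
    then have a: "a \<in> B" "a \<in> carrier U" and b: "b \<in> B" "b \<in> carrier U" using B_subset by auto
    show "chi0 (a \<otimes>\<^bsub>U\<lparr>carrier := B\<rparr>\<^esub> b) = chi0 a \<otimes>\<^bsub>class_ring UNIV\<^esub> chi0 b"
      using chi0_eqI[OF borel_add_eigen(2)[OF a(2) chi0_eigen[OF a(1)] b(2) chi0_eigen[OF b(1)]]]
      by (simp add: class_ring_def)
    show "chi0 (a \<oplus>\<^bsub>U\<lparr>carrier := B\<rparr>\<^esub> b) = chi0 a \<oplus>\<^bsub>class_ring UNIV\<^esub> chi0 b"
      using chi0_eqI[OF borel_add_eigen(1)[OF a(2) chi0_eigen[OF a(1)] b(2) chi0_eigen[OF b(1)]]]
      by (simp add: class_ring_def)
  next
    show "chi0 \<one>\<^bsub>U\<lparr>carrier := B\<rparr>\<^esub> = \<one>\<^bsub>class_ring UNIV\<^esub>"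
      by (simp add: class_ring_def chi0_def one_v Dfun_v)
  qed (simp add: class_ring_def)
  show "chi0 (cls n r s (const c)) = c" for c
    by (simp add: chi0_def cls_v Dfun_v)
  have g: "chi0 (cls n r s (mon [g])) = eigen g" if "g \<in> cartan_gens n \<union> GE ` {1..<n}" for g
    by (rule chi0_eqI[OF gen_eigen[OF that]])
  fix i assume i: "i \<in> {1..<n}"
  show "chi0 (cls n r s (wg i)) = r powi ip n (eps i) (fund_weight k) * s powi ip n (eps (i + 1)) (fund_weight k)"
    using g[of "GW i"] i weight_v[OF i r0 s0] by (auto simp: cartan_gens_def)
  show "chi0 (cls n r s (wg' i)) = r powi ip n (eps (i + 1)) (fund_weight k) * s powi ip n (eps i) (fund_weight k)"
    using g[of "GW' i"] i weight_v[OF i s0 r0] by (auto simp: cartan_gens_def mult.commute)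
  show "chi0 (cls n r s (eg i)) = 0"
    using g[of "GE i"] i by simp
qed

text \<open>Needed for every character, since nothing more is known about the one picked by
  \<open>SOME\<close>. Both sides are compared on the generators of the Borel subalgebra and
  extended by induction over \<open>generate_ring\<close>.\<close>

lemma char_eigen:
  assumes chi: "is_borel_char n r s (fund_weight k) chi" and b: "b \<in> B"
  shows "b \<odot>\<^bsub>T k\<^esub> v - tscale (chi b) v \<in> S"
proof -
  have hom: "chi \<in> ring_hom (U\<lparr>carrier := B\<rparr>) (class_ring UNIV)"
    and const: "\<And>c. chi (cls n r s (const c)) = c"
    using chi by (simp_all add: is_borel_char_def)
  have mult: "chi (a \<otimes>\<^bsub>U\<^esub> b) = chi a * chi b" and add: "chi (a \<oplus>\<^bsub>U\<^esub> b) = chi a + chi b"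
    if "a \<in> B" "b \<in> B" for a b
    using ring_hom_mult[OF hom, of a b] ring_hom_add[OF hom, of a b] that by (simp_all add: class_ring_def)
  have chi_one: "chi \<one>\<^bsub>U\<^esub> = 1"
    using ring_hom_one[OF hom] by (simp add: class_ring_def)
  have W: "chi (cls n r s (mon [GW i])) = eigen (GW i)" "chi (cls n r s (mon [GW' i])) = eigen (GW' i)"
    "chi (cls n r s (mon [GE i])) = eigen (GE i)" if "i \<in> {1..<n}" for i
    using chi that weight_v[OF that r0 s0] weight_v[OF that s0 r0]
    by (simp_all add: is_borel_char_def mult.commute)
  have gB: "cls n r s (mon [g]) \<in> B" if "g \<in> cartan_gens n" for g
    unfolding borel_subalg_def using that by (intro generate_ring.incl) blast
  \<comment> \<open>\<open>is_borel_char\<close> does not list values on the inverses of \<omega>_i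
    and \<omega>'_i; they follow from multiplicativity and (R1).\<close>
  have inv: "chi (cls n r s (mon [h])) = inverse (chi (cls n r s (mon [g])))"
    if g: "g \<in> cartan_gens n" and h: "h \<in> cartan_gens n" and rel: "mon [g] * mon [h] - 1 \<in> I" for g h
  proof -
    have gh: "g \<in> gens n" "h \<in> gens n" using g h cartan_gens_subset by blast+
    have "mon [g] * mon [h] \<in> carrier A" using gh by (intro free_alg_closed) simp_all
    have "cls n r s (mon [g] * mon [h]) = cls n r s 1"
    proof -
      interpret ideal I A by (rule ideal_I)
      have "(mon [g] * mon [h] - 1) \<oplus>\<^bsub>A\<^esub> 1 \<in> I +>\<^bsub>A\<^esub> 1"
        using rel by (rule a_rcosI[OF _ a_subset]) simp
      then have "mon [g] * mon [h] \<in> I +>\<^bsub>A\<^esub> 1" by simp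
      then show ?thesis unfolding cls_def
        by (intro a_repr_independence[symmetric, OF _ _ a_subgroup]) simp_all
    qed
    then have "cls n r s (mon [g]) \<otimes>\<^bsub>U\<^esub> cls n r s (mon [h]) = \<one>\<^bsub>U\<^esub>"
      using gh by (simp add: cls_ops cls_one)
    then have "chi (cls n r s (mon [g])) * chi (cls n r s (mon [h])) = 1"
      using mult[OF gB[OF g] gB[OF h]] chi_one by simp
    then show ?thesis by (simp add: inverse_unique)
  qed
  have R1: "mon [g] * mon [h] - 1 \<in> I"
    if "i \<in> {1..<n}" "(g, h) \<in> {(GW i, GWinv i), (GW' i, GWinv' i)}" for i g h
  proof -
    have "mon [g] * mon [h] - 1 \<in> rels" using that unfolding R1_def by auto
    then show ?thesis
      unfolding rel_ideal_def using ring.genideal_self[OF ring_free_alg rels_carrier] by blast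
  qed
  have winv: "wword (inverse c) (inverse d) i u = inverse (wword c d i u)" for c d i u
    by (induction u) (simp_all add: wword_Nil wword_Cons wt_def)
  have cg: "GW i \<in> cartan_gens n" "GWinv i \<in> cartan_gens n" "GW' i \<in> cartan_gens n" "GWinv' i \<in> cartan_gens n"
    if "i \<in> {1..<n}" for i using that by (auto simp: cartan_gens_def)
  have Winv: "chi (cls n r s (mon [GWinv i])) = eigen (GWinv i)" "chi (cls n r s (mon [GWinv' i])) = eigen (GWinv' i)"
    if i: "i \<in> {1..<n}" for i
    using inv[OF cg(1,2)[OF i] R1[OF i]] inv[OF cg(3,4)[OF i] R1[OF i]] W[OF i]
    by (simp_all add: winv)
  have gen: "chi (cls n r s (mon [g])) = eigen g" if "g \<in> cartan_gens n \<union> GE ` {1..<n}" for g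
    using that by (auto simp: cartan_gens_def W Winv simp del: eigen.simps)
  have minus: "chi (\<ominus>\<^bsub>U\<^esub> a) = - chi a" if a: "a \<in> B" for a
  proof -
    interpret U: ring U by (rule ring_U)
    have "\<ominus>\<^bsub>U\<^esub> a \<in> B" using a unfolding borel_subalg_def by (rule generate_ring.a_inv)
    moreover have "a \<in> carrier U" using a B_subset by blast
    moreover have "\<zero>\<^bsub>U\<^esub> \<in> B" unfolding borel_subalg_def by (rule U.zero_in_generate)
    \<comment> \<open>The second equation forces \<open>chi\<close> to vanish at zero; the first
      then gives compatibility with negation.\<close>
    ultimately have "chi \<zero>\<^bsub>U\<^esub> = chi a + chi (\<ominus>\<^bsub>U\<^esub> a)" "chi \<zero>\<^bsub>U\<^esub> = chi \<zero>\<^bsub>U\<^esub> + chi \<zero>\<^bsub>U\<^esub>"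
      using add[of a "\<ominus>\<^bsub>U\<^esub> a"] add[of "\<zero>\<^bsub>U\<^esub>" "\<zero>\<^bsub>U\<^esub>"] a by (simp_all add: U.r_neg)
    then show ?thesis by (simp add: add_eq_0_iff)
  qed
  show ?thesis using b[unfolded borel_subalg_def]
  proof (induction rule: generate_ring.induct)
    case one
    show ?case by (simp add: chi_one one_v sym_sum_closed)
  next
    case (incl h)
    then show ?case
    proof
      assume "h \<in> range (\<lambda>c. cls n r s (const c))"
      then obtain c where "h = cls n r s (const c)" by blast
      then show ?thesis by (simp add: const cls_v sym_sum_closed)
    next
      assume "h \<in> (\<lambda>g. cls n r s (mon [g])) ` (cartan_gens n \<union> GE ` {1..<n})"
      then obtain g where g: "g \<in> cartan_gens n \<union> GE ` {1..<n}" "h = cls n r s (mon [g])" by blast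
      show ?thesis using gen_eigen[OF g(1)] unfolding g(2) gen[OF g(1)] .
    qed
  next
    case (a_inv h)
    then have h: "h \<in> B" "h \<in> carrier U" using B_subset unfolding borel_subalg_def by blast+
    show ?case unfolding minus[OF h(1)] by (rule borel_add_eigen(3)[OF h(2) a_inv.IH h(2) a_inv.IH])
  next
    case (eng_add a b)
    then have h: "a \<in> B" "b \<in> B" "a \<in> carrier U" "b \<in> carrier U"
      using B_subset unfolding borel_subalg_def by blast+
    show ?case unfolding add[OF h(1,2)] by (rule borel_add_eigen(1)[OF h(3) eng_add.IH(1) h(4) eng_add.IH(2)])
  next
    case (eng_mult a b)
    then have h: "a \<in> B" "b \<in> B" "a \<in> carrier U" "b \<in> carrier U"
      using B_subset unfolding borel_subalg_def by blast+
    show ?case unfolding mult[OF h(1,2)] by (rule borel_add_eigen(2)[OF h(3) eng_mult.IH(1) h(4) eng_mult.IH(2)])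
  qed
qed

subsection \<open>The exterior power as a quotient of the Verma module\<close>

text \<open>The map sends the generator of the Verma module to the class of v. It is well defined
  because the Borel subalgebra acts on that class by the chosen character, and surjective because
  the class generates \<open>Q\<close>.\<close>

lemma quotient_of_verma:
  "\<exists>N. submodule N U (verma n r s (fund_weight k)) \<and> module_iso U (quot_module (verma n r s (fund_weight k)) N) Q"
proof -
  let ?W = "one_dim_module n r s (fund_weight k)"
  define chi where "chi = (SOME chi. is_borel_char n r s (fund_weight k) chi)"
  have chi: "is_borel_char n r s (fund_weight k) chi"
    unfolding chi_def by (rule someI[of "is_borel_char n r s (fund_weight k)", OF chi0_char])
  have W: "carrier ?W = UNIV" "x \<oplus>\<^bsub>?W\<^esub> y = x + y" "b \<odot>\<^bsub>?W\<^esub> x = chi b * x" for x y b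
    by (simp_all add: one_dim_module_def chi_def)
  interpret Ind: induced U B ?W
    by (rule induced.intro[OF ring_U B_subset]) (simp_all add: W)
  interpret QM: module_mod U "T k" S by (rule Q_mod)
  define \<psi> where "\<psi> c = S +>\<^bsub>T k\<^esub> tscale c v" for c
  have cv: "tscale c v \<in> tens_space n k" for c using tens_space_closed(4)[OF v_tens_space] .
  have "\<exists>\<Phi>. left_module_hom U (induced_module U B ?W) Q \<Phi> \<and> (\<forall>a\<in>carrier U. \<forall>w\<in>carrier ?W.
    \<exists>X\<in>carrier (induced_module U B ?W). \<Phi> X = a \<odot>\<^bsub>Q\<^esub> \<psi> w)"
  proof (rule Ind.induced_hom[OF QM.quot_left_module])
    show "\<psi> w \<in> carrier Q" for w
      unfolding \<psi>_def by (rule QM.coset_in_quot) (simp add: cv)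
    show "\<psi> (w \<oplus>\<^bsub>?W\<^esub> w') = \<psi> w \<oplus>\<^bsub>Q\<^esub> \<psi> w'" for w w'
      unfolding \<psi>_def W using QM.quot_add[of "tscale w v" "tscale w' v"] cv
      by (simp add: tvs.scale_left_distrib)
    show "\<psi> (b \<odot>\<^bsub>?W\<^esub> w) = b \<odot>\<^bsub>Q\<^esub> \<psi> w" if b: "b \<in> B" for b w
    proof -
      have bU: "b \<in> carrier U" using b B_subset by blast
      then obtain p where p: "p \<in> carrier A" "b = cls n r s p" by (rule UE)
      \<comment> \<open>Reduces \<open>B\<close>-linearity of \<psi> to the eigenvector property of
        v, which holds modulo S only.\<close>
      have "tscale (chi b * w) v - act r s p (tscale w v) = tscale (- w) (act r s p v - tscale (chi b) v)"
        by (simp add: tvs.scale_right_diff_distrib mult.commute)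
      also have "\<dots> \<in> S"
        by (rule sym_sum_closed(4)) (use char_eigen[OF chi b] in \<open>simp add: p cls_v\<close>)
      finally have "S +>\<^bsub>T k\<^esub> tscale (chi b * w) v = S +>\<^bsub>T k\<^esub> act r s p (tscale w v)"
        using coset_eq_iff'[OF cv act_tens_space[OF p(1) cv]] by blast
      also have "act r s p (tscale w v) = b \<odot>\<^bsub>T k\<^esub> tscale w v"
        unfolding p(2) by (rule tens_smult[OF p(1) cv, symmetric])
      also have "S +>\<^bsub>T k\<^esub> (b \<odot>\<^bsub>T k\<^esub> tscale w v) = b \<odot>\<^bsub>Q\<^esub> (S +>\<^bsub>T k\<^esub> tscale w v)"
        by (rule QM.quot_smult[symmetric, OF bU]) (simp add: cv)
      finally show ?thesis unfolding \<psi>_def W .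
    qed
  qed
  then obtain \<Phi> where \<Phi>: "left_module_hom U (induced_module U B ?W) Q \<Phi>"
    and im: "\<And>a w. a \<in> carrier U \<Longrightarrow> \<exists>X\<in>carrier (induced_module U B ?W). \<Phi> X = a \<odot>\<^bsub>Q\<^esub> \<psi> w"
    using W by blast
  have "\<exists>X\<in>carrier (induced_module U B ?W). \<Phi> X = Y" if Y: "Y \<in> carrier Q" for Y
  proof -
    obtain x where x: "x \<in> carrier (T k)" "Y = S +>\<^bsub>T k\<^esub> x" using QM.quot_memE[OF Y] by blast
    then have xT: "x \<in> tens_space n k" by simp
    \<comment> \<open>Cyclicity applied to v itself, which lies outside S by the functional.\<close>
    obtain p where p: "p \<in> carrier A" "x - act r s p v \<in> S"
      using cyclic[OF v_tens_space v_notin_S xT] by blast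
    have "Y = S +>\<^bsub>T k\<^esub> act r s p v"
      using coset_eq_iff'[OF xT act_tens_space[OF p(1) v_tens_space]] p(2) x(2) by blast
    also have "act r s p v = cls n r s p \<odot>\<^bsub>T k\<^esub> v" by (rule cls_v[OF p(1), symmetric])
    also have "S +>\<^bsub>T k\<^esub> (cls n r s p \<odot>\<^bsub>T k\<^esub> v) = cls n r s p \<odot>\<^bsub>Q\<^esub> (S +>\<^bsub>T k\<^esub> v)"
      by (rule QM.quot_smult[symmetric, OF cls_in_U[OF p(1)]]) (simp add: v_tens_space)
    also have "S +>\<^bsub>T k\<^esub> v = \<psi> 1" by (simp add: \<psi>_def)
    finally have "Y = cls n r s p \<odot>\<^bsub>Q\<^esub> \<psi> 1" .
    with im[OF cls_in_U[OF p(1)], of 1] show ?thesis by simp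
  qed
  then show ?thesis
    using left_module.ex_first_iso[OF Ind.induced_left_module QM.quot_left_module \<Phi>]
    unfolding verma_def by blast
qed

end

theorem theorem4p3:
  fixes n k :: nat and r s :: complex
  assumes "n \<ge> 2" and "r \<noteq> 0" and "s \<noteq> 0" and "r \<noteq> s"
    and "1 \<le> k" and "k \<le> n - 1"
  shows "\<exists>L. simple_quotient (Urs n r s) (verma n r s (fund_weight k)) L \<and>
      module_iso (Urs n r s) (quot_module (tens_power n r s k) (sym_sum n s k)) L"
proof -
  interpret exterior n r s k by unfold_locales (use assms in auto)
  obtain N where N: "submodule N U (verma n r s (fund_weight k))"
    and iso: "module_iso U (quot_module (verma n r s (fund_weight k)) N) Q"
    using quotient_of_verma by blast
  have "simple_module U (quot_module (verma n r s (fund_weight k)) N)"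
    by (rule module_iso_simple[OF iso Q_simple])
  with N have "simple_quotient U (verma n r s (fund_weight k)) (quot_module (verma n r s (fund_weight k)) N)"
    unfolding simple_quotient_def by blast
  with module_iso_sym[OF iso] show ?thesis by blast
qed

end
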